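(* Let $f: A\to B$ and $g: A\to C$ be two ring homomorphisms and let $J$ and $J'$ be proper ideals of $B$ and $C$, respectively, such that $I_{o}:=f^{-1}(J)=g^{-1}(J')$. Let $A\bowtie^{f,g}(J,J')$ denote the bi-amalgamation of $A$ with $(B,C)$ along $(J,J')$ with respect to $(f,g)$. Consider the following conditions, taken together: $f(A)+J$ and $g(A)+J'$ are Noetherian semihereditary rings; $J\cap\operatorname{Nil}(B)=0$; $J'\cap\operatorname{Nil}(C)=0$; and, for every $\mathfrak{m}\in\operatorname{Max}(A,I_{o})$, $J_{S_{\mathfrak{m}}}=0$ or $J'_{S'_{\mathfrak{m}}}=0$. If all these conditions hold, then $A\bowtie^{f,g}(J,J')$ is a Noetherian semihereditary ring. The converse holds if $I_{o}$ is a radical ideal of $A$; that is, if $I_o$ is radical and $A\bowtie^{f,g}(J,J')$ is a Noetherian semihereditary ring, then all these conditions hold.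
   Context: All rings are commutative with unity. A ring $R$ is semihereditary if every finitely generated ideal of $R$ is projective. $\operatorname{Nil}(R)$ denotes the nilradical of a ring $R$. The bi-amalgamation is the subring of $B\times C$ given by $A\bowtie^{f,g}(J,J'):=\{(f(a)+j,\,g(a)+j')\mid a\in A,\ (j,j')\in J\times J'\}$. Here $f(A)+J$ and $g(A)+J'$ are regarded as subrings of $B$ and $C$, respectively. $\operatorname{Max}(A,I_{o})$ is the set of maximal ideals of $A$ containing $I_{o}$. For $\mathfrak{m}\in\operatorname{Max}(A,I_{o})$, $S_{\mathfrak{m}}:=f(A\setminus\mathfrak{m})+J=\{f(s)+j\mid s\in A\setminus\mathfrak{m},\ j\in J\}$ and $S'_{\mathfrak{m}}:=g(A\setminus\mathfrak{m})+J'=\{g(s)+j'\mid s\in A\setminus\mathfrak{m},\ j'\in J'\}$, which are multiplicative subsets of $B$ and $C$, respectively; $J_{S_{\mathfrak{m}}}$ denotes the localization $S_{\mathfrak{m}}^{-1}J$ (an ideal of $S_{\mathfrak{m}}^{-1}B$) and $J'_{S'_{\mathfrak{m}}}$ denotes $S_{\mathfrak{m}}'^{-1}J'$ (an ideal of $S_{\mathfrak{m}}'^{-1}C$). *)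

theory Defs
  imports "HOL-Algebra.Ring_Divisibility" "HOL-Algebra.Chinese_Remainder"
    "HOL-Algebra.Subrings" "HOL-Algebra.Module"
begin

section \<open>Projective modules and semihereditary rings\<close>

definition module_hom ::
  "('a, 'm) ring_scheme \<Rightarrow> ('a, 'p, 'k) module_scheme \<Rightarrow> ('a, 'q, 'l) module_scheme \<Rightarrow> ('p \<Rightarrow> 'q) set"
  where "module_hom R M N =
    {h. h \<in> carrier M \<rightarrow> carrier N
      \<and> (\<forall>x\<in>carrier M. \<forall>y\<in>carrier M. h (x \<oplus>\<^bsub>M\<^esub> y) = h x \<oplus>\<^bsub>N\<^esub> h y)
      \<and> (\<forall>a\<in>carrier R. \<forall>x\<in>carrier M. h (a \<odot>\<^bsub>M\<^esub> x) = a \<odot>\<^bsub>N\<^esub> h x)}"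

text \<open>
  Projectivity as the lifting property against surjections \<open>N \<rightarrow> M\<close>.  A definition cannot
  quantify over the types of the elements of \<open>M\<close> and \<open>N\<close>, so two types are fixed here; they
  accommodate \<open>P\<close> itself and the free module on the set \<open>P\<close>.  Lemma
  \<open>projective_module_lift\<close> below gives the lifting property for modules over arbitrary types,
  so nothing is lost.
\<close>

definition projective_module ::
  "('a, 'm) ring_scheme \<Rightarrow> ('a, 'p) module \<Rightarrow> bool"
  where "projective_module R P \<longleftrightarrow> module R P \<and>
    (\<forall>(M :: ('a, 'p) module) (N :: ('a, 'p \<Rightarrow> 'a) module) e h.
       module R M \<and> module R N \<and>
       e \<in> module_hom R N M \<and> e ` carrier N = carrier M \<and> h \<in> module_hom R P M
       \<longrightarrow> (\<exists>k \<in> module_hom R P N. \<forall>x\<in>carrier P. e (k x) = h x))"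

definition ideal_module :: "('a, 'm) ring_scheme \<Rightarrow> 'a set \<Rightarrow> ('a, 'a) module"
  where "ideal_module R I =
    \<lparr>carrier = I, monoid.mult = (\<otimes>\<^bsub>R\<^esub>), one = \<one>\<^bsub>R\<^esub>, ring.zero = \<zero>\<^bsub>R\<^esub>,
     add = (\<oplus>\<^bsub>R\<^esub>), smult = (\<otimes>\<^bsub>R\<^esub>)\<rparr>"

definition semihereditary :: "('a, 'm) ring_scheme \<Rightarrow> bool"
  where "semihereditary R \<longleftrightarrow> cring R \<and>
    (\<forall>I. ideal I R \<and> (\<exists>S \<subseteq> carrier R. finite S \<and> I = Idl\<^bsub>R\<^esub> S)
         \<longrightarrow> projective_module R (ideal_module R I))"


section \<open>Radicals and localizations\<close>

definition ring_radical :: "('a, 'm) ring_scheme \<Rightarrow> 'a set \<Rightarrow> 'a set"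
  where "ring_radical R I = {x \<in> carrier R. \<exists>n::nat. n > 0 \<and> x [^]\<^bsub>R\<^esub> n \<in> I}"

definition nilradical :: "('a, 'm) ring_scheme \<Rightarrow> 'a set"
  where "nilradical R = ring_radical R {\<zero>\<^bsub>R\<^esub>}"

definition max_ideals_over :: "('a, 'm) ring_scheme \<Rightarrow> 'a set \<Rightarrow> 'a set set"
  where "max_ideals_over R I = {\<mm>. maximalideal \<mm> R \<and> I \<subseteq> \<mm>}"

definition mult_subset :: "('a, 'm) ring_scheme \<Rightarrow> 'a set \<Rightarrow> bool"
  where "mult_subset R S \<longleftrightarrow> S \<subseteq> carrier R \<and> \<one>\<^bsub>R\<^esub> \<in> S \<and> (\<forall>s\<in>S. \<forall>t\<in>S. s \<otimes>\<^bsub>R\<^esub> t \<in> S)"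

definition frac_rel :: "('a, 'm) ring_scheme \<Rightarrow> 'a set \<Rightarrow> (('a \<times> 'a) \<times> ('a \<times> 'a)) set"
  where "frac_rel R S =
    {((r, s), (r', s')). r \<in> carrier R \<and> r' \<in> carrier R \<and> s \<in> S \<and> s' \<in> S \<and>
       (\<exists>t\<in>S. t \<otimes>\<^bsub>R\<^esub> (s' \<otimes>\<^bsub>R\<^esub> r \<ominus>\<^bsub>R\<^esub> s \<otimes>\<^bsub>R\<^esub> r') = \<zero>\<^bsub>R\<^esub>)}"

definition loc_frac :: "('a, 'm) ring_scheme \<Rightarrow> 'a set \<Rightarrow> 'a \<Rightarrow> 'a \<Rightarrow> ('a \<times> 'a) set"
  where "loc_frac R S r s = frac_rel R S `` {(r, s)}"

text \<open>
  In \<open>mult\<close> and \<open>add\<close>, the union runs over all representatives; since the resulting class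
  does not depend on them, it is a union of copies of one and the same class
  (lemmas \<open>mult_frac\<close> and \<open>add_frac\<close>).
\<close>

definition localization :: "('a, 'm) ring_scheme \<Rightarrow> 'a set \<Rightarrow> ('a \<times> 'a) set ring"
  where "localization R S =
    \<lparr>carrier = {loc_frac R S r s | r s. r \<in> carrier R \<and> s \<in> S},
     monoid.mult = (\<lambda>X Y. \<Union>(r, s)\<in>X. \<Union>(r', s')\<in>Y. loc_frac R S (r \<otimes>\<^bsub>R\<^esub> r') (s \<otimes>\<^bsub>R\<^esub> s')),
     one = loc_frac R S \<one>\<^bsub>R\<^esub> \<one>\<^bsub>R\<^esub>,
     ring.zero = loc_frac R S \<zero>\<^bsub>R\<^esub> \<one>\<^bsub>R\<^esub>,
     add = (\<lambda>X Y. \<Union>(r, s)\<in>X. \<Union>(r', s')\<in>Y.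
              loc_frac R S (s' \<otimes>\<^bsub>R\<^esub> r \<oplus>\<^bsub>R\<^esub> s \<otimes>\<^bsub>R\<^esub> r') (s \<otimes>\<^bsub>R\<^esub> s'))\<rparr>"

definition local_ideal :: "('a, 'm) ring_scheme \<Rightarrow> 'a set \<Rightarrow> 'a set \<Rightarrow> ('a \<times> 'a) set set"
  where "local_ideal R S J = {loc_frac R S j s | j s. j \<in> J \<and> s \<in> S}"


section \<open>Bi-amalgamations\<close>

definition bi_amalgamation ::
  "('a, 'k) ring_scheme \<Rightarrow> ('b, 'm) ring_scheme \<Rightarrow> ('c, 'n) ring_scheme \<Rightarrow>
   ('a \<Rightarrow> 'b) \<Rightarrow> ('a \<Rightarrow> 'c) \<Rightarrow> 'b set \<Rightarrow> 'c set \<Rightarrow> ('b \<times> 'c) ring"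
  where "bi_amalgamation A B C f g J J' =
    (RDirProd B C)\<lparr>carrier :=
       {(f a \<oplus>\<^bsub>B\<^esub> j, g a \<oplus>\<^bsub>C\<^esub> j') | a j j'. a \<in> carrier A \<and> j \<in> J \<and> j' \<in> J'}\<rparr>"

definition image_plus_ideal ::
  "('a, 'k) ring_scheme \<Rightarrow> ('b, 'm) ring_scheme \<Rightarrow> ('a \<Rightarrow> 'b) \<Rightarrow> 'b set \<Rightarrow> ('b, 'm) ring_scheme"
  where "image_plus_ideal A B f J = B\<lparr>carrier := f ` carrier A <+>\<^bsub>B\<^esub> J\<rparr>"

definition image_mult_set ::
  "('a, 'k) ring_scheme \<Rightarrow> ('b, 'm) ring_scheme \<Rightarrow> ('a \<Rightarrow> 'b) \<Rightarrow> 'b set \<Rightarrow> 'a set \<Rightarrow> 'b set"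
  where "image_mult_set A B f J \<mm> = f ` (carrier A - \<mm>) <+>\<^bsub>B\<^esub> J"


section \<open>Consistency of the definitions\<close>

subsection \<open>Lifting against modules of arbitrary types\<close>

definition free_module :: "('a, 'm) ring_scheme \<Rightarrow> 'p set \<Rightarrow> ('a, 'p \<Rightarrow> 'a) module"
  where "free_module R X =
    \<lparr>carrier = {u. (\<forall>x. u x \<in> carrier R) \<and> {x. u x \<noteq> \<zero>\<^bsub>R\<^esub>} \<subseteq> X \<and> finite {x. u x \<noteq> \<zero>\<^bsub>R\<^esub>}},
     monoid.mult = undefined, one = undefined, ring.zero = (\<lambda>_. \<zero>\<^bsub>R\<^esub>),
     add = (\<lambda>u v x. u x \<oplus>\<^bsub>R\<^esub> v x), smult = (\<lambda>a u x. a \<otimes>\<^bsub>R\<^esub> u x)\<rparr>"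

lemma module_free_module:
  assumes "cring R" shows "module R (free_module R X)"
proof -
  interpret R: cring R by fact
  show ?thesis
  proof (rule moduleI[OF assms])
    show "abelian_group (free_module R X)"
    proof (rule abelian_groupI)
      fix u v assume u: "u \<in> carrier (free_module R X)" and v: "v \<in> carrier (free_module R X)"
      have "{x. u x \<oplus>\<^bsub>R\<^esub> v x \<noteq> \<zero>\<^bsub>R\<^esub>} \<subseteq> {x. u x \<noteq> \<zero>\<^bsub>R\<^esub>} \<union> {x. v x \<noteq> \<zero>\<^bsub>R\<^esub>}"
        using u v by (auto simp: free_module_def)
      moreover have "finite ({x. u x \<noteq> \<zero>\<^bsub>R\<^esub>} \<union> {x. v x \<noteq> \<zero>\<^bsub>R\<^esub>})"
        using u v by (auto simp: free_module_def)
      ultimately show "u \<oplus>\<^bsub>free_module R X\<^esub> v \<in> carrier (free_module R X)"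
        using u v by (auto simp: free_module_def intro: finite_subset)
    next
      show "\<zero>\<^bsub>free_module R X\<^esub> \<in> carrier (free_module R X)"
        by (simp add: free_module_def)
    next
      fix u assume u: "u \<in> carrier (free_module R X)"
      have *: "{x. \<ominus>\<^bsub>R\<^esub> u x \<noteq> \<zero>\<^bsub>R\<^esub>} = {x. u x \<noteq> \<zero>\<^bsub>R\<^esub>}"
        using u by (auto simp: free_module_def)
      show "\<exists>v\<in>carrier (free_module R X). v \<oplus>\<^bsub>free_module R X\<^esub> u = \<zero>\<^bsub>free_module R X\<^esub>"
        by (rule bexI[of _ "\<lambda>x. \<ominus>\<^bsub>R\<^esub> u x"])
           (use u * in \<open>auto simp: free_module_def R.l_neg\<close>)
    qed (auto simp: free_module_def R.a_ac)
  next
    fix a u assume a: "a \<in> carrier R" and u: "u \<in> carrier (free_module R X)"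
    have "{x. a \<otimes>\<^bsub>R\<^esub> u x \<noteq> \<zero>\<^bsub>R\<^esub>} \<subseteq> {x. u x \<noteq> \<zero>\<^bsub>R\<^esub>}"
      using a by auto
    then show "a \<odot>\<^bsub>free_module R X\<^esub> u \<in> carrier (free_module R X)"
      using a u by (auto simp: free_module_def intro: finite_subset)
  qed (auto simp: free_module_def R.l_distr R.r_distr R.m_assoc)
qed

definition linear_extension ::
  "('a, 'm) ring_scheme \<Rightarrow> ('a, 'q, 'l) module_scheme \<Rightarrow> ('p \<Rightarrow> 'q) \<Rightarrow> ('p \<Rightarrow> 'a) \<Rightarrow> 'q"
  where "linear_extension R N y u = (\<Oplus>\<^bsub>N\<^esub> x\<in>{x. u x \<noteq> \<zero>\<^bsub>R\<^esub>}. u x \<odot>\<^bsub>N\<^esub> y x)"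

lemma linear_extension_superset:
  assumes "module R N" and u: "u \<in> carrier (free_module R X)" and y: "y \<in> X \<rightarrow> carrier N"
    and "finite T" "{x. u x \<noteq> \<zero>\<^bsub>R\<^esub>} \<subseteq> T" "T \<subseteq> X"
  shows "linear_extension R N y u = (\<Oplus>\<^bsub>N\<^esub> x\<in>T. u x \<odot>\<^bsub>N\<^esub> y x)"
proof -
  interpret module R N by fact
  show ?thesis unfolding linear_extension_def
    by (rule M.add.finprod_mono_neutral_cong_left)
       (use assms in \<open>auto simp: free_module_def Pi_iff subset_iff\<close>)
qed

lemma linear_extension_hom:
  assumes "module R N" and y: "y \<in> X \<rightarrow> carrier N"
  shows "linear_extension R N y \<in> module_hom R (free_module R X) N"
proof -
  interpret module R N by fact
  let ?F = "free_module R X"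
  interpret F: module R ?F by (rule module_free_module) (rule R.is_cring)
  have uc: "u x \<in> carrier R" if "u \<in> carrier ?F" for u x
    using that by (simp add: free_module_def)
  have yc: "y x \<in> carrier N" if "x \<in> X" for x using y that by auto
  have fin: "finite {x. u x \<noteq> \<zero>\<^bsub>R\<^esub>}" and sub: "{x. u x \<noteq> \<zero>\<^bsub>R\<^esub>} \<subseteq> X" if "u \<in> carrier ?F" for u
    using that by (auto simp: free_module_def)
  have closed: "linear_extension R N y u \<in> carrier N" if "u \<in> carrier ?F" for u
    unfolding linear_extension_def
    by (rule M.finsum_closed) (use uc[OF that] yc sub[OF that] in \<open>auto simp: subset_iff\<close>)
  have add: "linear_extension R N y (u \<oplus>\<^bsub>?F\<^esub> v) = linear_extension R N y u \<oplus>\<^bsub>N\<^esub> linear_extension R N y v"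
    if u: "u \<in> carrier ?F" and v: "v \<in> carrier ?F" for u v
  proof -
    let ?T = "{x. u x \<noteq> \<zero>\<^bsub>R\<^esub>} \<union> {x. v x \<noteq> \<zero>\<^bsub>R\<^esub>}"
    have T: "finite ?T" "?T \<subseteq> X" using fin sub u v by auto
    have uv: "u \<oplus>\<^bsub>?F\<^esub> v \<in> carrier ?F" using u v by simp
    have "{x. (u \<oplus>\<^bsub>?F\<^esub> v) x \<noteq> \<zero>\<^bsub>R\<^esub>} \<subseteq> ?T" by (auto simp: free_module_def)
    then have "linear_extension R N y (u \<oplus>\<^bsub>?F\<^esub> v) = (\<Oplus>\<^bsub>N\<^esub> x\<in>?T. (u \<oplus>\<^bsub>?F\<^esub> v) x \<odot>\<^bsub>N\<^esub> y x)"
      by (intro linear_extension_superset[OF assms(1) uv y]) (use T in auto)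
    also have "\<dots> = (\<Oplus>\<^bsub>N\<^esub> x\<in>?T. u x \<odot>\<^bsub>N\<^esub> y x \<oplus>\<^bsub>N\<^esub> v x \<odot>\<^bsub>N\<^esub> y x)"
      by (rule M.finsum_cong')
         (use T uc u v yc in \<open>auto simp: free_module_def smult_l_distr subset_iff Pi_iff\<close>)
    also have "\<dots> = (\<Oplus>\<^bsub>N\<^esub> x\<in>?T. u x \<odot>\<^bsub>N\<^esub> y x) \<oplus>\<^bsub>N\<^esub> (\<Oplus>\<^bsub>N\<^esub> x\<in>?T. v x \<odot>\<^bsub>N\<^esub> y x)"
      by (rule M.finsum_addf) (use T uc u v yc in \<open>auto simp: subset_iff Pi_iff\<close>)
    also have "(\<Oplus>\<^bsub>N\<^esub> x\<in>?T. u x \<odot>\<^bsub>N\<^esub> y x) = linear_extension R N y u"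
      by (rule linear_extension_superset[OF assms(1) u y, symmetric]) (use T in auto)
    also have "(\<Oplus>\<^bsub>N\<^esub> x\<in>?T. v x \<odot>\<^bsub>N\<^esub> y x) = linear_extension R N y v"
      by (rule linear_extension_superset[OF assms(1) v y, symmetric]) (use T in auto)
    finally show ?thesis .
  qed
  have smult: "linear_extension R N y (a \<odot>\<^bsub>?F\<^esub> u) = a \<odot>\<^bsub>N\<^esub> linear_extension R N y u"
    if a: "a \<in> carrier R" and u: "u \<in> carrier ?F" for a u
  proof -
    let ?T = "{x. u x \<noteq> \<zero>\<^bsub>R\<^esub>}"
    have au: "a \<odot>\<^bsub>?F\<^esub> u \<in> carrier ?F" using a u by simp
    have "{x. (a \<odot>\<^bsub>?F\<^esub> u) x \<noteq> \<zero>\<^bsub>R\<^esub>} \<subseteq> ?T" using a by (auto simp: free_module_def)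
    then have "linear_extension R N y (a \<odot>\<^bsub>?F\<^esub> u) = (\<Oplus>\<^bsub>N\<^esub> x\<in>?T. (a \<odot>\<^bsub>?F\<^esub> u) x \<odot>\<^bsub>N\<^esub> y x)"
      by (intro linear_extension_superset[OF assms(1) au y]) (use fin sub u in auto)
    also have "\<dots> = (\<Oplus>\<^bsub>N\<^esub> x\<in>?T. a \<odot>\<^bsub>N\<^esub> (u x \<odot>\<^bsub>N\<^esub> y x))"
    proof (rule M.finsum_cong'[OF refl])
      show "(\<lambda>x. a \<odot>\<^bsub>N\<^esub> (u x \<odot>\<^bsub>N\<^esub> y x)) \<in> ?T \<rightarrow> carrier N"
        using a uc[OF u] yc sub[OF u] by (auto simp: subset_iff)
      fix x assume "x \<in> ?T"
      then have "x \<in> X" using sub[OF u] by auto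
      then show "(a \<odot>\<^bsub>?F\<^esub> u) x \<odot>\<^bsub>N\<^esub> y x = a \<odot>\<^bsub>N\<^esub> (u x \<odot>\<^bsub>N\<^esub> y x)"
        using a uc[OF u] yc by (simp add: free_module_def smult_assoc1)
    qed
    also have "\<dots> = a \<odot>\<^bsub>N\<^esub> linear_extension R N y u"
      unfolding linear_extension_def
      by (rule finsum_smult_ldistr[symmetric])
         (use fin[OF u] a uc[OF u] yc sub[OF u] in \<open>auto simp: subset_iff\<close>)
    finally show ?thesis .
  qed
  show ?thesis using closed add smult by (auto simp: module_hom_def)
qed

lemma linear_extension_single:
  assumes "module R N" "x \<in> X" "y x \<in> carrier N"
  shows "(\<lambda>z. if z = x then \<one>\<^bsub>R\<^esub> else \<zero>\<^bsub>R\<^esub>) \<in> carrier (free_module R X)"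
    and "linear_extension R N y (\<lambda>z. if z = x then \<one>\<^bsub>R\<^esub> else \<zero>\<^bsub>R\<^esub>) = y x"
proof -
  interpret module R N by fact
  let ?u = "\<lambda>z. if z = x then \<one>\<^bsub>R\<^esub> else \<zero>\<^bsub>R\<^esub>"
  have "finite {z. ?u z \<noteq> \<zero>\<^bsub>R\<^esub>}" by (rule finite_subset[of _ "{x}"]) auto
  then show u: "?u \<in> carrier (free_module R X)"
    using assms(2) by (auto simp: free_module_def)
  then have u': "?u \<in> carrier (free_module R {x})"
    by (auto simp: free_module_def)
  have "linear_extension R N y ?u = (\<Oplus>\<^bsub>N\<^esub> z\<in>{x}. ?u z \<odot>\<^bsub>N\<^esub> y z)"
    by (rule linear_extension_superset[OF assms(1) u']) (use assms(3) in auto)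
  also have "\<dots> = y x" using assms(3) by simp
  finally show "linear_extension R N y ?u = y x" .
qed

lemma module_hom_finsum:
  assumes "module R M" "module R N" "h \<in> module_hom R M N" "finite T" "v \<in> T \<rightarrow> carrier M"
  shows "h (\<Oplus>\<^bsub>M\<^esub> x\<in>T. v x) = (\<Oplus>\<^bsub>N\<^esub> x\<in>T. h (v x))"
proof -
  interpret M: module R M by fact
  interpret N: module R N by fact
  have "h \<zero>\<^bsub>M\<^esub> = h (\<zero>\<^bsub>R\<^esub> \<odot>\<^bsub>M\<^esub> \<zero>\<^bsub>M\<^esub>)" by simp
  also have "\<dots> = \<zero>\<^bsub>R\<^esub> \<odot>\<^bsub>N\<^esub> h \<zero>\<^bsub>M\<^esub>"
    using assms(3) M.R.zero_closed M.M.zero_closed unfolding module_hom_def by blast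
  also have "h \<zero>\<^bsub>M\<^esub> \<in> carrier N" using assms(3) by (auto simp: module_hom_def)
  then have "\<zero>\<^bsub>R\<^esub> \<odot>\<^bsub>N\<^esub> h \<zero>\<^bsub>M\<^esub> = \<zero>\<^bsub>N\<^esub>" by simp
  finally have z: "h \<zero>\<^bsub>M\<^esub> = \<zero>\<^bsub>N\<^esub>" .
  from assms(4,5) show ?thesis
  proof (induction T rule: finite_induct)
    case empty then show ?case using z by simp
  next
    case (insert x T)
    have v: "v x \<in> carrier M" "v \<in> T \<rightarrow> carrier M" using insert.prems by auto
    have hv: "(\<lambda>x. h (v x)) \<in> T \<rightarrow> carrier N" "h (v x) \<in> carrier N"
      using v assms(3) by (auto simp: module_hom_def)
    have "h (\<Oplus>\<^bsub>M\<^esub> z\<in>insert x T. v z) = h (v x \<oplus>\<^bsub>M\<^esub> (\<Oplus>\<^bsub>M\<^esub> z\<in>T. v z))"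
      using insert.hyps v by simp
    also have "\<dots> = h (v x) \<oplus>\<^bsub>N\<^esub> h (\<Oplus>\<^bsub>M\<^esub> z\<in>T. v z)"
      using assms(3) v M.M.finsum_closed[OF v(2)] by (auto simp: module_hom_def)
    also have "\<dots> = (\<Oplus>\<^bsub>N\<^esub> z\<in>insert x T. h (v z))"
      using insert hv v by simp
    finally show ?case .
  qed
qed

lemma projective_module_lift:
  fixes M :: "('a, 'q, 'k) module_scheme" and N :: "('a, 'r, 'l) module_scheme"
  assumes proj: "projective_module R P" and M: "module R M" and N: "module R N"
    and e: "e \<in> module_hom R N M" and surj: "e ` carrier N = carrier M"
    and h: "h \<in> module_hom R P M"
  shows "\<exists>k \<in> module_hom R P N. \<forall>x\<in>carrier P. e (k x) = h x"
proof -
  have P: "module R P" using proj by (simp add: projective_module_def)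
  interpret P: module R P by fact
  interpret M: module R M by fact
  interpret N: module R N by fact
  let ?F = "free_module R (carrier P)"
  have F: "module R ?F" by (rule module_free_module) (rule P.R.is_cring)
  let ?p = "linear_extension R P (\<lambda>x. x)"
  have p: "?p \<in> module_hom R ?F P" by (rule linear_extension_hom[OF P]) auto
  have psurj: "?p ` carrier ?F = carrier P"
  proof
    show "?p ` carrier ?F \<subseteq> carrier P" using p by (auto simp: module_hom_def)
    show "carrier P \<subseteq> ?p ` carrier ?F"
    proof
      fix x assume x: "x \<in> carrier P"
      show "x \<in> ?p ` carrier ?F"
        using linear_extension_single[OF P x, of "\<lambda>x. x", OF x] by (metis image_eqI)
    qed
  qed
  have "(\<lambda>x. x) \<in> module_hom R P P" by (auto simp: module_hom_def)
  then obtain s where s: "s \<in> module_hom R P ?F" and ps: "\<And>x. x \<in> carrier P \<Longrightarrow> ?p (s x) = x"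
    using proj P F p psurj unfolding projective_module_def by blast
  have "\<forall>x\<in>carrier P. \<exists>n\<in>carrier N. e n = h x"
  proof
    fix x assume "x \<in> carrier P"
    then have "h x \<in> e ` carrier N" using h surj by (auto simp: module_hom_def)
    then show "\<exists>n\<in>carrier N. e n = h x" by (metis imageE)
  qed
  then obtain y where y: "\<And>x. x \<in> carrier P \<Longrightarrow> y x \<in> carrier N"
      and ey: "\<And>x. x \<in> carrier P \<Longrightarrow> e (y x) = h x"
    by metis
  let ?q = "linear_extension R N y"
  have q: "?q \<in> module_hom R ?F N" by (rule linear_extension_hom[OF N]) (use y in auto)
  have eq: "e (?q u) = h (?p u)" if u: "u \<in> carrier ?F" for u
  proof -
    let ?T = "{x. u x \<noteq> \<zero>\<^bsub>R\<^esub>}"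
    have T: "finite ?T" "?T \<subseteq> carrier P" and uc: "\<And>x. u x \<in> carrier R"
      using u by (auto simp: free_module_def)
    have xP: "x \<in> carrier P" if "x \<in> ?T" for x using that T by auto
    have v: "(\<lambda>x. u x \<odot>\<^bsub>N\<^esub> y x) \<in> ?T \<rightarrow> carrier N"
      and w: "(\<lambda>x. u x \<odot>\<^bsub>P\<^esub> x) \<in> ?T \<rightarrow> carrier P"
      by (intro Pi_I N.smult_closed P.smult_closed uc y xP; assumption)+
    have "e (?q u) = (\<Oplus>\<^bsub>M\<^esub> x\<in>?T. e (u x \<odot>\<^bsub>N\<^esub> y x))"
      unfolding linear_extension_def
      by (rule module_hom_finsum[OF N M e T(1) v])
    also have "\<dots> = (\<Oplus>\<^bsub>M\<^esub> x\<in>?T. h (u x \<odot>\<^bsub>P\<^esub> x))"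
    proof (rule M.M.finsum_cong'[OF refl])
      show "(\<lambda>x. h (u x \<odot>\<^bsub>P\<^esub> x)) \<in> ?T \<rightarrow> carrier M"
        using h uc xP by (auto simp: module_hom_def)
      fix x assume "x \<in> ?T"
      then have x: "x \<in> carrier P" by (rule xP)
      have "e (u x \<odot>\<^bsub>N\<^esub> y x) = u x \<odot>\<^bsub>M\<^esub> e (y x)"
        using e uc y[OF x] by (simp add: module_hom_def)
      also have "\<dots> = h (u x \<odot>\<^bsub>P\<^esub> x)"
        using h uc x ey[OF x] by (simp add: module_hom_def)
      finally show "e (u x \<odot>\<^bsub>N\<^esub> y x) = h (u x \<odot>\<^bsub>P\<^esub> x)" .
    qed
    also have "\<dots> = h (?p u)"
      unfolding linear_extension_def
      by (rule module_hom_finsum[OF P M h T(1) w, symmetric])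
    finally show ?thesis .
  qed
  show ?thesis
  proof (rule bexI[of _ "?q \<circ> s"])
    show "?q \<circ> s \<in> module_hom R P N"
      using q s by (auto simp: module_hom_def Pi_iff)
    show "\<forall>x\<in>carrier P. e ((?q \<circ> s) x) = h x"
      using eq ps s by (auto simp: module_hom_def Pi_iff)
  qed
qed

lemma module_ideal_module:
  assumes "cring R" "ideal I R" shows "module R (ideal_module R I)"
proof -
  interpret cring R by fact
  interpret I: ideal I R by fact
  have I: "x \<in> carrier R" if "x \<in> I" for x using that by (rule I.Icarr)
  have "abelian_group (ideal_module R I)"
    by (rule abelian_groupI)
       (auto simp: ideal_module_def I a_ac r_neg intro!: bexI[of _ "\<ominus>\<^bsub>R\<^esub> _"])
  then show ?thesis
    by (intro moduleI[OF assms(1)])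
       (auto simp: ideal_module_def I l_distr r_distr m_assoc intro: I.I_l_closed)
qed


subsection \<open>The localization\<close>

lemma frac_rel_iff:
  assumes "cring R" "mult_subset R S" "r \<in> carrier R" "r' \<in> carrier R" "s \<in> S" "s' \<in> S"
  shows "((r, s), (r', s')) \<in> frac_rel R S \<longleftrightarrow>
    (\<exists>t\<in>S. t \<otimes>\<^bsub>R\<^esub> s' \<otimes>\<^bsub>R\<^esub> r = t \<otimes>\<^bsub>R\<^esub> s \<otimes>\<^bsub>R\<^esub> r')"
proof -
  interpret cring R by fact
  have S: "x \<in> carrier R" if "x \<in> S" for x using assms(2) that by (auto simp: mult_subset_def)
  have "t \<otimes>\<^bsub>R\<^esub> (s' \<otimes>\<^bsub>R\<^esub> r \<ominus>\<^bsub>R\<^esub> s \<otimes>\<^bsub>R\<^esub> r') = \<zero>\<^bsub>R\<^esub> \<longleftrightarrow> t \<otimes>\<^bsub>R\<^esub> s' \<otimes>\<^bsub>R\<^esub> r = t \<otimes>\<^bsub>R\<^esub> s \<otimes>\<^bsub>R\<^esub> r'" if "t \<in> S" for t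
  proof -
    have "t \<otimes>\<^bsub>R\<^esub> (s' \<otimes>\<^bsub>R\<^esub> r \<ominus>\<^bsub>R\<^esub> s \<otimes>\<^bsub>R\<^esub> r') = t \<otimes>\<^bsub>R\<^esub> s' \<otimes>\<^bsub>R\<^esub> r \<ominus>\<^bsub>R\<^esub> t \<otimes>\<^bsub>R\<^esub> s \<otimes>\<^bsub>R\<^esub> r'"
      using that S assms by (simp add: a_minus_def r_distr r_minus m_assoc)
    then show ?thesis using that S assms by simp
  qed
  then show ?thesis using assms by (auto simp: frac_rel_def)
qed

lemma equiv_frac_rel:
  assumes "cring R" "mult_subset R S"
  shows "equiv (carrier R \<times> S) (frac_rel R S)"
proof -
  interpret cring R by fact
  have S: "x \<in> carrier R" if "x \<in> S" for x using assms(2) that by (auto simp: mult_subset_def)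
  have one: "\<one>\<^bsub>R\<^esub> \<in> S" and mult: "\<And>s t. s \<in> S \<Longrightarrow> t \<in> S \<Longrightarrow> s \<otimes>\<^bsub>R\<^esub> t \<in> S"
    using assms(2) by (auto simp: mult_subset_def)
  note iff = frac_rel_iff[OF assms]
  show ?thesis
  proof (rule equivI)
    show "frac_rel R S \<subseteq> (carrier R \<times> S) \<times> (carrier R \<times> S)" by (auto simp: frac_rel_def)
    show "refl_on (carrier R \<times> S) (frac_rel R S)"
      using one by (auto simp: refl_on_def iff)
    show "sym (frac_rel R S)"
    proof (rule symI, clarify)
      fix r s r' s' assume *: "((r, s), (r', s')) \<in> frac_rel R S"
      then have "r \<in> carrier R" "r' \<in> carrier R" "s \<in> S" "s' \<in> S" by (auto simp: frac_rel_def)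
      with * show "((r', s'), (r, s)) \<in> frac_rel R S" by (metis iff)
    qed
    show "trans (frac_rel R S)"
    proof (rule transI, clarify)
      fix a b c d p q
      assume 1: "((a, b), (c, d)) \<in> frac_rel R S" and 2: "((c, d), (p, q)) \<in> frac_rel R S"
      then have c: "a \<in> carrier R" "c \<in> carrier R" "p \<in> carrier R" "b \<in> S" "d \<in> S" "q \<in> S"
        by (auto simp: frac_rel_def)
      obtain t where t: "t \<in> S" "t \<otimes>\<^bsub>R\<^esub> d \<otimes>\<^bsub>R\<^esub> a = t \<otimes>\<^bsub>R\<^esub> b \<otimes>\<^bsub>R\<^esub> c" using 1 c by (auto simp: iff)
      obtain u where u: "u \<in> S" "u \<otimes>\<^bsub>R\<^esub> q \<otimes>\<^bsub>R\<^esub> c = u \<otimes>\<^bsub>R\<^esub> d \<otimes>\<^bsub>R\<^esub> p" using 2 c by (auto simp: iff)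
      note cl = c t(1) u(1) S
      have "(t \<otimes>\<^bsub>R\<^esub> u \<otimes>\<^bsub>R\<^esub> d) \<otimes>\<^bsub>R\<^esub> q \<otimes>\<^bsub>R\<^esub> a = (u \<otimes>\<^bsub>R\<^esub> q) \<otimes>\<^bsub>R\<^esub> (t \<otimes>\<^bsub>R\<^esub> d \<otimes>\<^bsub>R\<^esub> a)"
        using cl by (simp add: m_ac)
      also have "\<dots> = (t \<otimes>\<^bsub>R\<^esub> b) \<otimes>\<^bsub>R\<^esub> (u \<otimes>\<^bsub>R\<^esub> q \<otimes>\<^bsub>R\<^esub> c)"
        unfolding t(2) using cl by (simp add: m_ac)
      also have "\<dots> = (t \<otimes>\<^bsub>R\<^esub> u \<otimes>\<^bsub>R\<^esub> d) \<otimes>\<^bsub>R\<^esub> b \<otimes>\<^bsub>R\<^esub> p"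
        unfolding u(2) using cl by (simp add: m_ac)
      finally show "((a, b), (p, q)) \<in> frac_rel R S"
        using c mult t(1) u(1) by (auto simp: iff)
    qed
  qed
qed

lemma frac_eq_iff:
  assumes "cring R" "mult_subset R S" "r \<in> carrier R" "r' \<in> carrier R" "s \<in> S" "s' \<in> S"
  shows "loc_frac R S r s = loc_frac R S r' s' \<longleftrightarrow>
    (\<exists>t\<in>S. t \<otimes>\<^bsub>R\<^esub> s' \<otimes>\<^bsub>R\<^esub> r = t \<otimes>\<^bsub>R\<^esub> s \<otimes>\<^bsub>R\<^esub> r')"
  using eq_equiv_class_iff[OF equiv_frac_rel[OF assms(1,2)]] assms
  by (simp add: loc_frac_def frac_rel_iff)

lemma frac_in_quotient:
  assumes "r \<in> carrier R" "s \<in> S" shows "loc_frac R S r s \<in> (carrier R \<times> S) // frac_rel R S"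
  using assms by (auto simp: loc_frac_def quotient_def)

lemma mem_frac_iff:
  assumes "cring R" "mult_subset R S" "r \<in> carrier R" "s \<in> S"
  shows "(r', s') \<in> loc_frac R S r s \<longleftrightarrow> r' \<in> carrier R \<and> s' \<in> S \<and> loc_frac R S r' s' = loc_frac R S r s"
  using eq_equiv_class_iff[OF equiv_frac_rel[OF assms(1,2)], of "(r, s)" "(r', s')"] assms(3,4)
  by (auto simp: loc_frac_def frac_rel_def)

lemma UN_pairs_const:
  assumes "p \<in> U" "q \<in> V"
    and "\<And>a b a' b'. (a, b) \<in> U \<Longrightarrow> (a', b') \<in> V \<Longrightarrow> F a b a' b' = c"
  shows "(\<Union>(a, b)\<in>U. \<Union>(a', b')\<in>V. F a b a' b') = c"
proof -
  have "(\<Union>(a, b)\<in>U. \<Union>(a', b')\<in>V. F a b a' b') = (\<Union>x\<in>U. \<Union>y\<in>V. c)"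
    using assms(3) by (intro SUP_cong refl) (auto split: prod.splits)
  then show ?thesis using assms(1,2) by auto
qed

lemma mult_frac:
  assumes "cring R" "mult_subset R S" "r \<in> carrier R" "r' \<in> carrier R" "s \<in> S" "s' \<in> S"
  shows "loc_frac R S r s \<otimes>\<^bsub>localization R S\<^esub> loc_frac R S r' s' = loc_frac R S (r \<otimes>\<^bsub>R\<^esub> r') (s \<otimes>\<^bsub>R\<^esub> s')"
proof -
  interpret cring R by fact
  have S: "x \<in> carrier R" if "x \<in> S" for x using assms(2) that by (auto simp: mult_subset_def)
  have one: "\<one>\<^bsub>R\<^esub> \<in> S" and mult: "\<And>s t. s \<in> S \<Longrightarrow> t \<in> S \<Longrightarrow> s \<otimes>\<^bsub>R\<^esub> t \<in> S"
    using assms(2) by (auto simp: mult_subset_def)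
  have *: "loc_frac R S (a \<otimes>\<^bsub>R\<^esub> a') (b \<otimes>\<^bsub>R\<^esub> b') = loc_frac R S (r \<otimes>\<^bsub>R\<^esub> r') (s \<otimes>\<^bsub>R\<^esub> s')"
    if "(a, b) \<in> loc_frac R S r s" "(a', b') \<in> loc_frac R S r' s'" for a b a' b'
  proof -
    have c: "a \<in> carrier R" "b \<in> S" "a' \<in> carrier R" "b' \<in> S"
      and e: "loc_frac R S a b = loc_frac R S r s" "loc_frac R S a' b' = loc_frac R S r' s'"
      using that assms by (auto simp: mem_frac_iff)
    obtain t where t: "t \<in> S" "t \<otimes>\<^bsub>R\<^esub> s \<otimes>\<^bsub>R\<^esub> a = t \<otimes>\<^bsub>R\<^esub> b \<otimes>\<^bsub>R\<^esub> r"
      using e(1) c assms by (auto simp: frac_eq_iff)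
    obtain u where u: "u \<in> S" "u \<otimes>\<^bsub>R\<^esub> s' \<otimes>\<^bsub>R\<^esub> a' = u \<otimes>\<^bsub>R\<^esub> b' \<otimes>\<^bsub>R\<^esub> r'"
      using e(2) c assms by (auto simp: frac_eq_iff)
    note cl = c t(1) u(1) assms(3-6) S
    have "(t \<otimes>\<^bsub>R\<^esub> u) \<otimes>\<^bsub>R\<^esub> (s \<otimes>\<^bsub>R\<^esub> s') \<otimes>\<^bsub>R\<^esub> (a \<otimes>\<^bsub>R\<^esub> a') = (t \<otimes>\<^bsub>R\<^esub> s \<otimes>\<^bsub>R\<^esub> a) \<otimes>\<^bsub>R\<^esub> (u \<otimes>\<^bsub>R\<^esub> s' \<otimes>\<^bsub>R\<^esub> a')"
      using cl by (simp add: m_ac)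
    also have "\<dots> = (t \<otimes>\<^bsub>R\<^esub> u) \<otimes>\<^bsub>R\<^esub> (b \<otimes>\<^bsub>R\<^esub> b') \<otimes>\<^bsub>R\<^esub> (r \<otimes>\<^bsub>R\<^esub> r')"
      unfolding t(2) u(2) using cl by (simp add: m_ac)
    finally show ?thesis
      using c t(1) u(1) assms mult by (subst frac_eq_iff) auto
  qed
  have "(r, s) \<in> loc_frac R S r s" "(r', s') \<in> loc_frac R S r' s'"
    using assms by (auto simp: mem_frac_iff)
  then show ?thesis unfolding localization_def monoid.simps ring.simps
    by (rule UN_pairs_const) (rule *)
qed

lemma add_frac:
  assumes "cring R" "mult_subset R S" "r \<in> carrier R" "r' \<in> carrier R" "s \<in> S" "s' \<in> S"
  shows "loc_frac R S r s \<oplus>\<^bsub>localization R S\<^esub> loc_frac R S r' s' =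
    loc_frac R S (s' \<otimes>\<^bsub>R\<^esub> r \<oplus>\<^bsub>R\<^esub> s \<otimes>\<^bsub>R\<^esub> r') (s \<otimes>\<^bsub>R\<^esub> s')"
proof -
  interpret cring R by fact
  have S: "x \<in> carrier R" if "x \<in> S" for x using assms(2) that by (auto simp: mult_subset_def)
  have one: "\<one>\<^bsub>R\<^esub> \<in> S" and mult: "\<And>s t. s \<in> S \<Longrightarrow> t \<in> S \<Longrightarrow> s \<otimes>\<^bsub>R\<^esub> t \<in> S"
    using assms(2) by (auto simp: mult_subset_def)
  have *: "loc_frac R S (b' \<otimes>\<^bsub>R\<^esub> a \<oplus>\<^bsub>R\<^esub> b \<otimes>\<^bsub>R\<^esub> a') (b \<otimes>\<^bsub>R\<^esub> b') = loc_frac R S (s' \<otimes>\<^bsub>R\<^esub> r \<oplus>\<^bsub>R\<^esub> s \<otimes>\<^bsub>R\<^esub> r') (s \<otimes>\<^bsub>R\<^esub> s')"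
    if "(a, b) \<in> loc_frac R S r s" "(a', b') \<in> loc_frac R S r' s'" for a b a' b'
  proof -
    have c: "a \<in> carrier R" "b \<in> S" "a' \<in> carrier R" "b' \<in> S"
      and e: "loc_frac R S a b = loc_frac R S r s" "loc_frac R S a' b' = loc_frac R S r' s'"
      using that assms by (auto simp: mem_frac_iff)
    obtain t where t: "t \<in> S" "t \<otimes>\<^bsub>R\<^esub> s \<otimes>\<^bsub>R\<^esub> a = t \<otimes>\<^bsub>R\<^esub> b \<otimes>\<^bsub>R\<^esub> r"
      using e(1) c assms by (auto simp: frac_eq_iff)
    obtain u where u: "u \<in> S" "u \<otimes>\<^bsub>R\<^esub> s' \<otimes>\<^bsub>R\<^esub> a' = u \<otimes>\<^bsub>R\<^esub> b' \<otimes>\<^bsub>R\<^esub> r'"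
      using e(2) c assms by (auto simp: frac_eq_iff)
    note cl = c t(1) u(1) assms(3-6) S
    have "(t \<otimes>\<^bsub>R\<^esub> u) \<otimes>\<^bsub>R\<^esub> (s \<otimes>\<^bsub>R\<^esub> s') \<otimes>\<^bsub>R\<^esub> (b' \<otimes>\<^bsub>R\<^esub> a \<oplus>\<^bsub>R\<^esub> b \<otimes>\<^bsub>R\<^esub> a') =
        (u \<otimes>\<^bsub>R\<^esub> s' \<otimes>\<^bsub>R\<^esub> b') \<otimes>\<^bsub>R\<^esub> (t \<otimes>\<^bsub>R\<^esub> s \<otimes>\<^bsub>R\<^esub> a) \<oplus>\<^bsub>R\<^esub> (t \<otimes>\<^bsub>R\<^esub> s \<otimes>\<^bsub>R\<^esub> b) \<otimes>\<^bsub>R\<^esub> (u \<otimes>\<^bsub>R\<^esub> s' \<otimes>\<^bsub>R\<^esub> a')"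
      using cl by (simp add: r_distr m_ac)
    also have "\<dots> = (t \<otimes>\<^bsub>R\<^esub> u) \<otimes>\<^bsub>R\<^esub> (b \<otimes>\<^bsub>R\<^esub> b') \<otimes>\<^bsub>R\<^esub> (s' \<otimes>\<^bsub>R\<^esub> r \<oplus>\<^bsub>R\<^esub> s \<otimes>\<^bsub>R\<^esub> r')"
      unfolding t(2) u(2) using cl by (simp add: r_distr m_ac)
    finally show ?thesis
      using cl mult by (subst frac_eq_iff[OF assms(1,2)]) auto
  qed
  have "(r, s) \<in> loc_frac R S r s" "(r', s') \<in> loc_frac R S r' s'"
    using assms by (auto simp: mem_frac_iff)
  then show ?thesis unfolding localization_def monoid.simps ring.simps
    by (rule UN_pairs_const) (rule *)
qed

lemma cring_localization:
  assumes "cring R" "mult_subset R S" shows "cring (localization R S)"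
proof -
  interpret cring R by fact
  have S: "x \<in> carrier R" if "x \<in> S" for x using assms(2) that by (auto simp: mult_subset_def)
  have one: "\<one>\<^bsub>R\<^esub> \<in> S" and mult: "\<And>s t. s \<in> S \<Longrightarrow> t \<in> S \<Longrightarrow> s \<otimes>\<^bsub>R\<^esub> t \<in> S"
    using assms(2) by (auto simp: mult_subset_def)
  let ?L = "localization R S"
  note mf = mult_frac[OF assms] and af = add_frac[OF assms] and eqI = frac_eq_iff[OF assms, THEN iffD2]
  have C: "X \<in> carrier ?L \<longleftrightarrow> (\<exists>r s. r \<in> carrier R \<and> s \<in> S \<and> X = loc_frac R S r s)" for X
    by (auto simp: localization_def)
  have Z: "\<zero>\<^bsub>?L\<^esub> = loc_frac R S \<zero>\<^bsub>R\<^esub> \<one>\<^bsub>R\<^esub>" and O: "\<one>\<^bsub>?L\<^esub> = loc_frac R S \<one>\<^bsub>R\<^esub> \<one>\<^bsub>R\<^esub>"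
    by (simp_all add: localization_def)
  have ex: "\<exists>t\<in>S. t \<otimes>\<^bsub>R\<^esub> s' \<otimes>\<^bsub>R\<^esub> r = t \<otimes>\<^bsub>R\<^esub> s \<otimes>\<^bsub>R\<^esub> r'"
    if "s' \<otimes>\<^bsub>R\<^esub> r = s \<otimes>\<^bsub>R\<^esub> r'" "r \<in> carrier R" "r' \<in> carrier R" "s \<in> S" "s' \<in> S" for r r' s s'
    using that one S by (intro bexI[of _ "\<one>\<^bsub>R\<^esub>"]) auto
  have closed: "X \<oplus>\<^bsub>?L\<^esub> Y \<in> carrier ?L" "X \<otimes>\<^bsub>?L\<^esub> Y \<in> carrier ?L"
    if "X \<in> carrier ?L" "Y \<in> carrier ?L" for X Y
  proof -
    obtain a b where 1: "a \<in> carrier R" "b \<in> S" "X = loc_frac R S a b"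
      using \<open>X \<in> carrier ?L\<close> unfolding C by (elim exE conjE)
    obtain c d where 2: "c \<in> carrier R" "d \<in> S" "Y = loc_frac R S c d"
      using \<open>Y \<in> carrier ?L\<close> unfolding C by (elim exE conjE)
    note * = 1 2
    have c: "d \<otimes>\<^bsub>R\<^esub> a \<oplus>\<^bsub>R\<^esub> b \<otimes>\<^bsub>R\<^esub> c \<in> carrier R" "a \<otimes>\<^bsub>R\<^esub> c \<in> carrier R" "b \<otimes>\<^bsub>R\<^esub> d \<in> S"
      using *(1,2,4,5) S mult by auto
    show "X \<oplus>\<^bsub>?L\<^esub> Y \<in> carrier ?L"
      unfolding *(3,6) af[OF *(1,4,2,5)] C using c by blast
    show "X \<otimes>\<^bsub>?L\<^esub> Y \<in> carrier ?L"
      unfolding *(3,6) mf[OF *(1,4,2,5)] C using c by blast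
  qed
  have "abelian_group ?L"
  proof (rule abelian_groupI)
    fix X assume "X \<in> carrier ?L"
    then obtain r s where X: "r \<in> carrier R" "s \<in> S" "X = loc_frac R S r s" by (auto simp: C)
    show "\<zero>\<^bsub>?L\<^esub> \<oplus>\<^bsub>?L\<^esub> X = X"
      unfolding X Z using X(1,2) S one by (simp add: af)
    show "\<exists>Y\<in>carrier ?L. Y \<oplus>\<^bsub>?L\<^esub> X = \<zero>\<^bsub>?L\<^esub>"
    proof (rule bexI[of _ "loc_frac R S (\<ominus>\<^bsub>R\<^esub> r) s"])
      show "loc_frac R S (\<ominus>\<^bsub>R\<^esub> r) s \<in> carrier ?L" unfolding C using X by blast
      show "loc_frac R S (\<ominus>\<^bsub>R\<^esub> r) s \<oplus>\<^bsub>?L\<^esub> X = \<zero>\<^bsub>?L\<^esub>"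
        unfolding X Z using X(1,2) S one mult
        by (simp add: af r_minus l_neg) (rule eqI; (rule ex)?; simp)
    qed
  next
    show "\<zero>\<^bsub>?L\<^esub> \<in> carrier ?L" unfolding C Z using one by blast
  next
    fix X Y assume "X \<in> carrier ?L" "Y \<in> carrier ?L"
    then show "X \<oplus>\<^bsub>?L\<^esub> Y \<in> carrier ?L" by (rule closed)
    obtain a b where 1: "a \<in> carrier R" "b \<in> S" "X = loc_frac R S a b"
      using \<open>X \<in> carrier ?L\<close> unfolding C by (elim exE conjE)
    obtain c d where 2: "c \<in> carrier R" "d \<in> S" "Y = loc_frac R S c d"
      using \<open>Y \<in> carrier ?L\<close> unfolding C by (elim exE conjE)
    note * = 1 2
    show "X \<oplus>\<^bsub>?L\<^esub> Y = Y \<oplus>\<^bsub>?L\<^esub> X"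
      unfolding *(3,6) using *(1,2,4,5) S by (simp add: af a_comm m_comm)
  next
    fix X Y W assume "X \<in> carrier ?L" "Y \<in> carrier ?L" "W \<in> carrier ?L"
    obtain a b where 1: "a \<in> carrier R" "b \<in> S" "X = loc_frac R S a b"
      using \<open>X \<in> carrier ?L\<close> unfolding C by (elim exE conjE)
    obtain c d where 2: "c \<in> carrier R" "d \<in> S" "Y = loc_frac R S c d"
      using \<open>Y \<in> carrier ?L\<close> unfolding C by (elim exE conjE)
    obtain p q where 3: "p \<in> carrier R" "q \<in> S" "W = loc_frac R S p q"
      using \<open>W \<in> carrier ?L\<close> unfolding C by (elim exE conjE)
    note * = 1 2 3
    show "X \<oplus>\<^bsub>?L\<^esub> Y \<oplus>\<^bsub>?L\<^esub> W = X \<oplus>\<^bsub>?L\<^esub> (Y \<oplus>\<^bsub>?L\<^esub> W)"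
      unfolding *(3,6,9) using *(1,2,4,5,7,8) S mult by (simp add: af r_distr a_assoc m_ac)
  qed
  moreover have "comm_monoid ?L"
  proof (rule comm_monoidI)
    show "\<one>\<^bsub>?L\<^esub> \<in> carrier ?L" unfolding C O using one by blast
  next
    fix X assume "X \<in> carrier ?L"
    then obtain r s where X: "r \<in> carrier R" "s \<in> S" "X = loc_frac R S r s" by (auto simp: C)
    show "\<one>\<^bsub>?L\<^esub> \<otimes>\<^bsub>?L\<^esub> X = X"
      unfolding X O using X(1,2) S one by (simp add: mf)
  next
    fix X Y assume "X \<in> carrier ?L" "Y \<in> carrier ?L"
    then show "X \<otimes>\<^bsub>?L\<^esub> Y \<in> carrier ?L" by (rule closed)
    obtain a b where 1: "a \<in> carrier R" "b \<in> S" "X = loc_frac R S a b"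
      using \<open>X \<in> carrier ?L\<close> unfolding C by (elim exE conjE)
    obtain c d where 2: "c \<in> carrier R" "d \<in> S" "Y = loc_frac R S c d"
      using \<open>Y \<in> carrier ?L\<close> unfolding C by (elim exE conjE)
    note * = 1 2
    show "X \<otimes>\<^bsub>?L\<^esub> Y = Y \<otimes>\<^bsub>?L\<^esub> X"
      unfolding *(3,6) using *(1,2,4,5) S by (simp add: mf m_comm)
  next
    fix X Y W assume "X \<in> carrier ?L" "Y \<in> carrier ?L" "W \<in> carrier ?L"
    obtain a b where 1: "a \<in> carrier R" "b \<in> S" "X = loc_frac R S a b"
      using \<open>X \<in> carrier ?L\<close> unfolding C by (elim exE conjE)
    obtain c d where 2: "c \<in> carrier R" "d \<in> S" "Y = loc_frac R S c d"
      using \<open>Y \<in> carrier ?L\<close> unfolding C by (elim exE conjE)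
    obtain p q where 3: "p \<in> carrier R" "q \<in> S" "W = loc_frac R S p q"
      using \<open>W \<in> carrier ?L\<close> unfolding C by (elim exE conjE)
    note * = 1 2 3
    show "X \<otimes>\<^bsub>?L\<^esub> Y \<otimes>\<^bsub>?L\<^esub> W = X \<otimes>\<^bsub>?L\<^esub> (Y \<otimes>\<^bsub>?L\<^esub> W)"
      unfolding *(3,6,9) using *(1,2,4,5,7,8) S mult by (simp add: mf m_ac)
  qed
  moreover have "(X \<oplus>\<^bsub>?L\<^esub> Y) \<otimes>\<^bsub>?L\<^esub> W = X \<otimes>\<^bsub>?L\<^esub> W \<oplus>\<^bsub>?L\<^esub> Y \<otimes>\<^bsub>?L\<^esub> W"
    if "X \<in> carrier ?L" "Y \<in> carrier ?L" "W \<in> carrier ?L" for X Y W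
  proof -
    obtain a b where 1: "a \<in> carrier R" "b \<in> S" "X = loc_frac R S a b"
      using \<open>X \<in> carrier ?L\<close> unfolding C by (elim exE conjE)
    obtain c d where 2: "c \<in> carrier R" "d \<in> S" "Y = loc_frac R S c d"
      using \<open>Y \<in> carrier ?L\<close> unfolding C by (elim exE conjE)
    obtain p q where 3: "p \<in> carrier R" "q \<in> S" "W = loc_frac R S p q"
      using \<open>W \<in> carrier ?L\<close> unfolding C by (elim exE conjE)
    note * = 1 2 3
    note c = *(1,2,4,5,7,8)
    have "d \<otimes>\<^bsub>R\<^esub> a \<oplus>\<^bsub>R\<^esub> b \<otimes>\<^bsub>R\<^esub> c \<in> carrier R" using c S by simp
    then have l: "(X \<oplus>\<^bsub>?L\<^esub> Y) \<otimes>\<^bsub>?L\<^esub> W = loc_frac R S ((d \<otimes>\<^bsub>R\<^esub> a \<oplus>\<^bsub>R\<^esub> b \<otimes>\<^bsub>R\<^esub> c) \<otimes>\<^bsub>R\<^esub> p) (b \<otimes>\<^bsub>R\<^esub> d \<otimes>\<^bsub>R\<^esub> q)"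
      unfolding *(3,6,9) using c mult by (simp add: af mf)
    have r: "X \<otimes>\<^bsub>?L\<^esub> W \<oplus>\<^bsub>?L\<^esub> Y \<otimes>\<^bsub>?L\<^esub> W =
        loc_frac R S (d \<otimes>\<^bsub>R\<^esub> q \<otimes>\<^bsub>R\<^esub> (a \<otimes>\<^bsub>R\<^esub> p) \<oplus>\<^bsub>R\<^esub> b \<otimes>\<^bsub>R\<^esub> q \<otimes>\<^bsub>R\<^esub> (c \<otimes>\<^bsub>R\<^esub> p)) (b \<otimes>\<^bsub>R\<^esub> q \<otimes>\<^bsub>R\<^esub> (d \<otimes>\<^bsub>R\<^esub> q))"
      unfolding *(3,6,9) using c mult by (simp add: af mf)
    have "(b \<otimes>\<^bsub>R\<^esub> q \<otimes>\<^bsub>R\<^esub> (d \<otimes>\<^bsub>R\<^esub> q)) \<otimes>\<^bsub>R\<^esub> ((d \<otimes>\<^bsub>R\<^esub> a \<oplus>\<^bsub>R\<^esub> b \<otimes>\<^bsub>R\<^esub> c) \<otimes>\<^bsub>R\<^esub> p) =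
        (b \<otimes>\<^bsub>R\<^esub> d \<otimes>\<^bsub>R\<^esub> q) \<otimes>\<^bsub>R\<^esub> (d \<otimes>\<^bsub>R\<^esub> q \<otimes>\<^bsub>R\<^esub> (a \<otimes>\<^bsub>R\<^esub> p) \<oplus>\<^bsub>R\<^esub> b \<otimes>\<^bsub>R\<^esub> q \<otimes>\<^bsub>R\<^esub> (c \<otimes>\<^bsub>R\<^esub> p))"
      using c S by (simp add: l_distr r_distr m_ac)
    then show ?thesis unfolding l r
      by (intro eqI ex) (use c S mult in auto)
  qed
  ultimately show ?thesis by (rule cringI)
qed


subsection \<open>Bi-amalgamations\<close>

lemma mult_subset_image_mult_set:
  assumes "cring A" "cring B" and f: "f \<in> ring_hom A B" and "ideal J B" and \<mm>: "primeideal \<mm> A"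
  shows "mult_subset B (image_mult_set A B f J \<mm>)"
proof -
  interpret A: cring A by fact
  interpret B: cring B by fact
  interpret J: ideal J B by fact
  interpret P: primeideal \<mm> A by fact
  have mem: "x \<in> image_mult_set A B f J \<mm> \<longleftrightarrow>
      (\<exists>a j. a \<in> carrier A \<and> a \<notin> \<mm> \<and> j \<in> J \<and> x = f a \<oplus>\<^bsub>B\<^esub> j)" for x
    by (auto simp: image_mult_set_def set_add_def set_mult_def)
  have fc: "f a \<in> carrier B" if "a \<in> carrier A" for a using f that by (rule ring_hom_closed)
  have "\<one>\<^bsub>B\<^esub> \<in> image_mult_set A B f J \<mm>"
    unfolding mem
  proof (intro exI conjI)
    show "\<one>\<^bsub>A\<^esub> \<in> carrier A" by simp
    show "\<one>\<^bsub>A\<^esub> \<notin> \<mm>" using P.I_notcarr P.one_imp_carrier by blast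
    show "\<zero>\<^bsub>B\<^esub> \<in> J" by (rule J.zero_closed)
    show "\<one>\<^bsub>B\<^esub> = f \<one>\<^bsub>A\<^esub> \<oplus>\<^bsub>B\<^esub> \<zero>\<^bsub>B\<^esub>" using ring_hom_one[OF f] by simp
  qed
  moreover have "x \<otimes>\<^bsub>B\<^esub> y \<in> image_mult_set A B f J \<mm>"
    if x: "x \<in> image_mult_set A B f J \<mm>" and y: "y \<in> image_mult_set A B f J \<mm>" for x y
  proof -
    obtain a j where a: "a \<in> carrier A" "a \<notin> \<mm>" "j \<in> J" "x = f a \<oplus>\<^bsub>B\<^esub> j"
      using x unfolding mem by (elim exE conjE)
    obtain b k where b: "b \<in> carrier A" "b \<notin> \<mm>" "k \<in> J" "y = f b \<oplus>\<^bsub>B\<^esub> k"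
      using y unfolding mem by (elim exE conjE)
    have jk: "j \<in> carrier B" "k \<in> carrier B" using a b J.Icarr by auto
    show ?thesis unfolding mem
    proof (intro exI conjI)
      show "a \<otimes>\<^bsub>A\<^esub> b \<in> carrier A" using a b by simp
      show "a \<otimes>\<^bsub>A\<^esub> b \<notin> \<mm>" using a b P.I_prime by blast
      show "f a \<otimes>\<^bsub>B\<^esub> k \<oplus>\<^bsub>B\<^esub> j \<otimes>\<^bsub>B\<^esub> (f b \<oplus>\<^bsub>B\<^esub> k) \<in> J"
        using a b fc jk by (simp add: J.I_l_closed J.I_r_closed J.a_closed)
      show "x \<otimes>\<^bsub>B\<^esub> y = f (a \<otimes>\<^bsub>A\<^esub> b) \<oplus>\<^bsub>B\<^esub> (f a \<otimes>\<^bsub>B\<^esub> k \<oplus>\<^bsub>B\<^esub> j \<otimes>\<^bsub>B\<^esub> (f b \<oplus>\<^bsub>B\<^esub> k))"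
        unfolding a(4) b(4) using a b fc jk ring_hom_mult[OF f]
        by (simp add: B.l_distr B.r_distr B.a_ac)
    qed
  qed
  moreover have "image_mult_set A B f J \<mm> \<subseteq> carrier B"
    using fc J.Icarr by (auto simp: mem)
  ultimately show ?thesis by (auto simp: mult_subset_def)
qed

lemma ideal_local_ideal:
  assumes "cring R" "mult_subset R S" "ideal J R"
  shows "ideal (local_ideal R S J) (localization R S)"
proof -
  interpret cring R by fact
  interpret J: ideal J R by fact
  interpret L: cring "localization R S" by (rule cring_localization) fact+
  have S: "x \<in> carrier R" if "x \<in> S" for x using assms(2) that by (auto simp: mult_subset_def)
  have one: "\<one>\<^bsub>R\<^esub> \<in> S" and mult: "\<And>s t. s \<in> S \<Longrightarrow> t \<in> S \<Longrightarrow> s \<otimes>\<^bsub>R\<^esub> t \<in> S"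
    using assms(2) by (auto simp: mult_subset_def)
  let ?L = "localization R S"
  note mf = mult_frac[OF assms(1,2)] and af = add_frac[OF assms(1,2)]
  have C: "X \<in> carrier ?L \<longleftrightarrow> (\<exists>r s. r \<in> carrier R \<and> s \<in> S \<and> X = loc_frac R S r s)" for X
    by (auto simp: localization_def)
  have I: "X \<in> local_ideal R S J \<longleftrightarrow> (\<exists>j s. j \<in> J \<and> s \<in> S \<and> X = loc_frac R S j s)" for X
    by (auto simp: local_ideal_def)
  have sub: "X \<in> carrier ?L" if "X \<in> local_ideal R S J" for X
    using that J.Icarr unfolding I C by (elim exE conjE) (intro exI conjI)
  have z: "\<zero>\<^bsub>?L\<^esub> \<in> local_ideal R S J"
    unfolding I using one J.zero_closed by (intro exI conjI) (auto simp: localization_def)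
  have add: "X \<oplus>\<^bsub>?L\<^esub> Y \<in> local_ideal R S J"
    if X: "X \<in> local_ideal R S J" and Y: "Y \<in> local_ideal R S J" for X Y
  proof -
    obtain a b where 1: "a \<in> J" "b \<in> S" "X = loc_frac R S a b"
      using X unfolding I by (elim exE conjE)
    obtain c d where 2: "c \<in> J" "d \<in> S" "Y = loc_frac R S c d"
      using Y unfolding I by (elim exE conjE)
    have "d \<otimes>\<^bsub>R\<^esub> a \<oplus>\<^bsub>R\<^esub> b \<otimes>\<^bsub>R\<^esub> c \<in> J"
      using 1 2 S by (simp add: J.I_l_closed J.a_closed)
    then show ?thesis
      unfolding 1(3) 2(3) af[OF J.Icarr[OF 1(1)] J.Icarr[OF 2(1)] 1(2) 2(2)] I
      using mult[OF 1(2) 2(2)] by (intro exI conjI) (assumption | rule refl)+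
  qed
  have mul: "Y \<otimes>\<^bsub>?L\<^esub> X \<in> local_ideal R S J"
    if X: "X \<in> local_ideal R S J" and Y: "Y \<in> carrier ?L" for X Y
  proof -
    obtain a b where 1: "a \<in> J" "b \<in> S" "X = loc_frac R S a b"
      using X unfolding I by (elim exE conjE)
    obtain c d where 2: "c \<in> carrier R" "d \<in> S" "Y = loc_frac R S c d"
      using Y unfolding C by (elim exE conjE)
    have "c \<otimes>\<^bsub>R\<^esub> a \<in> J" using 1 2 by (simp add: J.I_l_closed)
    then show ?thesis
      unfolding 1(3) 2(3) mf[OF 2(1) J.Icarr[OF 1(1)] 2(2) 1(2)] I
      using mult[OF 2(2) 1(2)] by (intro exI conjI) (assumption | rule refl)+
  qed
  have neg: "\<ominus>\<^bsub>?L\<^esub> X \<in> local_ideal R S J" if X: "X \<in> local_ideal R S J" for X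
  proof -
    have "\<ominus>\<^bsub>?L\<^esub> X = (\<ominus>\<^bsub>?L\<^esub> \<one>\<^bsub>?L\<^esub>) \<otimes>\<^bsub>?L\<^esub> X" using sub[OF X] by (simp add: L.l_minus)
    then show ?thesis using mul[OF X, of "\<ominus>\<^bsub>?L\<^esub> \<one>\<^bsub>?L\<^esub>"] by simp
  qed
  show ?thesis
  proof (rule idealI)
    show "ring ?L" by (rule L.ring_axioms)
    show "subgroup (local_ideal R S J) (add_monoid ?L)"
      by (rule L.add.subgroupI) (use sub z add neg in \<open>auto simp: a_inv_def\<close>)
    fix X Y assume X: "X \<in> local_ideal R S J" and Y: "Y \<in> carrier ?L"
    show "Y \<otimes>\<^bsub>?L\<^esub> X \<in> local_ideal R S J" by (rule mul[OF X Y])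
    then show "X \<otimes>\<^bsub>?L\<^esub> Y \<in> local_ideal R S J" using L.m_comm[OF sub[OF X] Y] by simp
  qed
qed

lemma cring_image_plus_ideal:
  assumes "cring A" "cring B" and f: "f \<in> ring_hom A B" and "ideal J B"
  shows "cring (image_plus_ideal A B f J)"
proof -
  interpret A: cring A by fact
  interpret B: cring B by fact
  interpret J: ideal J B by fact
  let ?K = "f ` carrier A <+>\<^bsub>B\<^esub> J"
  have mem: "x \<in> ?K \<longleftrightarrow> (\<exists>a j. a \<in> carrier A \<and> j \<in> J \<and> x = f a \<oplus>\<^bsub>B\<^esub> j)" for x
    by (auto simp: set_add_def set_mult_def)
  have fc: "f a \<in> carrier B" if "a \<in> carrier A" for a using f that by (rule ring_hom_closed)
  interpret f: ring_hom_cring A B f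
    by (rule RingHom.ring_hom_cringI[OF ring_hom_ringI2[OF A.ring_axioms B.ring_axioms f] A.is_cring B.is_cring])
  have "subring ?K B"
  proof (rule B.subringI)
    show "?K \<subseteq> carrier B" using fc J.Icarr by (auto simp: mem)
    show "\<one>\<^bsub>B\<^esub> \<in> ?K" unfolding mem
      by (rule exI[of _ "\<one>\<^bsub>A\<^esub>"], rule exI[of _ "\<zero>\<^bsub>B\<^esub>"]) (simp add: J.zero_closed)
  next
    fix x assume "x \<in> ?K"
    then obtain a j where a: "a \<in> carrier A" "j \<in> J" "x = f a \<oplus>\<^bsub>B\<^esub> j" unfolding mem by (elim exE conjE)
    show "\<ominus>\<^bsub>B\<^esub> x \<in> ?K" unfolding mem
      by (rule exI[of _ "\<ominus>\<^bsub>A\<^esub> a"], rule exI[of _ "\<ominus>\<^bsub>B\<^esub> j"])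
         (use a fc J.Icarr in \<open>simp add: B.minus_add J.a_inv_closed\<close>)
  next
    fix x y assume x: "x \<in> ?K" and y: "y \<in> ?K"
    obtain a j where a: "a \<in> carrier A" "j \<in> J" "x = f a \<oplus>\<^bsub>B\<^esub> j"
      using x unfolding mem by (elim exE conjE)
    obtain b k where b: "b \<in> carrier A" "k \<in> J" "y = f b \<oplus>\<^bsub>B\<^esub> k"
      using y unfolding mem by (elim exE conjE)
    have jk: "j \<in> carrier B" "k \<in> carrier B" using a b J.Icarr by auto
    show "x \<otimes>\<^bsub>B\<^esub> y \<in> ?K" unfolding mem
    proof (intro exI conjI)
      show "a \<otimes>\<^bsub>A\<^esub> b \<in> carrier A" using a b by simp
      show "f a \<otimes>\<^bsub>B\<^esub> k \<oplus>\<^bsub>B\<^esub> j \<otimes>\<^bsub>B\<^esub> (f b \<oplus>\<^bsub>B\<^esub> k) \<in> J"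
        using a b fc jk by (simp add: J.I_l_closed J.I_r_closed J.a_closed)
      show "x \<otimes>\<^bsub>B\<^esub> y = f (a \<otimes>\<^bsub>A\<^esub> b) \<oplus>\<^bsub>B\<^esub> (f a \<otimes>\<^bsub>B\<^esub> k \<oplus>\<^bsub>B\<^esub> j \<otimes>\<^bsub>B\<^esub> (f b \<oplus>\<^bsub>B\<^esub> k))"
        unfolding a(3) b(3) using a b fc jk by (simp add: B.l_distr B.r_distr B.a_ac)
    qed
    show "x \<oplus>\<^bsub>B\<^esub> y \<in> ?K" unfolding mem
      by (rule exI[of _ "a \<oplus>\<^bsub>A\<^esub> b"], rule exI[of _ "j \<oplus>\<^bsub>B\<^esub> k"])
         (use a b fc jk in \<open>simp add: B.a_ac J.a_closed\<close>)
  qed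
  then show ?thesis unfolding image_plus_ideal_def
    using B.subcring_iff[OF subringE(1)] B.subcringI' by blast
qed

lemma cring_RDirProd:
  assumes "cring B" "cring C" shows "cring (RDirProd B C)"
proof -
  interpret B: cring B by fact
  interpret C: cring C by fact
  interpret D: ring "RDirProd B C" by (rule RDirProd_ring[OF B.ring_axioms C.ring_axioms])
  have "comm_monoid_axioms (RDirProd B C)"
    by unfold_locales
       (auto simp: RDirProd_def DirProd_def monoid.defs B.m_comm C.m_comm)
  then show ?thesis
    by (intro cring.intro comm_monoid.intro D.ring_axioms D.monoid_axioms)
qed

lemma cring_bi_amalgamation:
  assumes "cring A" "cring B" "cring C" and f: "f \<in> ring_hom A B" and g: "g \<in> ring_hom A C"
    and "ideal J B" "ideal J' C"
  shows "cring (bi_amalgamation A B C f g J J')"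
proof -
  interpret A: cring A by fact
  interpret B: cring B by fact
  interpret C: cring C by fact
  interpret J: ideal J B by fact
  interpret J': ideal J' C by fact
  interpret D: cring "RDirProd B C" by (rule cring_RDirProd) fact+
  interpret f: ring_hom_cring A B f
    by (rule RingHom.ring_hom_cringI[OF ring_hom_ringI2[OF A.ring_axioms B.ring_axioms f] A.is_cring B.is_cring])
  interpret g: ring_hom_cring A C g
    by (rule RingHom.ring_hom_cringI[OF ring_hom_ringI2[OF A.ring_axioms C.ring_axioms g] A.is_cring C.is_cring])
  let ?D = "RDirProd B C"
  let ?K = "{(f a \<oplus>\<^bsub>B\<^esub> j, g a \<oplus>\<^bsub>C\<^esub> j') | a j j'. a \<in> carrier A \<and> j \<in> J \<and> j' \<in> J'}"
  have mem: "x \<in> ?K \<longleftrightarrow> (\<exists>a j j'. a \<in> carrier A \<and> j \<in> J \<and> j' \<in> J' \<and>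
      x = (f a \<oplus>\<^bsub>B\<^esub> j, g a \<oplus>\<^bsub>C\<^esub> j'))" for x by auto
  have car: "carrier ?D = carrier B \<times> carrier C" by (rule RDirProd_carrier)
  have ops: "(b, c) \<oplus>\<^bsub>?D\<^esub> (b', c') = (b \<oplus>\<^bsub>B\<^esub> b', c \<oplus>\<^bsub>C\<^esub> c')"
    "(b, c) \<otimes>\<^bsub>?D\<^esub> (b', c') = (b \<otimes>\<^bsub>B\<^esub> b', c \<otimes>\<^bsub>C\<^esub> c')"
    "\<zero>\<^bsub>?D\<^esub> = (\<zero>\<^bsub>B\<^esub>, \<zero>\<^bsub>C\<^esub>)" "\<one>\<^bsub>?D\<^esub> = (\<one>\<^bsub>B\<^esub>, \<one>\<^bsub>C\<^esub>)" for b c b' c'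
    by (simp_all add: RDirProd_def DirProd_def monoid.defs)
  have neg: "\<ominus>\<^bsub>?D\<^esub> (b, c) = (\<ominus>\<^bsub>B\<^esub> b, \<ominus>\<^bsub>C\<^esub> c)" if "b \<in> carrier B" "c \<in> carrier C" for b c
    by (rule D.minus_equality) (use that in \<open>auto simp: ops car B.l_neg C.l_neg\<close>)
  have "subring ?K ?D"
  proof (rule D.subringI)
    show "?K \<subseteq> carrier ?D" by (auto simp: car J.Icarr J'.Icarr)
    show "\<one>\<^bsub>?D\<^esub> \<in> ?K" unfolding mem
      by (rule exI[of _ "\<one>\<^bsub>A\<^esub>"], rule exI[of _ "\<zero>\<^bsub>B\<^esub>"], rule exI[of _ "\<zero>\<^bsub>C\<^esub>"])
         (simp add: ops J.zero_closed J'.zero_closed)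
  next
    fix x assume "x \<in> ?K"
    then obtain a j j' where a: "a \<in> carrier A" "j \<in> J" "j' \<in> J'"
      "x = (f a \<oplus>\<^bsub>B\<^esub> j, g a \<oplus>\<^bsub>C\<^esub> j')" unfolding mem by (elim exE conjE)
    show "\<ominus>\<^bsub>?D\<^esub> x \<in> ?K" unfolding mem
      by (rule exI[of _ "\<ominus>\<^bsub>A\<^esub> a"], rule exI[of _ "\<ominus>\<^bsub>B\<^esub> j"], rule exI[of _ "\<ominus>\<^bsub>C\<^esub> j'"])
         (use a J.Icarr J'.Icarr in
           \<open>simp add: neg B.minus_add C.minus_add J.a_inv_closed J'.a_inv_closed\<close>)
  next
    fix x y assume x: "x \<in> ?K" and y: "y \<in> ?K"
    obtain a j j' where a: "a \<in> carrier A" "j \<in> J" "j' \<in> J'"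
      "x = (f a \<oplus>\<^bsub>B\<^esub> j, g a \<oplus>\<^bsub>C\<^esub> j')" using x unfolding mem by (elim exE conjE)
    obtain b k k' where b: "b \<in> carrier A" "k \<in> J" "k' \<in> J'"
      "y = (f b \<oplus>\<^bsub>B\<^esub> k, g b \<oplus>\<^bsub>C\<^esub> k')" using y unfolding mem by (elim exE conjE)
    have jk: "j \<in> carrier B" "k \<in> carrier B" "j' \<in> carrier C" "k' \<in> carrier C"
      using a b J.Icarr J'.Icarr by auto
    show "x \<otimes>\<^bsub>?D\<^esub> y \<in> ?K" unfolding mem
    proof (intro exI conjI)
      show "a \<otimes>\<^bsub>A\<^esub> b \<in> carrier A" using a b by simp
      show "f a \<otimes>\<^bsub>B\<^esub> k \<oplus>\<^bsub>B\<^esub> j \<otimes>\<^bsub>B\<^esub> (f b \<oplus>\<^bsub>B\<^esub> k) \<in> J"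
        using a b jk by (simp add: J.I_l_closed J.I_r_closed J.a_closed)
      show "g a \<otimes>\<^bsub>C\<^esub> k' \<oplus>\<^bsub>C\<^esub> j' \<otimes>\<^bsub>C\<^esub> (g b \<oplus>\<^bsub>C\<^esub> k') \<in> J'"
        using a b jk by (simp add: J'.I_l_closed J'.I_r_closed J'.a_closed)
      show "x \<otimes>\<^bsub>?D\<^esub> y = (f (a \<otimes>\<^bsub>A\<^esub> b) \<oplus>\<^bsub>B\<^esub> (f a \<otimes>\<^bsub>B\<^esub> k \<oplus>\<^bsub>B\<^esub> j \<otimes>\<^bsub>B\<^esub> (f b \<oplus>\<^bsub>B\<^esub> k)),
          g (a \<otimes>\<^bsub>A\<^esub> b) \<oplus>\<^bsub>C\<^esub> (g a \<otimes>\<^bsub>C\<^esub> k' \<oplus>\<^bsub>C\<^esub> j' \<otimes>\<^bsub>C\<^esub> (g b \<oplus>\<^bsub>C\<^esub> k')))"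
        unfolding a(4) b(4) using a(1) b(1) jk
        by (simp add: ops B.l_distr B.r_distr B.a_ac C.l_distr C.r_distr C.a_ac)
    qed
    show "x \<oplus>\<^bsub>?D\<^esub> y \<in> ?K" unfolding mem
      by (rule exI[of _ "a \<oplus>\<^bsub>A\<^esub> b"], rule exI[of _ "j \<oplus>\<^bsub>B\<^esub> k"], rule exI[of _ "j' \<oplus>\<^bsub>C\<^esub> k'"])
         (use a b jk in \<open>simp add: ops B.a_ac C.a_ac J.a_closed J'.a_closed\<close>)
  qed
  then show ?thesis unfolding bi_amalgamation_def
    using D.subcring_iff[OF subringE(1)] D.subcringI' by blast
qed

end

theory Submission
  imports Defs
begin

text \<open>
  Put \<open>D = A \<bowtie>\<^sup>f\<^sup>,\<^sup>g (J, J')\<close>, \<open>R = f(A) + J\<close> and \<open>R' = g(A) + J'\<close>.  The two projections map \<open>D\<close> onto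
  \<open>R\<close> and \<open>R'\<close>; their kernels \<open>K' = 0 \<times> J'\<close> and \<open>K = J \<times> 0\<close> intersect in zero, and
  \<open>D / (K' + K)\<close> is \<open>A / I\<^sub>o\<close>.  So the theorem is about a subdirect product of two rings.

  A Noetherian ring is semihereditary iff all its localizations at maximal ideals are valuation
  domains.  One direction evaluates the dual basis of a projective ideal \<open>(x, y)\<close>
  (\<open>semihereditary_valuation_at\<close>, \<open>semihereditary_domain_at\<close>); the other shows that a finitely
  generated ideal is locally zero or free on one generator, and patches local liftings
  (\<open>noetherian_semihereditaryI\<close>).  All local statements are expressed by denominators outside the
  maximal ideal, so no ring of fractions has to be handled.

  Let \<open>P\<close> be a maximal ideal of \<open>D\<close>.  Since \<open>K K' = 0\<close>, an element of one kernel outside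
  \<open>P\<close> annihilates the other kernel; so if \<open>P\<close> fails to contain one of them, then the other vanishes
  at \<open>P\<close>.  If \<open>P\<close> contains both, it comes from some \<open>\<mm>\<close> in \<open>Max(A, I\<^sub>o)\<close>, and the hypothesis on
  \<open>J\<^bsub>S\<^sub>\<mm>\<^esub>\<close> and \<open>J'\<^bsub>S'\<^sub>\<mm>\<^esub>\<close> says that \<open>K\<close> or \<open>K'\<close> vanishes at \<open>P\<close>.  In every case the localization
  \<open>D\<^sub>P\<close> is that of \<open>R\<close> or \<open>R'\<close>, a valuation domain; this gives \<open>semihereditary_subdirect\<close>.

  Conversely, if \<open>D\<^sub>P\<close> is a valuation domain, then \<open>K\<^sub>P K'\<^sub>P = 0\<close> forces one factor to be zero, which
  is the local condition.  For the localization \<open>D\<^sub>P / K'\<^sub>P\<close> of \<open>R\<close>, either \<open>K'\<^sub>P = 0\<close> and it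
  equals \<open>D\<^sub>P\<close>, or \<open>K\<^sub>P = 0\<close> and it is the localization of \<open>A / I\<^sub>o\<close>: a quotient of the valuation
  domain \<open>D\<^sub>P\<close> that is reduced because \<open>I\<^sub>o\<close> is radical, hence a domain
  (\<open>semihereditary_subdirect_factor\<close>).  Finally \<open>J \<inter> Nil(B) = 0\<close> because the nilpotent elements of
  \<open>B\<close> in \<open>J\<close> are nilpotent in \<open>R\<close>, and semihereditary rings are reduced.
\<close>

section \<open>Ideals of commutative rings\<close>

lemma (in cring) ideal_of_closed:
  assumes "I \<subseteq> carrier R" "\<zero> \<in> I"
    and add: "\<And>x y. x \<in> I \<Longrightarrow> y \<in> I \<Longrightarrow> x \<oplus> y \<in> I"
    and mult: "\<And>r x. r \<in> carrier R \<Longrightarrow> x \<in> I \<Longrightarrow> r \<otimes> x \<in> I"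
  shows "ideal I R"
proof (rule idealI)
  show "subgroup I (add_monoid R)"
  proof (rule add.subgroupI)
    fix x assume x: "x \<in> I"
    then have "(\<ominus> \<one>) \<otimes> x = \<ominus> x" using assms(1) by (auto simp: l_minus)
    then show "\<ominus> x \<in> I" using mult[OF _ x, of "\<ominus> \<one>"] by simp
  qed (use assms in auto)
next
  fix a x assume "a \<in> I" "x \<in> carrier R"
  then show "x \<otimes> a \<in> I" "a \<otimes> x \<in> I" using mult m_comm[of a x] assms(1) by auto
qed (rule ring_axioms)

lemma (in cring) Idl_pair:
  assumes x: "x \<in> carrier R" and y: "y \<in> carrier R"
  shows "Idl {x, y} = {a \<otimes> x \<oplus> b \<otimes> y | a b. a \<in> carrier R \<and> b \<in> carrier R}" (is "_ = ?I")
proof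
  have "ideal ?I R"
  proof (rule ideal_of_closed)
    show "\<zero> \<in> ?I"
      by (rule CollectI, rule exI[of _ \<zero>], rule exI[of _ \<zero>]) (use x y in simp)
  next
    fix u v assume "u \<in> ?I" "v \<in> ?I"
    then obtain a b c d where *: "a \<in> carrier R" "b \<in> carrier R" "u = a \<otimes> x \<oplus> b \<otimes> y"
      "c \<in> carrier R" "d \<in> carrier R" "v = c \<otimes> x \<oplus> d \<otimes> y" by blast
    show "u \<oplus> v \<in> ?I"
      by (rule CollectI, rule exI[of _ "a \<oplus> c"], rule exI[of _ "b \<oplus> d"])
         (use * x y in \<open>simp add: l_distr a_ac\<close>)
  next
    fix r u assume r: "r \<in> carrier R" and "u \<in> ?I"
    then obtain a b where *: "a \<in> carrier R" "b \<in> carrier R" "u = a \<otimes> x \<oplus> b \<otimes> y" by blast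
    show "r \<otimes> u \<in> ?I"
      by (rule CollectI, rule exI[of _ "r \<otimes> a"], rule exI[of _ "r \<otimes> b"])
         (use * r x y in \<open>simp add: r_distr m_assoc\<close>)
  qed (use x y in auto)
  moreover have "x \<in> ?I"
    by (rule CollectI, rule exI[of _ \<one>], rule exI[of _ \<zero>]) (use x y in simp)
  moreover have "y \<in> ?I"
    by (rule CollectI, rule exI[of _ \<zero>], rule exI[of _ \<one>]) (use x y in simp)
  ultimately show "Idl {x, y} \<subseteq> ?I" by (intro genideal_minimal) auto
  interpret I: ideal "Idl {x, y}" R by (rule genideal_ideal) (use x y in auto)
  have "x \<in> Idl {x, y}" "y \<in> Idl {x, y}" using genideal_self[of "{x, y}"] x y by auto
  then show "?I \<subseteq> Idl {x, y}" by (auto intro: I.a_closed I.I_l_closed)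
qed

section \<open>Localization at a maximal ideal by denominators\<close>

text \<open>
  The next three properties say, for a maximal ideal \<open>P\<close>, that \<open>K\<^sub>P = 0\<close>, that divisibility in
  \<open>R\<^sub>P\<close> is total, and that \<open>R\<^sub>P\<close> has no zero divisors.  The last two together say that \<open>R\<^sub>P\<close> is a
  valuation domain.
\<close>
definition vanishes_at :: "('a, 'm) ring_scheme \<Rightarrow> 'a set \<Rightarrow> 'a set \<Rightarrow> bool"
  where "vanishes_at R P K \<longleftrightarrow> (\<forall>x\<in>K. \<exists>s\<in>carrier R - P. s \<otimes>\<^bsub>R\<^esub> x = \<zero>\<^bsub>R\<^esub>)"

definition valuation_at :: "('a, 'm) ring_scheme \<Rightarrow> 'a set \<Rightarrow> bool"
  where "valuation_at R P \<longleftrightarrow> (\<forall>x\<in>carrier R. \<forall>y\<in>carrier R.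
    \<exists>s\<in>carrier R - P. \<exists>r\<in>carrier R. s \<otimes>\<^bsub>R\<^esub> x = r \<otimes>\<^bsub>R\<^esub> y \<or> s \<otimes>\<^bsub>R\<^esub> y = r \<otimes>\<^bsub>R\<^esub> x)"

definition domain_at :: "('a, 'm) ring_scheme \<Rightarrow> 'a set \<Rightarrow> bool"
  where "domain_at R P \<longleftrightarrow> (\<forall>x\<in>carrier R. \<forall>y\<in>carrier R. x \<otimes>\<^bsub>R\<^esub> y = \<zero>\<^bsub>R\<^esub> \<longrightarrow>
    (\<exists>s\<in>carrier R - P. s \<otimes>\<^bsub>R\<^esub> x = \<zero>\<^bsub>R\<^esub> \<or> s \<otimes>\<^bsub>R\<^esub> y = \<zero>\<^bsub>R\<^esub>))"

section \<open>Semihereditary rings are locally valuation domains\<close>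

definition square_module :: "('a, 'm) ring_scheme \<Rightarrow> ('a, 'a \<times> 'a) module"
  where "square_module R =
    \<lparr>carrier = carrier R \<times> carrier R, monoid.mult = undefined, one = undefined,
     ring.zero = (\<zero>\<^bsub>R\<^esub>, \<zero>\<^bsub>R\<^esub>),
     add = (\<lambda>u v. (fst u \<oplus>\<^bsub>R\<^esub> fst v, snd u \<oplus>\<^bsub>R\<^esub> snd v)),
     smult = (\<lambda>a u. (a \<otimes>\<^bsub>R\<^esub> fst u, a \<otimes>\<^bsub>R\<^esub> snd u))\<rparr>"

lemma (in cring) module_square_module: "module R (square_module R)"
proof (rule moduleI[OF is_cring])
  show "abelian_group (square_module R)"
  proof (rule abelian_groupI)
    fix u assume u: "u \<in> carrier (square_module R)"
    show "\<exists>v\<in>carrier (square_module R). v \<oplus>\<^bsub>square_module R\<^esub> u = \<zero>\<^bsub>square_module R\<^esub>"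
      by (rule bexI[of _ "(\<ominus> fst u, \<ominus> snd u)"])
         (use u in \<open>auto simp: square_module_def l_neg\<close>)
  qed (auto simp: square_module_def a_ac)
qed (auto simp: square_module_def l_distr r_distr m_assoc)

text \<open>
  The surjection \<open>(u, v) \<mapsto> u x + v y\<close> onto the projective ideal \<open>(x, y)\<close> splits; the rows of
  the matrix \<open>a, b / c, d\<close> are the values at \<open>x\<close> and \<open>y\<close> of the two coordinates of a splitting.
  The relations express that these coordinates are \<open>R\<close>-linear functionals \<open>\<phi>\<close>: they satisfy
  \<open>y \<phi>(x) = \<phi>(x y) = x \<phi>(y)\<close>, and \<open>w \<phi>(x) = \<phi>(w x)\<close>.
\<close>
lemma semihereditary_dual_basis:
  fixes R (structure)
  assumes "semihereditary R" and x: "x \<in> carrier R" and y: "y \<in> carrier R"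
  obtains a b c d where "a \<in> carrier R" "b \<in> carrier R" "c \<in> carrier R" "d \<in> carrier R"
    and "x = a \<otimes> x \<oplus> c \<otimes> y" and "y = b \<otimes> x \<oplus> d \<otimes> y"
    and "a \<otimes> y = b \<otimes> x" and "c \<otimes> y = d \<otimes> x"
    and "\<And>w. w \<in> carrier R \<Longrightarrow> w \<otimes> x = \<zero> \<Longrightarrow> w \<otimes> a = \<zero>"
proof -
  interpret cring R using assms(1) by (simp add: semihereditary_def)
  let ?I = "Idl {x, y}" and ?N = "square_module R"
  let ?P = "ideal_module R ?I"
  have I: "ideal ?I R" using x y by (intro genideal_ideal) auto
  interpret I: ideal ?I R by (rule I)
  have xy: "x \<in> ?I" "y \<in> ?I" using genideal_self[of "{x, y}"] x y by auto
  have proj: "projective_module R ?P"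
    using assms(1) I x y unfolding semihereditary_def
    by (metis finite.emptyI finite.insertI empty_subsetI insert_subset)
  have P: "module R ?P" by (rule module_ideal_module[OF is_cring I])
  let ?e = "\<lambda>u. fst u \<otimes> x \<oplus> snd u \<otimes> y"
  have e: "?e \<in> module_hom R ?N ?P"
    using x y xy by (auto simp: module_hom_def square_module_def ideal_module_def l_distr r_distr
        m_assoc a_ac intro!: I.a_closed I.I_l_closed)
  have surj: "?e ` carrier ?N = carrier ?P"
    unfolding Idl_pair[OF x y] ideal_module_def square_module_def by force
  \<comment> \<open>The identity of the ideal lifts along \<open>e\<close>; the lift \<open>k\<close> is the splitting.\<close>
  have "(\<lambda>z. z) \<in> module_hom R ?P ?P" by (auto simp: module_hom_def)
  from projective_module_lift[OF proj P module_square_module e surj this]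
  obtain k where k: "k \<in> module_hom R ?P ?N" and ek: "\<And>z. z \<in> ?I \<Longrightarrow> ?e (k z) = z"
    by (auto simp: ideal_module_def)
  have kc: "fst (k z) \<in> carrier R" "snd (k z) \<in> carrier R" if "z \<in> ?I" for z
    using k that by (auto simp: module_hom_def square_module_def ideal_module_def Pi_iff mem_Times_iff)
  have ks: "fst (k (r \<otimes> z)) = r \<otimes> fst (k z)" "snd (k (r \<otimes> z)) = r \<otimes> snd (k z)"
    if "r \<in> carrier R" "z \<in> ?I" for r z
    using k that by (auto simp: module_hom_def square_module_def ideal_module_def)
  show thesis
  proof (rule that[of "fst (k x)" "fst (k y)" "snd (k x)" "snd (k y)"])
    have "fst (k (y \<otimes> x)) = fst (k (x \<otimes> y))" "snd (k (y \<otimes> x)) = snd (k (x \<otimes> y))"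
      using m_comm x y by simp_all
    then show "fst (k x) \<otimes> y = fst (k y) \<otimes> x" "snd (k x) \<otimes> y = snd (k y) \<otimes> x"
      using ks[OF y xy(1)] ks[OF x xy(2)] m_comm kc xy x y by simp_all
    fix w assume w: "w \<in> carrier R" "w \<otimes> x = \<zero>"
    have "w \<otimes> fst (k x) = fst (k (\<zero> \<otimes> x))" using w ks(1)[OF w(1) xy(1)] x by simp
    also have "\<dots> = \<zero>" using ks(1)[OF zero_closed xy(1)] kc xy by simp
    finally show "w \<otimes> fst (k x) = \<zero>" .
  qed (use kc xy ek in auto)
qed

lemma (in cring) one_notin_maximalideal:
  assumes "maximalideal P R" shows "\<one> \<notin> P"
proof -
  interpret maximalideal P R by fact
  show ?thesis using I_notcarr one_imp_carrier by blast
qed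

lemma (in cring) maximalideal_complement_mult:
  assumes P: "maximalideal P R" and "s \<in> carrier R - P" "t \<in> carrier R - P"
  shows "s \<otimes> t \<in> carrier R - P"
  using primeideal.I_prime[OF maximalideal_prime[OF P]] assms by blast

lemma (in cring) maximalideal_complement_one:
  assumes P: "maximalideal P R" shows "\<one> \<in> carrier R - P"
  using one_notin_maximalideal[OF P] by simp

text \<open>
  Since \<open>R x\<close> is projective, the map \<open>R \<rightarrow> R x\<close> splits; so the annihilator of \<open>x\<close> is generated by
  an idempotent, and \<open>a\<close> is the complementary idempotent.
\<close>
lemma semihereditary_annihilator:
  fixes R (structure)
  assumes "semihereditary R" "x \<in> carrier R"
  obtains a where "a \<in> carrier R" "x = a \<otimes> x" "\<And>w. w \<in> carrier R \<Longrightarrow> w \<otimes> x = \<zero> \<Longrightarrow> w \<otimes> a = \<zero>"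
proof -
  interpret cring R using assms(1) by (simp add: semihereditary_def)
  from semihereditary_dual_basis[OF assms zero_closed] that show thesis
    using assms(2) by (metis m_closed r_null r_zero)
qed

text \<open>
  Supplies the denominators below: for every \<open>a\<close>, one of \<open>a\<close> and \<open>1 - a\<close> becomes invertible at \<open>P\<close>.
\<close>
lemma (in cring) maximalideal_minus_one:
  assumes P: "maximalideal P R" and "a \<in> carrier R"
  shows "a \<notin> P \<or> \<one> \<ominus> a \<notin> P"
proof (rule ccontr)
  interpret maximalideal P R by fact
  assume "\<not> ?thesis"
  then have "a \<oplus> (\<one> \<ominus> a) \<in> P" by (auto intro: a_closed)
  moreover have "a \<oplus> (\<one> \<ominus> a) = \<one>"
    using assms(2) by (simp add: a_minus_def a_lcomm[of a] r_neg)
  ultimately show False using one_notin_maximalideal[OF P] by simp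
qed

text \<open>
  The complementary idempotents \<open>a\<close> and \<open>1 - a\<close> kill \<open>y\<close> and \<open>x\<close> respectively.
\<close>
lemma (in cring) semihereditary_domain_at:
  assumes "semihereditary R" and P: "maximalideal P R"
  shows "domain_at R P"
  unfolding domain_at_def
proof (intro ballI impI)
  fix x y assume x: "x \<in> carrier R" and y: "y \<in> carrier R" and xy: "x \<otimes> y = \<zero>"
  obtain a where a: "a \<in> carrier R" "x = a \<otimes> x" "\<And>w. w \<in> carrier R \<Longrightarrow> w \<otimes> x = \<zero> \<Longrightarrow> w \<otimes> a = \<zero>"
    by (rule semihereditary_annihilator[OF assms(1) x]) blast
  have 1: "a \<otimes> y = \<zero>" using a(3)[OF y] xy a(1) x y by (simp add: m_comm)
  have "(\<one> \<ominus> a) \<otimes> x = x \<ominus> a \<otimes> x" using x a(1) by (simp add: a_minus_def l_distr l_minus)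
  also have "\<dots> = \<zero>" using a(2) x by (simp add: a_minus_def r_neg)
  finally have 2: "(\<one> \<ominus> a) \<otimes> x = \<zero>" .
  show "\<exists>s\<in>carrier R - P. s \<otimes> x = \<zero> \<or> s \<otimes> y = \<zero>"
    using maximalideal_minus_one[OF P a(1)] 1 2 a(1) by (metis DiffI minus_closed one_closed)
qed

text \<open>
  The dual basis yields both \<open>a y = b x\<close> and \<open>(1 - a) x = c y\<close>.
\<close>
lemma (in cring) semihereditary_valuation_at:
  assumes "semihereditary R" and P: "maximalideal P R"
  shows "valuation_at R P"
  unfolding valuation_at_def
proof (intro ballI)
  fix x y assume x: "x \<in> carrier R" and y: "y \<in> carrier R"
  obtain a b c d where c: "a \<in> carrier R" "b \<in> carrier R" "c \<in> carrier R"
    and 1: "x = a \<otimes> x \<oplus> c \<otimes> y" and 2: "a \<otimes> y = b \<otimes> x"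
    using semihereditary_dual_basis[OF assms(1) x y] by metis
  have "(\<one> \<ominus> a) \<otimes> x = x \<ominus> a \<otimes> x" using x c by (simp add: a_minus_def l_distr l_minus)
  also have "\<dots> = c \<otimes> y"
    using 1 c x y by (metis a_minus_def add.inv_solve_right' add.m_comm m_closed minus_closed)
  finally have 3: "(\<one> \<ominus> a) \<otimes> x = c \<otimes> y" .
  show "\<exists>s\<in>carrier R - P. \<exists>r\<in>carrier R. s \<otimes> x = r \<otimes> y \<or> s \<otimes> y = r \<otimes> x"
    using maximalideal_minus_one[OF P c(1)] 2 3 c by (metis DiffI minus_closed one_closed)
qed

lemma (in cring) semihereditary_reduced:
  assumes "semihereditary R" and x: "x \<in> carrier R" and "x [^] Suc n = \<zero>"
  shows "x = \<zero>"
  using assms(3)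
proof (induction n)
  case 0 then show ?case using x by simp
next
  case (Suc n)
  obtain a where a: "a \<in> carrier R" "x = a \<otimes> x" "\<And>w. w \<in> carrier R \<Longrightarrow> w \<otimes> x = \<zero> \<Longrightarrow> w \<otimes> a = \<zero>"
    by (rule semihereditary_annihilator[OF assms(1) x]) blast
  have "x [^] Suc n \<otimes> a = \<zero>" by (rule a(3)) (use Suc.prems x in simp_all)
  moreover have "x [^] Suc n \<otimes> a = x [^] n \<otimes> (a \<otimes> x)" using x a(1) by (simp add: m_ac)
  ultimately have "x [^] Suc n = \<zero>" using a(2) by simp
  then show ?case by (rule Suc.IH)
qed

section \<open>Noetherian rings that are locally valuation domains are semihereditary\<close>

lemma (in cring) vanishes_at_Idl:
  assumes P: "maximalideal P R" and "finite S" "S \<subseteq> carrier R" "vanishes_at R P S"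
  obtains t where "t \<in> carrier R - P" "\<And>x. x \<in> Idl S \<Longrightarrow> t \<otimes> x = \<zero>"
proof -
  have "\<exists>t\<in>carrier R - P. \<forall>x\<in>S. t \<otimes> x = \<zero>"
    using assms(2-4)
  proof (induction S rule: finite_induct)
    case empty then show ?case using maximalideal_complement_one[OF P] by blast
  next
    case (insert z S)
    then obtain t where t: "t \<in> carrier R - P" "\<And>x. x \<in> S \<Longrightarrow> t \<otimes> x = \<zero>"
      by (auto simp: vanishes_at_def)
    obtain s where s: "s \<in> carrier R - P" "s \<otimes> z = \<zero>"
      using insert.prems by (auto simp: vanishes_at_def)
    show ?case
    proof (intro bexI ballI)
      fix x assume "x \<in> insert z S"
      then consider "x = z" | "x \<in> S" by blast
      then show "(s \<otimes> t) \<otimes> x = \<zero>"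
        using s t insert.prems by cases (auto simp: m_assoc m_lcomm[of s t])
    qed (rule maximalideal_complement_mult[OF P s(1) t(1)])
  qed
  then obtain t where t: "t \<in> carrier R - P" "\<And>x. x \<in> S \<Longrightarrow> t \<otimes> x = \<zero>" by blast
  have "ideal {x \<in> carrier R. t \<otimes> x = \<zero>} R"
    by (rule ideal_of_closed) (use t(1) in \<open>auto simp: r_distr m_lcomm\<close>)
  then have "Idl S \<subseteq> {x \<in> carrier R. t \<otimes> x = \<zero>}"
    using t(2) assms(3) by (intro genideal_minimal) auto
  then show thesis using that[OF t(1)] by blast
qed

text \<open>
  Over a valuation ring one of finitely many generators divides all the others.  The common
  denominator \<open>s\<close> collects those of the finitely many comparisons.
\<close>
lemma (in cring) valuation_at_Idl:
  assumes P: "maximalideal P R" and V: "valuation_at R P" and "finite S" "S \<subseteq> carrier R"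
  obtains x s where "x \<in> Idl S" "s \<in> carrier R - P"
    "\<And>y. y \<in> Idl S \<Longrightarrow> \<exists>r\<in>carrier R. s \<otimes> y = r \<otimes> x"
proof -
  have "\<exists>x\<in>insert \<zero> S. \<exists>s\<in>carrier R - P. \<forall>y\<in>S. \<exists>r\<in>carrier R. s \<otimes> y = r \<otimes> x"
    using assms(3,4)
  proof (induction S rule: finite_induct)
    case empty then show ?case using maximalideal_complement_one[OF P] by blast
  next
    case (insert z S)
    then obtain x s where x: "x \<in> insert \<zero> S" and s: "s \<in> carrier R - P"
      and xs: "\<And>y. y \<in> S \<Longrightarrow> \<exists>r\<in>carrier R. s \<otimes> y = r \<otimes> x" by blast
    have c: "x \<in> carrier R" "z \<in> carrier R" "S \<subseteq> carrier R" "s \<in> carrier R"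
      using x s insert.prems by auto
    obtain t r where t: "t \<in> carrier R - P" and r: "r \<in> carrier R"
      and "t \<otimes> x = r \<otimes> z \<or> t \<otimes> z = r \<otimes> x"
      using V c unfolding valuation_at_def by meson
    have tc: "t \<in> carrier R" using t by blast
    note st = maximalideal_complement_mult[OF P s t]
    from \<open>t \<otimes> x = r \<otimes> z \<or> t \<otimes> z = r \<otimes> x\<close> show ?case
    proof
      assume tx: "t \<otimes> x = r \<otimes> z"
      have "\<exists>q\<in>carrier R. (s \<otimes> t) \<otimes> y = q \<otimes> z" if y: "y \<in> insert z S" for y
      proof (cases "y = z")
        case True then show ?thesis using c tc by blast
      next
        case False
        then obtain q where q: "q \<in> carrier R" "s \<otimes> y = q \<otimes> x" using y xs by blast
        have "(s \<otimes> t) \<otimes> y = t \<otimes> (s \<otimes> y)" using c tc y by (auto simp: m_ac)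
        also have "\<dots> = q \<otimes> (t \<otimes> x)" unfolding q(2) using q(1) c tc by (simp add: m_ac)
        also have "\<dots> = (q \<otimes> r) \<otimes> z" unfolding tx using q(1) c r by (simp add: m_ac)
        finally show ?thesis using q(1) r by blast
      qed
      then show ?thesis using st by blast
    next
      assume tz: "t \<otimes> z = r \<otimes> x"
      have "\<exists>q\<in>carrier R. (s \<otimes> t) \<otimes> y = q \<otimes> x" if y: "y \<in> insert z S" for y
      proof (cases "y = z")
        case True
        then have "(s \<otimes> t) \<otimes> y = (s \<otimes> r) \<otimes> x" using c tc r tz by (simp add: m_assoc)
        then show ?thesis using c r by blast
      next
        case False
        then obtain q where q: "q \<in> carrier R" "s \<otimes> y = q \<otimes> x" using y xs by blast
        have "(s \<otimes> t) \<otimes> y = t \<otimes> (s \<otimes> y)" using c tc y by (auto simp: m_ac)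
        also have "\<dots> = (t \<otimes> q) \<otimes> x" unfolding q(2) using q(1) c tc by (simp add: m_ac)
        finally show ?thesis using q(1) tc by blast
      qed
      then show ?thesis using st x by blast
    qed
  qed
  then obtain x s where x: "x \<in> insert \<zero> S" and s: "s \<in> carrier R - P"
    and xs: "\<And>y. y \<in> S \<Longrightarrow> \<exists>r\<in>carrier R. s \<otimes> y = r \<otimes> x" by blast
  have xc: "x \<in> carrier R" and sc: "s \<in> carrier R" using x s assms(4) by auto
  interpret I: ideal "Idl S" R by (rule genideal_ideal[OF assms(4)])
  let ?L = "{y \<in> carrier R. \<exists>r\<in>carrier R. s \<otimes> y = r \<otimes> x}"
  have "ideal ?L R"
  proof (rule ideal_of_closed)
    show "\<zero> \<in> ?L" using sc xc by (auto intro!: bexI[of _ \<zero>])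
  next
    fix y z assume "y \<in> ?L" "z \<in> ?L"
    then obtain p q where "y \<in> carrier R" "z \<in> carrier R" "p \<in> carrier R" "q \<in> carrier R"
      "s \<otimes> y = p \<otimes> x" "s \<otimes> z = q \<otimes> x" by blast
    then show "y \<oplus> z \<in> ?L" using sc xc by (auto simp: r_distr l_distr intro!: bexI[of _ "p \<oplus> q"])
  next
    fix a y assume a: "a \<in> carrier R" and "y \<in> ?L"
    then obtain p where "y \<in> carrier R" "p \<in> carrier R" "s \<otimes> y = p \<otimes> x" by blast
    then show "a \<otimes> y \<in> ?L" using a sc xc
      by (auto simp: m_lcomm[of s a] m_assoc intro!: bexI[of _ "a \<otimes> p"])
  qed blast
  then have "Idl S \<subseteq> ?L" using xs assms(4) by (intro genideal_minimal) auto
  moreover have "x \<in> Idl S" using x genideal_self[OF assms(4)] I.zero_closed by auto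
  ultimately show thesis using that[OF _ s] by blast
qed

lemma (in noetherian_ring) ideal_in_maximalideal:
  assumes "ideal I R" "I \<noteq> carrier R"
  obtains P where "maximalideal P R" "I \<subseteq> P"
proof -
  let ?A = "{K. ideal K R \<and> I \<subseteq> K \<and> K \<noteq> carrier R}"
  have "\<exists>M\<in>?A. \<forall>X\<in>?A. M \<subseteq> X \<longrightarrow> X = M"
  proof (rule subset_Zorn)
    fix \<C> assume C: "subset.chain ?A \<C>"
    show "\<exists>U\<in>?A. \<forall>X\<in>\<C>. X \<subseteq> U"
    proof (cases "\<C> = {}")
      case True then show ?thesis using assms by blast
    next
      case False
      have "subset.chain {K. ideal K R} \<C>" using C by (auto simp: pred_on.chain_def)
      then have "\<Union>\<C> \<in> \<C>" using ideal_chain_is_trivial False by blast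
      then have "\<Union>\<C> \<in> ?A" using C unfolding pred_on.chain_def by blast
      then show ?thesis by blast
    qed
  qed
  then obtain M where M: "M \<in> ?A" and max: "\<forall>X\<in>?A. M \<subseteq> X \<longrightarrow> X = M"
    by (rule bexE)
  have "maximalideal M R"
  proof (rule maximalidealI)
    fix K assume K: "ideal K R" "M \<subseteq> K" "K \<subseteq> carrier R"
    show "K = M \<or> K = carrier R" using M max K by auto
  qed (use M(1) in auto)
  then show thesis using that[of M] M by auto
qed

text \<open>
  Near \<open>P\<close>, the ideal \<open>I\<close> generated by \<open>S\<close> is zero or free on one generator \<open>x\<close>.  In the second
  case \<open>s z = q(z) x\<close>, where the coefficient \<open>q(z)\<close> is determined up to the annihilator of
  \<open>x\<close>.  That annihilator vanishes at \<open>P\<close> and is finitely generated, so a single denominator \<open>t\<close>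
  kills it, and \<open>t q\<close> is a well-defined linear functional.  Thus multiplication by a suitable
  denominator on \<open>I\<close> factors through a free module of rank one.
\<close>
lemma (in cring) local_dual_generator:
  assumes noeth: "noetherian_ring R" and P: "maximalideal P R"
    and V: "valuation_at R P" and D: "domain_at R P"
    and S: "finite S" "S \<subseteq> carrier R"
  obtains s y \<phi> where "s \<in> carrier R - P" "y \<in> Idl S"
    "\<And>z. z \<in> Idl S \<Longrightarrow> \<phi> z \<in> carrier R"
    "\<And>z w. z \<in> Idl S \<Longrightarrow> w \<in> Idl S \<Longrightarrow> \<phi> (z \<oplus> w) = \<phi> z \<oplus> \<phi> w"
    "\<And>r z. r \<in> carrier R \<Longrightarrow> z \<in> Idl S \<Longrightarrow> \<phi> (r \<otimes> z) = r \<otimes> \<phi> z"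
    "\<And>z. z \<in> Idl S \<Longrightarrow> \<phi> z \<otimes> y = s \<otimes> z"
proof -
  interpret I: ideal "Idl S" R by (rule genideal_ideal[OF S(2)])
  obtain x s where x: "x \<in> Idl S" and s: "s \<in> carrier R - P"
    and div: "\<And>y. y \<in> Idl S \<Longrightarrow> \<exists>r\<in>carrier R. s \<otimes> y = r \<otimes> x"
    using valuation_at_Idl[OF P V S] by metis
  have xc: "x \<in> carrier R" and sc: "s \<in> carrier R" using x s by auto
  show thesis
  proof (cases "\<exists>t\<in>carrier R - P. t \<otimes> x = \<zero>")
    case True
    then obtain t where t: "t \<in> carrier R - P" "t \<otimes> x = \<zero>" by blast
    show thesis
    proof (rule that[of "t \<otimes> s" x "\<lambda>_. \<zero>"])
      fix z assume z: "z \<in> Idl S"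
      obtain r where r: "r \<in> carrier R" "s \<otimes> z = r \<otimes> x" using div[OF z] by blast
      have "(t \<otimes> s) \<otimes> z = r \<otimes> (t \<otimes> x)"
        using r t(1) sc xc z by (simp add: m_assoc m_lcomm[of r t])
      then show "\<zero> \<otimes> x = (t \<otimes> s) \<otimes> z" using r t xc by simp
    qed (use x maximalideal_complement_mult[OF P t(1) s] in auto)
  next
    case False
    \<comment> \<open>In the domain \<open>R\<^sub>P\<close> the nonzero element \<open>x\<close> has zero annihilator.\<close>
    let ?K = "{w \<in> carrier R. w \<otimes> x = \<zero>}"
    have "ideal ?K R" by (rule ideal_of_closed) (use xc in \<open>auto simp: l_distr m_assoc\<close>)
    then obtain T where T: "finite T" "T \<subseteq> carrier R" "?K = Idl T"
      using noetherian_ring.finetely_gen[OF noeth] by blast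
    have "vanishes_at R P ?K"
      using D False xc unfolding domain_at_def vanishes_at_def by blast
    moreover have "T \<subseteq> ?K" unfolding T(3) by (rule genideal_self[OF T(2)])
    ultimately have "vanishes_at R P T" unfolding vanishes_at_def by blast
    then obtain t where t: "t \<in> carrier R - P" and "\<And>w. w \<in> Idl T \<Longrightarrow> t \<otimes> w = \<zero>"
      using vanishes_at_Idl[OF P T(1,2)] by metis
    then have kill: "t \<otimes> w = \<zero>" if "w \<in> carrier R" "w \<otimes> x = \<zero>" for w
      using that T(3) by auto
    have tc: "t \<in> carrier R" using t by blast
    have well: "t \<otimes> w = t \<otimes> v" if "w \<in> carrier R" "v \<in> carrier R" "w \<otimes> x = v \<otimes> x" for w v
    proof -
      have "(w \<ominus> v) \<otimes> x = \<zero>" using that xc by (simp add: a_minus_def l_distr l_minus r_neg)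
      then have "t \<otimes> (w \<ominus> v) = \<zero>" using that by (intro kill) auto
      then have "t \<otimes> w \<ominus> t \<otimes> v = \<zero>" using that tc by (simp add: a_minus_def r_distr r_minus)
      then show ?thesis using that tc by simp
    qed
    define q where "q z = (SOME r. r \<in> carrier R \<and> s \<otimes> z = r \<otimes> x)" for z
    have q: "q z \<in> carrier R" "s \<otimes> z = q z \<otimes> x" if "z \<in> Idl S" for z
      using someI_ex[of "\<lambda>r. r \<in> carrier R \<and> s \<otimes> z = r \<otimes> x"] div[OF that] by (auto simp: q_def)
    show thesis
    proof (rule that[of "t \<otimes> s" x "\<lambda>z. t \<otimes> q z"])
      fix z assume z: "z \<in> Idl S"
      show "t \<otimes> q z \<in> carrier R" using tc q z by simp
      have "(t \<otimes> q z) \<otimes> x = t \<otimes> (s \<otimes> z)" using q[OF z] tc xc by (simp add: m_assoc)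
      then show "(t \<otimes> q z) \<otimes> x = (t \<otimes> s) \<otimes> z" using tc sc z by (simp add: m_assoc)
      {
        fix w assume w: "w \<in> Idl S"
        have "t \<otimes> q (z \<oplus> w) = t \<otimes> (q z \<oplus> q w)"
        proof (rule well)
          have "q (z \<oplus> w) \<otimes> x = s \<otimes> (z \<oplus> w)" using q(2)[of "z \<oplus> w"] z w by simp
          also have "\<dots> = (q z \<oplus> q w) \<otimes> x"
            using q[OF z] q[OF w] z w sc xc by (simp add: r_distr l_distr)
          finally show "q (z \<oplus> w) \<otimes> x = (q z \<oplus> q w) \<otimes> x" .
        qed (use q z w in auto)
        then show "t \<otimes> q (z \<oplus> w) = t \<otimes> q z \<oplus> t \<otimes> q w"
          using q z w tc by (simp add: r_distr)
      next
        fix r assume r: "r \<in> carrier R"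
        have rz: "r \<otimes> z \<in> Idl S" using r z by (rule I.I_l_closed[rotated])
        have "t \<otimes> q (r \<otimes> z) = t \<otimes> (r \<otimes> q z)"
        proof (rule well)
          have "q (r \<otimes> z) \<otimes> x = r \<otimes> (s \<otimes> z)" using q(2)[OF rz] r z sc by (simp add: m_lcomm)
          also have "\<dots> = (r \<otimes> q z) \<otimes> x" using q[OF z] r xc by (simp add: m_assoc)
          finally show "q (r \<otimes> z) \<otimes> x = (r \<otimes> q z) \<otimes> x" .
        qed (use q z rz r in auto)
        then show "t \<otimes> q (r \<otimes> z) = r \<otimes> (t \<otimes> q z)"
          using q z tc r by (simp add: m_lcomm)
      }
    qed (use x maximalideal_complement_mult[OF P t(1) s] in auto)
  qed
qed

text \<open>
  For a lifting problem \<open>h : I \<rightarrow> M\<close> along \<open>e : N \<rightarrow> M\<close>, the scalars \<open>r\<close> for which \<open>r h\<close> can be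
  lifted form an ideal.  By the previous lemma this ideal contains a denominator for every maximal
  ideal, so it contains \<open>1\<close>.
\<close>
lemma (in cring) noetherian_semihereditaryI:
  assumes noeth: "noetherian_ring R"
    and loc: "\<And>P. maximalideal P R \<Longrightarrow> valuation_at R P \<and> domain_at R P"
  shows "semihereditary R"
  unfolding semihereditary_def
proof (intro conjI allI impI is_cring)
  fix I assume "ideal I R \<and> (\<exists>S\<subseteq>carrier R. finite S \<and> I = Idl S)"
  then obtain S where S: "finite S" "S \<subseteq> carrier R" and I: "I = Idl S" and id: "ideal I R" by blast
  let ?P = "ideal_module R I"
  interpret I: ideal I R by (rule id)
  show "projective_module R ?P"
    unfolding projective_module_def
  proof (intro conjI allI impI module_ideal_module[OF is_cring id], elim conjE)
    fix M :: "('a, 'a) module" and N :: "('a, 'a \<Rightarrow> 'a) module" and e h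
    assume M: "module R M" and N: "module R N" and e: "e \<in> module_hom R N M"
      and surj: "e ` carrier N = carrier M" and h: "h \<in> module_hom R ?P M"
    interpret M: module R M by (rule M)
    interpret N: module R N by (rule N)
    have hc: "h z \<in> carrier M" and h_add: "h (z \<oplus> w) = h z \<oplus>\<^bsub>M\<^esub> h w"
      and h_smult: "r \<in> carrier R \<Longrightarrow> h (r \<otimes> z) = r \<odot>\<^bsub>M\<^esub> h z" if "z \<in> I" "w \<in> I" for z w r
      using h that by (auto simp: module_hom_def ideal_module_def)
    have ec: "e n \<in> carrier M" and e_add: "e (n \<oplus>\<^bsub>N\<^esub> n') = e n \<oplus>\<^bsub>M\<^esub> e n'"
      and e_smult: "r \<in> carrier R \<Longrightarrow> e (r \<odot>\<^bsub>N\<^esub> n) = r \<odot>\<^bsub>M\<^esub> e n"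
      if "n \<in> carrier N" "n' \<in> carrier N" for n n' r
      using e that by (auto simp: module_hom_def)
    define T where "T = {r \<in> carrier R. \<exists>k\<in>module_hom R ?P N. \<forall>z\<in>I. e (k z) = r \<odot>\<^bsub>M\<^esub> h z}"
    have TI: "r \<in> T" if "r \<in> carrier R" "k \<in> module_hom R ?P N" "\<And>z. z \<in> I \<Longrightarrow> e (k z) = r \<odot>\<^bsub>M\<^esub> h z" for r k
      unfolding T_def using that by auto
    have T: "ideal T R"
    proof (rule ideal_of_closed)
      have "(\<lambda>_. \<zero>\<^bsub>N\<^esub>) \<in> module_hom R ?P N" by (auto simp: module_hom_def)
      moreover have "e \<zero>\<^bsub>N\<^esub> = \<zero>\<^bsub>M\<^esub>"
        using e_smult[of "\<zero>\<^bsub>N\<^esub>" "\<zero>\<^bsub>N\<^esub>" \<zero>] ec[of "\<zero>\<^bsub>N\<^esub>" "\<zero>\<^bsub>N\<^esub>"] by simp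
      ultimately show "\<zero> \<in> T" unfolding T_def
        using hc by (auto intro!: bexI[of _ "\<lambda>_. \<zero>\<^bsub>N\<^esub>"])
    next
      fix a b assume "a \<in> T" "b \<in> T"
      then obtain k l where ab: "a \<in> carrier R" "b \<in> carrier R"
        and k: "k \<in> module_hom R ?P N" "\<And>z. z \<in> I \<Longrightarrow> e (k z) = a \<odot>\<^bsub>M\<^esub> h z"
        and l: "l \<in> module_hom R ?P N" "\<And>z. z \<in> I \<Longrightarrow> e (l z) = b \<odot>\<^bsub>M\<^esub> h z"
        unfolding T_def by blast
      have kl: "k z \<in> carrier N" "l z \<in> carrier N" if "z \<in> I" for z
        using k(1) l(1) that by (auto simp: module_hom_def ideal_module_def)
      have hom: "(\<lambda>z. k z \<oplus>\<^bsub>N\<^esub> l z) \<in> module_hom R ?P N"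
        using k(1) l(1) kl by (auto simp: module_hom_def ideal_module_def N.M.a_ac N.smult_r_distr)
      have val: "e (k z \<oplus>\<^bsub>N\<^esub> l z) = (a \<oplus> b) \<odot>\<^bsub>M\<^esub> h z" if "z \<in> I" for z
        using that kl ab k(2) l(2) hc by (simp add: e_add M.smult_l_distr)
      show "a \<oplus> b \<in> T" by (rule TI[OF _ hom val]) (use ab in auto)
    next
      fix r a assume r: "r \<in> carrier R" and "a \<in> T"
      then obtain k where a: "a \<in> carrier R"
        and k: "k \<in> module_hom R ?P N" "\<And>z. z \<in> I \<Longrightarrow> e (k z) = a \<odot>\<^bsub>M\<^esub> h z"
        unfolding T_def by blast
      have kc: "k z \<in> carrier N" if "z \<in> I" for z
        using k(1) that by (auto simp: module_hom_def ideal_module_def)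
      have hom: "(\<lambda>z. r \<odot>\<^bsub>N\<^esub> k z) \<in> module_hom R ?P N"
        using k(1) kc r by (auto simp: module_hom_def ideal_module_def N.smult_r_distr
            N.smult_assoc1[symmetric] m_comm)
      have val: "e (r \<odot>\<^bsub>N\<^esub> k z) = (r \<otimes> a) \<odot>\<^bsub>M\<^esub> h z" if "z \<in> I" for z
        using that e_smult[OF kc[OF that] kc[OF that] r] r a k(2) hc by (simp add: M.smult_assoc1)
      show "r \<otimes> a \<in> T" by (rule TI[OF _ hom val]) (use r a in auto)
    qed (auto simp: T_def)
    have "T = carrier R"
    proof (rule ccontr)
      assume "T \<noteq> carrier R"
      then obtain P where P: "maximalideal P R" and TP: "T \<subseteq> P"
        using noetherian_ring.ideal_in_maximalideal[OF noeth T] by metis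
      obtain s y \<phi> where s: "s \<in> carrier R - P" and y: "y \<in> I"
        and pc: "\<And>z. z \<in> I \<Longrightarrow> \<phi> z \<in> carrier R"
        and pa: "\<And>z w. z \<in> I \<Longrightarrow> w \<in> I \<Longrightarrow> \<phi> (z \<oplus> w) = \<phi> z \<oplus> \<phi> w"
        and ps: "\<And>r z. r \<in> carrier R \<Longrightarrow> z \<in> I \<Longrightarrow> \<phi> (r \<otimes> z) = r \<otimes> \<phi> z"
        and py: "\<And>z. z \<in> I \<Longrightarrow> \<phi> z \<otimes> y = s \<otimes> z"
      proof (rule local_dual_generator[OF noeth P conjunct1[OF loc[OF P]] conjunct2[OF loc[OF P]] S, folded I], goal_cases)
        case (1 s y \<phi>)
        show ?thesis by (rule 1(1)[OF 1(2-)])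
      qed
      \<comment> \<open>\<open>s h(z) = h(\<phi>(z) y) = \<phi>(z) h(y)\<close>, so lifting the single element \<open>h(y)\<close> is enough.\<close>
      obtain n where n: "n \<in> carrier N" "e n = h y" using surj hc[OF y y] by (metis imageE)
      have hom: "(\<lambda>z. \<phi> z \<odot>\<^bsub>N\<^esub> n) \<in> module_hom R ?P N"
        using pc n(1) by (auto simp: module_hom_def ideal_module_def pa ps N.smult_l_distr N.smult_assoc1)
      have val: "e (\<phi> z \<odot>\<^bsub>N\<^esub> n) = s \<odot>\<^bsub>M\<^esub> h z" if z: "z \<in> I" for z
      proof -
        have "e (\<phi> z \<odot>\<^bsub>N\<^esub> n) = \<phi> z \<odot>\<^bsub>M\<^esub> h y" using e_smult[OF n(1) n(1) pc[OF z]] n(2) by simp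
        also have "\<dots> = h (\<phi> z \<otimes> y)" using h_smult[OF y y pc[OF z]] by simp
        also have "\<dots> = s \<odot>\<^bsub>M\<^esub> h z" using py[OF z] h_smult[OF z z] s by simp
        finally show ?thesis .
      qed
      have "s \<in> T" by (rule TI[OF _ hom val]) (use s in auto)
      then show False using s TP by blast
    qed
    then have "\<one> \<in> T" by simp
    then obtain k where k: "k \<in> module_hom R ?P N" "\<And>z. z \<in> I \<Longrightarrow> e (k z) = \<one> \<odot>\<^bsub>M\<^esub> h z"
      unfolding T_def by blast
    then have "\<forall>x\<in>carrier ?P. e (k x) = h x" using hc by (simp add: ideal_module_def)
    then show "\<exists>k\<in>module_hom R ?P N. \<forall>x\<in>carrier ?P. e (k x) = h x" using k(1) by blast
  qed
qed

section \<open>Maximal ideals under ring homomorphisms\<close>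

lemma (in abelian_group) minus_eqI:
  assumes "x = y \<oplus> z" "y \<in> carrier G" "z \<in> carrier G"
  shows "x \<ominus> y = z"
  using assms by (simp add: a_minus_def a_comm[of y z] a_assoc r_neg)

lemma ring_hom_cring_of_hom:
  assumes "cring R" "cring S" "h \<in> ring_hom R S"
  shows "ring_hom_cring R S h"
proof -
  interpret R: cring R by fact
  interpret S: cring S by fact
  show ?thesis
    by (rule RingHom.ring_hom_cringI[OF ring_hom_ringI2[OF R.ring_axioms S.ring_axioms assms(3)] R.is_cring S.is_cring])
qed

lemma (in cring) maximalideal_iff:
  "maximalideal P R \<longleftrightarrow> ideal P R \<and> \<one> \<notin> P \<and>
     (\<forall>x\<in>carrier R - P. \<exists>y\<in>carrier R. \<exists>p\<in>P. \<one> = y \<otimes> x \<oplus> p)" (is "_ \<longleftrightarrow> ?r")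
proof
  assume P: "maximalideal P R"
  interpret P: maximalideal P R by (rule P)
  have "\<exists>y\<in>carrier R. \<exists>p\<in>P. \<one> = y \<otimes> x \<oplus> p" if x: "x \<in> carrier R - P" for x
  proof -
    have xc: "x \<in> carrier R" using x by blast
    let ?K = "{y \<otimes> x \<oplus> p | y p. y \<in> carrier R \<and> p \<in> P}"
    have "ideal ?K R"
    proof (rule ideal_of_closed)
      show "\<zero> \<in> ?K"
        by (rule CollectI, rule exI[of _ \<zero>], rule exI[of _ \<zero>]) (use xc in simp)
    next
      fix u v assume "u \<in> ?K" "v \<in> ?K"
      then obtain a b c d where *: "a \<in> carrier R" "b \<in> P" "u = a \<otimes> x \<oplus> b"
        "c \<in> carrier R" "d \<in> P" "v = c \<otimes> x \<oplus> d" by blast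
      show "u \<oplus> v \<in> ?K"
        by (rule CollectI, rule exI[of _ "a \<oplus> c"], rule exI[of _ "b \<oplus> d"])
           (use * xc in \<open>simp add: l_distr a_ac P.Icarr\<close>)
    next
      fix r u assume r: "r \<in> carrier R" and "u \<in> ?K"
      then obtain a b where *: "a \<in> carrier R" "b \<in> P" "u = a \<otimes> x \<oplus> b" by blast
      show "r \<otimes> u \<in> ?K"
        by (rule CollectI, rule exI[of _ "r \<otimes> a"], rule exI[of _ "r \<otimes> b"])
           (use * r xc in \<open>simp add: r_distr m_assoc P.Icarr P.I_l_closed\<close>)
    qed (use xc P.Icarr in auto)
    moreover have "P \<subseteq> ?K"
    proof
      fix p assume "p \<in> P"
      then show "p \<in> ?K"
        by (intro CollectI exI[of _ \<zero>] exI[of _ p]) (use xc P.Icarr in simp)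
    qed
    moreover have "x \<in> ?K"
      by (rule CollectI, rule exI[of _ \<one>], rule exI[of _ \<zero>]) (use xc in simp)
    moreover have "?K \<subseteq> carrier R" using xc P.Icarr by auto
    ultimately have "?K = carrier R" using P.I_maximal[of ?K] x by blast
    then have "\<one> \<in> ?K" by simp
    then show ?thesis by blast
  qed
  then show ?r using P.is_ideal one_notin_maximalideal[OF P] by blast
next
  assume r: ?r
  show "maximalideal P R"
  proof (rule maximalidealI)
    show "carrier R \<noteq> P" using r by auto
    fix K assume K: "ideal K R" and PK: "P \<subseteq> K" and "K \<subseteq> carrier R"
    interpret K: ideal K R by (rule K)
    show "K = P \<or> K = carrier R"
    proof (rule disjCI)
      assume "K \<noteq> carrier R"
      have "x \<in> P" if x: "x \<in> K" for x
      proof (rule ccontr)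
        assume "x \<notin> P"
        then obtain y p where "y \<in> carrier R" "p \<in> P" "\<one> = y \<otimes> x \<oplus> p"
          using r K.Icarr[OF x] by blast
        then have "\<one> \<in> K" using x PK by (auto intro: K.a_closed K.I_l_closed)
        then show False using K.one_imp_carrier \<open>K \<noteq> carrier R\<close> by blast
      qed
      then show "K = P" using PK by blast
    qed
  qed (use r in blast)
qed

text \<open>
  When \<open>S = h(R) + N\<close>, the maximal ideals of \<open>S\<close> containing \<open>N\<close> correspond to the maximal ideals of
  \<open>R\<close> containing \<open>h\<inverse>(N)\<close>, because both are those of \<open>S / N = R / h\<inverse>(N)\<close>.  The case \<open>N = 0\<close> is that
  of a surjection; the diagonal map \<open>A \<rightarrow> D\<close> requires \<open>N = J \<times> J'\<close>.
\<close>
lemma maximalideal_vimage: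
  assumes "cring R" "cring S" and h: "h \<in> ring_hom R S" and P: "maximalideal P S" and "N \<subseteq> P"
    and gen: "carrier S \<subseteq> h ` carrier R <+>\<^bsub>S\<^esub> N"
  shows "maximalideal {a \<in> carrier R. h a \<in> P} R"
proof -
  interpret R: cring R by fact
  interpret S: cring S by fact
  interpret h: ring_hom_cring R S h by (rule ring_hom_cring_of_hom) fact+
  interpret P: maximalideal P S by (rule P)
  note Pm = P[unfolded S.maximalideal_iff]
  show ?thesis unfolding R.maximalideal_iff
  proof (intro conjI ballI)
    show "ideal {a \<in> carrier R. h a \<in> P} R"
      by (rule R.ideal_of_closed) (auto intro: P.a_closed P.I_l_closed)
    show "\<one>\<^bsub>R\<^esub> \<notin> {a \<in> carrier R. h a \<in> P}" using Pm by simp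
    fix x assume x: "x \<in> carrier R - {a \<in> carrier R. h a \<in> P}"
    then have "h x \<in> carrier S - P" by auto
    then obtain y p where y: "y \<in> carrier S" "p \<in> P" "\<one>\<^bsub>S\<^esub> = y \<otimes>\<^bsub>S\<^esub> h x \<oplus>\<^bsub>S\<^esub> p" using Pm by blast
    obtain b n where b: "b \<in> carrier R" "n \<in> N" "y = h b \<oplus>\<^bsub>S\<^esub> n"
      using gen y(1) by (auto simp: set_add_def set_mult_def)
    have n: "n \<in> P" using b(2) assms(5) by blast
    have c: "x \<in> carrier R" "h x \<in> carrier S" "h b \<in> carrier S" "n \<in> carrier S" "p \<in> carrier S"
      using x b n y P.Icarr by auto
    let ?q = "\<one>\<^bsub>R\<^esub> \<ominus>\<^bsub>R\<^esub> b \<otimes>\<^bsub>R\<^esub> x"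
    have "h ?q = \<one>\<^bsub>S\<^esub> \<ominus>\<^bsub>S\<^esub> h b \<otimes>\<^bsub>S\<^esub> h x" using c b(1) by (simp add: a_minus_def)
    also have "\<dots> = n \<otimes>\<^bsub>S\<^esub> h x \<oplus>\<^bsub>S\<^esub> p"
    proof -
      have "\<one>\<^bsub>S\<^esub> = h b \<otimes>\<^bsub>S\<^esub> h x \<oplus>\<^bsub>S\<^esub> (n \<otimes>\<^bsub>S\<^esub> h x \<oplus>\<^bsub>S\<^esub> p)"
        using y(3) b(3) c by (simp add: S.l_distr S.a_assoc)
      then show ?thesis using c by (intro S.minus_eqI) auto
    qed
    also have "\<dots> \<in> P" using n c(2) y(2) by (intro P.a_closed P.I_r_closed)
    finally have "?q \<in> {a \<in> carrier R. h a \<in> P}" using c b(1) by simp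
    moreover have "\<one>\<^bsub>R\<^esub> = b \<otimes>\<^bsub>R\<^esub> x \<oplus>\<^bsub>R\<^esub> ?q"
      using c(1) b(1) by (simp add: a_minus_def R.a_lcomm[of "b \<otimes>\<^bsub>R\<^esub> x"] R.r_neg)
    ultimately show "\<exists>y\<in>carrier R. \<exists>p\<in>{a \<in> carrier R. h a \<in> P}. \<one>\<^bsub>R\<^esub> = y \<otimes>\<^bsub>R\<^esub> x \<oplus>\<^bsub>R\<^esub> p"
      using b(1) by blast
  qed
qed

text \<open>
  Two representations \<open>h a + n\<close> and \<open>h b + m\<close> of the same element satisfy \<open>h(a - b) \<in> N\<close>, hence
  \<open>a - b \<in> P\<close>; so membership in the image is decided by the \<open>R\<close>-component of any representation.
\<close>
lemma maximalideal_image: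
  assumes "cring R" "cring S" and h: "h \<in> ring_hom R S" and P: "maximalideal P R"
    and N: "ideal N S" and NP: "{a \<in> carrier R. h a \<in> N} \<subseteq> P"
    and gen: "carrier S \<subseteq> h ` carrier R <+>\<^bsub>S\<^esub> N"
  shows "maximalideal (h ` P <+>\<^bsub>S\<^esub> N) S"
    and "\<And>a n. a \<in> carrier R \<Longrightarrow> n \<in> N \<Longrightarrow> h a \<oplus>\<^bsub>S\<^esub> n \<in> h ` P <+>\<^bsub>S\<^esub> N \<longleftrightarrow> a \<in> P"
proof -
  interpret R: cring R by fact
  interpret S: cring S by fact
  interpret h: ring_hom_cring R S h by (rule ring_hom_cring_of_hom) fact+
  interpret P: maximalideal P R by (rule P)
  interpret N: ideal N S by (rule N)
  note Pm = P[unfolded R.maximalideal_iff]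
  let ?Q = "h ` P <+>\<^bsub>S\<^esub> N"
  have Q: "x \<in> ?Q \<longleftrightarrow> (\<exists>a n. a \<in> P \<and> n \<in> N \<and> x = h a \<oplus>\<^bsub>S\<^esub> n)" for x
    by (auto simp: set_add_def set_mult_def)
  have QI: "h a \<oplus>\<^bsub>S\<^esub> n \<in> ?Q" if "a \<in> P" "n \<in> N" for a n using that Q by blast
  show mem: "h a \<oplus>\<^bsub>S\<^esub> n \<in> ?Q \<longleftrightarrow> a \<in> P" if a: "a \<in> carrier R" and n: "n \<in> N" for a n
  proof
    assume "h a \<oplus>\<^bsub>S\<^esub> n \<in> ?Q"
    then obtain b m where b: "b \<in> P" "m \<in> N" "h a \<oplus>\<^bsub>S\<^esub> n = h b \<oplus>\<^bsub>S\<^esub> m" using Q by blast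
    have c: "b \<in> carrier R" "h a \<in> carrier S" "h b \<in> carrier S" "n \<in> carrier S" "m \<in> carrier S"
      using a n b P.Icarr N.Icarr by auto
    have "h a = (h b \<oplus>\<^bsub>S\<^esub> m) \<ominus>\<^bsub>S\<^esub> n"
      by (rule S.minus_eqI[symmetric]) (use b(3) c in \<open>simp_all add: S.a_comm\<close>)
    then have "h a = h b \<oplus>\<^bsub>S\<^esub> (m \<ominus>\<^bsub>S\<^esub> n)"
      using c by (simp add: a_minus_def S.a_assoc)
    then have "h a \<ominus>\<^bsub>S\<^esub> h b = m \<ominus>\<^bsub>S\<^esub> n"
      using c by (intro S.minus_eqI) auto
    then have "h (a \<ominus>\<^bsub>R\<^esub> b) = m \<ominus>\<^bsub>S\<^esub> n"
      using a c by (simp add: a_minus_def)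
    also have "\<dots> \<in> N" using b(2) n by (simp add: a_minus_def N.a_closed)
    finally have "a \<ominus>\<^bsub>R\<^esub> b \<in> P" using NP a c(1) by auto
    then have "(a \<ominus>\<^bsub>R\<^esub> b) \<oplus>\<^bsub>R\<^esub> b \<in> P" using b(1) by (rule P.a_closed)
    then show "a \<in> P" using a c(1) by (simp add: a_minus_def R.a_assoc R.l_neg)
  qed (use QI n in blast)
  show "maximalideal ?Q S" unfolding S.maximalideal_iff
  proof (intro conjI ballI)
    show "ideal ?Q S"
    proof (rule S.ideal_of_closed)
      show "?Q \<subseteq> carrier S" using P.Icarr N.Icarr by (auto simp: Q)
      show "\<zero>\<^bsub>S\<^esub> \<in> ?Q" using QI[OF P.zero_closed N.zero_closed] by simp
    next
      fix x y assume "x \<in> ?Q" "y \<in> ?Q"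
      then obtain a n b m where *: "a \<in> P" "n \<in> N" "x = h a \<oplus>\<^bsub>S\<^esub> n" "b \<in> P" "m \<in> N" "y = h b \<oplus>\<^bsub>S\<^esub> m"
        using Q by metis
      have "h (a \<oplus>\<^bsub>R\<^esub> b) \<oplus>\<^bsub>S\<^esub> (n \<oplus>\<^bsub>S\<^esub> m) \<in> ?Q" using * by (intro QI P.a_closed N.a_closed)
      moreover have "h (a \<oplus>\<^bsub>R\<^esub> b) \<oplus>\<^bsub>S\<^esub> (n \<oplus>\<^bsub>S\<^esub> m) = x \<oplus>\<^bsub>S\<^esub> y"
        using * P.Icarr N.Icarr by (simp add: S.a_ac)
      ultimately show "x \<oplus>\<^bsub>S\<^esub> y \<in> ?Q" by simp
    next
      fix r x assume r: "r \<in> carrier S" and "x \<in> ?Q"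
      then obtain a n where *: "a \<in> P" "n \<in> N" "x = h a \<oplus>\<^bsub>S\<^esub> n" using Q by metis
      obtain b m where b: "b \<in> carrier R" "m \<in> N" "r = h b \<oplus>\<^bsub>S\<^esub> m"
        using gen r by (auto simp: set_add_def set_mult_def)
      have "h (b \<otimes>\<^bsub>R\<^esub> a) \<oplus>\<^bsub>S\<^esub> (h b \<otimes>\<^bsub>S\<^esub> n \<oplus>\<^bsub>S\<^esub> m \<otimes>\<^bsub>S\<^esub> x) \<in> ?Q"
        using * b P.Icarr N.Icarr by (intro QI P.I_l_closed N.a_closed N.I_l_closed N.I_r_closed) auto
      moreover have "h (b \<otimes>\<^bsub>R\<^esub> a) \<oplus>\<^bsub>S\<^esub> (h b \<otimes>\<^bsub>S\<^esub> n \<oplus>\<^bsub>S\<^esub> m \<otimes>\<^bsub>S\<^esub> x) = r \<otimes>\<^bsub>S\<^esub> x"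
        using * b P.Icarr N.Icarr by (simp add: S.l_distr S.r_distr S.a_ac)
      ultimately show "r \<otimes>\<^bsub>S\<^esub> x \<in> ?Q" by simp
    qed
    show "\<one>\<^bsub>S\<^esub> \<notin> ?Q" using mem[of "\<one>\<^bsub>R\<^esub>" "\<zero>\<^bsub>S\<^esub>"] Pm N.zero_closed by simp
  next
    fix x assume x: "x \<in> carrier S - ?Q"
    obtain b m where b: "b \<in> carrier R" "m \<in> N" "x = h b \<oplus>\<^bsub>S\<^esub> m"
      using gen x by (auto simp: set_add_def set_mult_def)
    have "b \<notin> P" using x b QI by auto
    then obtain y p where y: "y \<in> carrier R" "p \<in> P" "\<one>\<^bsub>R\<^esub> = y \<otimes>\<^bsub>R\<^esub> b \<oplus>\<^bsub>R\<^esub> p" using Pm b(1) by blast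
    have c: "p \<in> carrier R" "m \<in> carrier S" using y b P.Icarr N.Icarr by auto
    have "\<one>\<^bsub>S\<^esub> = h (y \<otimes>\<^bsub>R\<^esub> b \<oplus>\<^bsub>R\<^esub> p)" using y(3) h.hom_one by simp
    also have "\<dots> = h y \<otimes>\<^bsub>S\<^esub> x \<oplus>\<^bsub>S\<^esub> (h p \<oplus>\<^bsub>S\<^esub> \<ominus>\<^bsub>S\<^esub> (h y \<otimes>\<^bsub>S\<^esub> m))"
      using y(1) b(1) c b(3) by (simp add: S.r_distr S.a_assoc S.a_comm[of "h p"] S.r_neg2)
    finally have "\<one>\<^bsub>S\<^esub> = h y \<otimes>\<^bsub>S\<^esub> x \<oplus>\<^bsub>S\<^esub> (h p \<oplus>\<^bsub>S\<^esub> \<ominus>\<^bsub>S\<^esub> (h y \<otimes>\<^bsub>S\<^esub> m))" .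
    moreover have "h p \<oplus>\<^bsub>S\<^esub> \<ominus>\<^bsub>S\<^esub> (h y \<otimes>\<^bsub>S\<^esub> m) \<in> ?Q"
      using y b(2) by (intro QI N.a_inv_closed N.I_l_closed) auto
    ultimately show "\<exists>y\<in>carrier S. \<exists>p\<in>?Q. \<one>\<^bsub>S\<^esub> = y \<otimes>\<^bsub>S\<^esub> x \<oplus>\<^bsub>S\<^esub> p"
      using h.hom_closed[OF y(1)] by blast
  qed
qed

lemma (in ring) image_set_add_zero:
  assumes "h \<in> X \<rightarrow> carrier R" shows "h ` X <+> {\<zero>} = h ` X"
  using assms by (force simp: set_add_def set_mult_def)

lemma surjective_maximalideal_image:
  assumes "cring R" "cring S" and h: "h \<in> ring_hom R S" and surj: "h ` carrier R = carrier S"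
    and P: "maximalideal P R" and ker: "a_kernel R S h \<subseteq> P"
  shows "maximalideal (h ` P) S" and "\<And>a. a \<in> carrier R \<Longrightarrow> h a \<in> h ` P \<longleftrightarrow> a \<in> P"
proof -
  interpret R: cring R by fact
  interpret S: cring S by fact
  have hc: "h \<in> P \<rightarrow> carrier S" "h \<in> carrier R \<rightarrow> carrier S"
    using ring_hom_closed[OF h] additive_subgroup.a_Hcarr[OF ideal.axioms(1)[OF maximalideal.axioms(1)[OF P]]]
    by auto
  have ker': "{a \<in> carrier R. h a \<in> {\<zero>\<^bsub>S\<^esub>}} \<subseteq> P" using ker by (auto simp: a_kernel_def')
  have gen: "carrier S \<subseteq> h ` carrier R <+>\<^bsub>S\<^esub> {\<zero>\<^bsub>S\<^esub>}"
    using surj S.image_set_add_zero[OF hc(2)] by simp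
  note * = maximalideal_image[OF assms(1,2) h P S.zeroideal ker' gen, unfolded S.image_set_add_zero[OF hc(1)]]
  show "maximalideal (h ` P) S" by (rule *(1))
  show "h a \<in> h ` P \<longleftrightarrow> a \<in> P" if a: "a \<in> carrier R" for a
    using *(2)[OF a, of "\<zero>\<^bsub>S\<^esub>"] hc a by (auto simp: Pi_iff)
qed

lemma surjective_maximalideal_vimage:
  assumes "cring R" "cring S" and h: "h \<in> ring_hom R S" and surj: "h ` carrier R = carrier S"
    and P: "maximalideal P S"
  shows "maximalideal {a \<in> carrier R. h a \<in> P} R"
proof -
  interpret S: cring S by fact
  have hc: "h \<in> carrier R \<rightarrow> carrier S" using ring_hom_closed[OF h] by auto
  show ?thesis
    by (rule maximalideal_vimage[OF assms(1,2) h P, of "{\<zero>\<^bsub>S\<^esub>}"])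
       (use surj S.image_set_add_zero[OF hc] additive_subgroup.zero_closed[OF ideal.axioms(1)[OF maximalideal.axioms(1)[OF P]]] in auto)
qed

section \<open>Subdirect products of two rings\<close>

lemma a_kernel_iff: "x \<in> a_kernel R S h \<longleftrightarrow> x \<in> carrier R \<and> h x = \<zero>\<^bsub>S\<^esub>"
  unfolding a_kernel_def' by blast

lemma ideal_surjective_image:
  assumes "cring R" "cring S" and h: "h \<in> ring_hom R S" and surj: "h ` carrier R = carrier S"
    and I: "ideal I R"
  shows "ideal (h ` I) S"
proof -
  interpret h: ring_hom_cring R S h by (rule ring_hom_cring_of_hom) fact+
  interpret I: ideal I R by fact
  show ?thesis
  proof (rule h.S.ideal_of_closed)
    show "h ` I \<subseteq> carrier S" using I.Icarr by auto
    show "\<zero>\<^bsub>S\<^esub> \<in> h ` I" using I.zero_closed h.hom_zero by (metis image_eqI)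
    fix x y assume "x \<in> h ` I" "y \<in> h ` I"
    then obtain a b where ab: "a \<in> I" "b \<in> I" "x = h a" "y = h b" by blast
    then have "x \<oplus>\<^bsub>S\<^esub> y = h (a \<oplus>\<^bsub>R\<^esub> b)" using I.Icarr by simp
    then show "x \<oplus>\<^bsub>S\<^esub> y \<in> h ` I" using ab I.a_closed by blast
  next
    fix r x assume "r \<in> carrier S" "x \<in> h ` I"
    then obtain s a where sa: "s \<in> carrier R" "a \<in> I" "r = h s" "x = h a" using surj by blast
    then have "r \<otimes>\<^bsub>S\<^esub> x = h (s \<otimes>\<^bsub>R\<^esub> a)" using I.Icarr by simp
    then show "r \<otimes>\<^bsub>S\<^esub> x \<in> h ` I" using sa I.I_l_closed by blast
  qed
qed

lemma noetherian_surjective_image: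
  assumes "cring R" "cring S" and h: "h \<in> ring_hom R S" and surj: "h ` carrier R = carrier S"
    and noeth: "noetherian_ring R"
  shows "noetherian_ring S"
proof -
  interpret h: ring_hom_cring R S h by (rule ring_hom_cring_of_hom) fact+
  show ?thesis
  proof (rule h.S.noetherian_ringI)
    fix I assume I: "ideal I S"
    interpret I: ideal I S by (rule I)
    have "ideal {a \<in> carrier R. h a \<in> I} R"
      by (rule h.R.ideal_of_closed) (auto intro: I.a_closed I.I_l_closed)
    then obtain T where T: "T \<subseteq> carrier R" "finite T" "{a \<in> carrier R. h a \<in> I} = Idl\<^bsub>R\<^esub> T"
      using noetherian_ring.finetely_gen[OF noeth] by metis
    have hT: "h ` T \<subseteq> carrier S" using T by auto
    interpret G: ideal "Idl\<^bsub>S\<^esub> (h ` T)" S by (rule h.S.genideal_ideal[OF hT])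
    have sub: "T \<subseteq> {a \<in> carrier R. h a \<in> I}" unfolding T(3) by (rule h.R.genideal_self[OF T(1)])
    have "ideal {a \<in> carrier R. h a \<in> Idl\<^bsub>S\<^esub> (h ` T)} R"
      by (rule h.R.ideal_of_closed) (auto intro: G.a_closed G.I_l_closed)
    moreover have "T \<subseteq> {a \<in> carrier R. h a \<in> Idl\<^bsub>S\<^esub> (h ` T)}"
      using T(1) h.S.genideal_self[OF hT] by auto
    ultimately have pre: "{a \<in> carrier R. h a \<in> I} \<subseteq> {a \<in> carrier R. h a \<in> Idl\<^bsub>S\<^esub> (h ` T)}"
      unfolding T(3) by (rule h.R.genideal_minimal)
    have "I = Idl\<^bsub>S\<^esub> (h ` T)"
    proof
      show "I \<subseteq> Idl\<^bsub>S\<^esub> (h ` T)"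
      proof
        fix x assume x: "x \<in> I"
        then obtain a where "a \<in> carrier R" "x = h a" using surj I.Icarr by blast
        then show "x \<in> Idl\<^bsub>S\<^esub> (h ` T)" using x pre by blast
      qed
      show "Idl\<^bsub>S\<^esub> (h ` T) \<subseteq> I" by (rule h.S.genideal_minimal[OF I]) (use sub in auto)
    qed
    then show "\<exists>A\<subseteq>carrier S. finite A \<and> I = Idl\<^bsub>S\<^esub> A" using hT T(2) by blast
  qed
qed

text \<open>
  An ideal \<open>I\<close> of \<open>D\<close> is determined within a chain by \<open>p(I)\<close> and \<open>I \<inter> ker p\<close>.  On \<open>ker p\<close> the map
  \<open>q\<close> is injective, so the second datum is the ideal \<open>q(I \<inter> ker p)\<close> of \<open>S\<close>.  Both kinds of ideals
  stabilize along a chain, hence so does the chain.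
\<close>
lemma noetherian_subdirect:
  assumes "cring D" "cring R" "cring S"
    and p: "p \<in> ring_hom D R" "p ` carrier D = carrier R"
    and q: "q \<in> ring_hom D S" "q ` carrier D = carrier S"
    and ker: "a_kernel D R p \<inter> a_kernel D S q = {\<zero>\<^bsub>D\<^esub>}"
    and noeth: "noetherian_ring R" "noetherian_ring S"
  shows "noetherian_ring D"
proof -
  interpret p: ring_hom_cring D R p by (rule ring_hom_cring_of_hom) fact+
  interpret q: ring_hom_cring D S q by (rule ring_hom_cring_of_hom) fact+
  let ?K = "a_kernel D R p"
  have K: "ideal ?K D" by (rule p.ring.kernel_is_ideal)
  show ?thesis
  proof (rule p.R.trivial_ideal_chain_imp_noetherian)
    fix \<C> assume ne: "\<C> \<noteq> {}" and chain: "subset.chain {I. ideal I D} \<C>"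
    have id: "ideal I D" if "I \<in> \<C>" for I using that chain by (auto simp: subset_chain_def)
    have cmp: "I \<subseteq> L \<or> L \<subseteq> I" if "I \<in> \<C>" "L \<in> \<C>" for I L
      using that chain by (auto simp: subset_chain_def)
    have idU: "ideal (\<Union>\<C>) D" using p.R.chain_Union_is_ideal[OF chain] ne by simp
    have "\<Union>((`) p ` \<C>) \<in> (`) p ` \<C>"
    proof (rule noetherian_ring.ideal_chain_is_trivial[OF noeth(1)])
      show "subset.chain {I. ideal I R} ((`) p ` \<C>)"
        unfolding subset_chain_def
      proof (intro conjI ballI subsetI)
        fix X assume "X \<in> (`) p ` \<C>"
        then show "X \<in> {I. ideal I R}" using ideal_surjective_image[OF assms(1,2) p] id by auto
      next
        fix X Y assume "X \<in> (`) p ` \<C>" "Y \<in> (`) p ` \<C>"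
        then show "X \<subseteq> Y \<or> Y \<subseteq> X" using cmp by (blast intro: image_mono)
      qed
    qed (use ne in simp)
    then obtain I where I: "I \<in> \<C>" "p ` I = \<Union>((`) p ` \<C>)" by (metis imageE)
    let ?q = "\<lambda>I. q ` (I \<inter> ?K)"
    have "\<Union>(?q ` \<C>) \<in> ?q ` \<C>"
    proof (rule noetherian_ring.ideal_chain_is_trivial[OF noeth(2)])
      show "subset.chain {I. ideal I S} (?q ` \<C>)"
        unfolding subset_chain_def
      proof (intro conjI ballI subsetI)
        fix X assume "X \<in> ?q ` \<C>"
        then show "X \<in> {I. ideal I S}"
          using ideal_surjective_image[OF assms(1,3) q] p.R.i_intersect[OF id K] by auto
      next
        fix X Y assume "X \<in> ?q ` \<C>" "Y \<in> ?q ` \<C>"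
        then obtain I L where "I \<in> \<C>" "L \<in> \<C>" "X = ?q I" "Y = ?q L" by blast
        moreover from this have "?q I \<subseteq> ?q L \<or> ?q L \<subseteq> ?q I" using cmp[of I L] by blast
        ultimately show "X \<subseteq> Y \<or> Y \<subseteq> X" by blast
      qed
    qed (use ne in simp)
    then obtain L where L: "L \<in> \<C>" "?q L = \<Union>(?q ` \<C>)" by (metis (no_types, lifting) imageE)
    have "\<exists>M\<in>\<C>. I \<subseteq> M \<and> L \<subseteq> M" using cmp[OF I(1) L(1)] I(1) L(1) by blast
    then obtain M where M: "M \<in> \<C>" "I \<subseteq> M" "L \<subseteq> M" by blast
    interpret M: ideal M D by (rule id[OF M(1)])
    have "x \<in> M" if x: "x \<in> \<Union>\<C>" for x
    proof -
      interpret U: ideal "\<Union>\<C>" D by (rule idU)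
      have xc: "x \<in> carrier D" using x by (rule U.Icarr)
      have "p x \<in> p ` I" unfolding I(2) using x by blast
      then obtain y where y: "y \<in> I" "p x = p y" by blast
      have yM: "y \<in> M" and yc: "y \<in> carrier D" using y M(2) M.Icarr by auto
      let ?z = "x \<ominus>\<^bsub>D\<^esub> y"
      have zc: "?z \<in> carrier D" using xc yc by simp
      have "y \<in> \<Union>\<C>" using yM M(1) by blast
      then have zU: "?z \<in> \<Union>\<C>" unfolding a_minus_def using x by (intro U.a_closed U.a_inv_closed)
      have "p ?z = \<zero>\<^bsub>R\<^esub>" using y(2) xc yc by (simp add: a_minus_def p.S.r_neg)
      then have zK: "?z \<in> ?K" unfolding a_kernel_iff using zc by blast
      have "q ?z \<in> ?q L" unfolding L(2) using zU zK by blast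
      then obtain w where w: "w \<in> L" "w \<in> ?K" "q ?z = q w" by blast
      have wM: "w \<in> M" and wc: "w \<in> carrier D" using w M(3) M.Icarr by auto
      have "q (?z \<ominus>\<^bsub>D\<^esub> w) = q ?z \<ominus>\<^bsub>S\<^esub> q w" using zc wc by (simp add: a_minus_def)
      then have "q (?z \<ominus>\<^bsub>D\<^esub> w) = \<zero>\<^bsub>S\<^esub>" using w(3) wc by (simp add: a_minus_def q.S.r_neg)
      then have "?z \<ominus>\<^bsub>D\<^esub> w \<in> a_kernel D S q" unfolding a_kernel_iff using zc wc p.R.minus_closed by blast
      moreover have "?z \<ominus>\<^bsub>D\<^esub> w \<in> ?K"
        using additive_subgroup.a_closed[OF ideal.axioms(1)[OF K]]
          additive_subgroup.a_inv_closed[OF ideal.axioms(1)[OF K]] zK w(2)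
          p.R.abelian_group_axioms by (simp add: a_minus_def)
      ultimately have "?z \<ominus>\<^bsub>D\<^esub> w = \<zero>\<^bsub>D\<^esub>" using ker by blast
      then have "?z = w" using zc wc by simp
      moreover have "x = ?z \<oplus>\<^bsub>D\<^esub> y" using xc yc by (simp add: a_minus_def p.R.a_assoc p.R.l_neg)
      ultimately show "x \<in> M" using wM yM M.a_closed by simp
    qed
    then have "\<Union>\<C> = M" using M(1) by blast
    then show "\<Union>\<C> \<in> \<C>" using M(1) by simp
  qed
qed

text \<open>
  If the kernel of \<open>p\<close> vanishes at \<open>P\<close>, then \<open>p\<close> induces an isomorphism of localizations.  In terms
  of denominators: an equation in \<open>R\<close> lifts to \<open>D\<close> after multiplication by some \<open>t\<close> outside \<open>P\<close>.
\<close>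
lemma local_properties_vimage:
  assumes "cring D" "cring R" and p: "p \<in> ring_hom D R" and surj: "p ` carrier D = carrier R"
    and P: "maximalideal P D" and PQ: "\<And>d. d \<in> carrier D \<Longrightarrow> p d \<in> Q \<longleftrightarrow> d \<in> P"
    and K: "vanishes_at D P (a_kernel D R p)"
  shows "valuation_at R Q \<Longrightarrow> valuation_at D P" and "domain_at R Q \<Longrightarrow> domain_at D P"
proof -
  interpret p: ring_hom_cring D R p by (rule ring_hom_cring_of_hom) fact+
  have lift: "\<exists>t\<in>carrier D - P. (t \<otimes>\<^bsub>D\<^esub> x) \<otimes>\<^bsub>D\<^esub> u = (t \<otimes>\<^bsub>D\<^esub> y) \<otimes>\<^bsub>D\<^esub> v"
    if "x \<in> carrier D" "y \<in> carrier D" "u \<in> carrier D" "v \<in> carrier D"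
      "p x \<otimes>\<^bsub>R\<^esub> p u = p y \<otimes>\<^bsub>R\<^esub> p v" for x y u v
  proof -
    let ?z = "x \<otimes>\<^bsub>D\<^esub> u \<ominus>\<^bsub>D\<^esub> y \<otimes>\<^bsub>D\<^esub> v"
    have "p ?z = \<zero>\<^bsub>R\<^esub>" using that by (simp add: a_minus_def p.S.r_neg)
    moreover have "?z \<in> carrier D" using that by simp
    ultimately have "?z \<in> a_kernel D R p" unfolding a_kernel_iff by blast
    then obtain t where t: "t \<in> carrier D - P" "t \<otimes>\<^bsub>D\<^esub> ?z = \<zero>\<^bsub>D\<^esub>"
      using K by (auto simp: vanishes_at_def)
    then have "t \<otimes>\<^bsub>D\<^esub> (x \<otimes>\<^bsub>D\<^esub> u) \<ominus>\<^bsub>D\<^esub> t \<otimes>\<^bsub>D\<^esub> (y \<otimes>\<^bsub>D\<^esub> v) = \<zero>\<^bsub>D\<^esub>"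
      using that by (simp add: a_minus_def p.R.r_distr p.R.r_minus)
    then have "t \<otimes>\<^bsub>D\<^esub> (x \<otimes>\<^bsub>D\<^esub> u) = t \<otimes>\<^bsub>D\<^esub> (y \<otimes>\<^bsub>D\<^esub> v)" using that t(1) by simp
    then show ?thesis using that t(1) by (auto simp: p.R.m_assoc)
  qed
  have ex: "\<exists>d\<in>carrier D. p d = r" if "r \<in> carrier R" for r
    using that surj by (metis imageE)
  have ex': "\<exists>d\<in>carrier D - P. p d = r" if "r \<in> carrier R - Q" for r
    using ex[of r] that PQ by blast
  {
    assume V: "valuation_at R Q"
    show "valuation_at D P" unfolding valuation_at_def
    proof (intro ballI)
      fix x y assume x: "x \<in> carrier D" and y: "y \<in> carrier D"
      have "\<exists>\<sigma>\<in>carrier R - Q. \<exists>\<rho>\<in>carrier R. \<sigma> \<otimes>\<^bsub>R\<^esub> p x = \<rho> \<otimes>\<^bsub>R\<^esub> p y \<or> \<sigma> \<otimes>\<^bsub>R\<^esub> p y = \<rho> \<otimes>\<^bsub>R\<^esub> p x"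
        using V p.hom_closed[OF x] p.hom_closed[OF y] by (simp add: valuation_at_def)
      then obtain s r where s: "s \<in> carrier D - P" and r: "r \<in> carrier D"
        and "p s \<otimes>\<^bsub>R\<^esub> p x = p r \<otimes>\<^bsub>R\<^esub> p y \<or> p s \<otimes>\<^bsub>R\<^esub> p y = p r \<otimes>\<^bsub>R\<^esub> p x"
        using ex ex' by metis
      then obtain t where t: "t \<in> carrier D - P"
        and "(t \<otimes>\<^bsub>D\<^esub> s) \<otimes>\<^bsub>D\<^esub> x = (t \<otimes>\<^bsub>D\<^esub> r) \<otimes>\<^bsub>D\<^esub> y \<or> (t \<otimes>\<^bsub>D\<^esub> s) \<otimes>\<^bsub>D\<^esub> y = (t \<otimes>\<^bsub>D\<^esub> r) \<otimes>\<^bsub>D\<^esub> x"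
        using lift[of s r x y] lift[of s r y x] x y by blast
      moreover have "t \<otimes>\<^bsub>D\<^esub> s \<in> carrier D - P"
        by (rule p.R.maximalideal_complement_mult[OF P t s])
      moreover have "t \<otimes>\<^bsub>D\<^esub> r \<in> carrier D" using t r by simp
      ultimately show "\<exists>s\<in>carrier D - P. \<exists>r\<in>carrier D. s \<otimes>\<^bsub>D\<^esub> x = r \<otimes>\<^bsub>D\<^esub> y \<or> s \<otimes>\<^bsub>D\<^esub> y = r \<otimes>\<^bsub>D\<^esub> x"
        by blast
    qed
  next
    assume dom: "domain_at R Q"
    show "domain_at D P" unfolding domain_at_def
    proof (intro ballI impI)
      fix x y assume x: "x \<in> carrier D" and y: "y \<in> carrier D" and xy: "x \<otimes>\<^bsub>D\<^esub> y = \<zero>\<^bsub>D\<^esub>"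
      have "p x \<otimes>\<^bsub>R\<^esub> p y = \<zero>\<^bsub>R\<^esub>" using x y xy p.hom_mult[of x y] by simp
      then have "\<exists>\<sigma>\<in>carrier R - Q. \<sigma> \<otimes>\<^bsub>R\<^esub> p x = \<zero>\<^bsub>R\<^esub> \<or> \<sigma> \<otimes>\<^bsub>R\<^esub> p y = \<zero>\<^bsub>R\<^esub>"
        using dom p.hom_closed[OF x] p.hom_closed[OF y] by (simp add: domain_at_def)
      then obtain s where s: "s \<in> carrier D - P"
        and "p s \<otimes>\<^bsub>R\<^esub> p x = \<zero>\<^bsub>R\<^esub> \<or> p s \<otimes>\<^bsub>R\<^esub> p y = \<zero>\<^bsub>R\<^esub>"
        using ex' by metis
      then have "p s \<otimes>\<^bsub>R\<^esub> p x = p \<zero>\<^bsub>D\<^esub> \<otimes>\<^bsub>R\<^esub> p x \<or> p s \<otimes>\<^bsub>R\<^esub> p y = p \<zero>\<^bsub>D\<^esub> \<otimes>\<^bsub>R\<^esub> p y"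
        using x y by simp
      then obtain t where t: "t \<in> carrier D - P"
        and "(t \<otimes>\<^bsub>D\<^esub> s) \<otimes>\<^bsub>D\<^esub> x = (t \<otimes>\<^bsub>D\<^esub> \<zero>\<^bsub>D\<^esub>) \<otimes>\<^bsub>D\<^esub> x \<or> (t \<otimes>\<^bsub>D\<^esub> s) \<otimes>\<^bsub>D\<^esub> y = (t \<otimes>\<^bsub>D\<^esub> \<zero>\<^bsub>D\<^esub>) \<otimes>\<^bsub>D\<^esub> y"
        using lift[of s "\<zero>\<^bsub>D\<^esub>" x x] lift[of s "\<zero>\<^bsub>D\<^esub>" y y] x y s by blast
      then have "(t \<otimes>\<^bsub>D\<^esub> s) \<otimes>\<^bsub>D\<^esub> x = \<zero>\<^bsub>D\<^esub> \<or> (t \<otimes>\<^bsub>D\<^esub> s) \<otimes>\<^bsub>D\<^esub> y = \<zero>\<^bsub>D\<^esub>"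
        using t x y by simp
      then show "\<exists>s\<in>carrier D - P. s \<otimes>\<^bsub>D\<^esub> x = \<zero>\<^bsub>D\<^esub> \<or> s \<otimes>\<^bsub>D\<^esub> y = \<zero>\<^bsub>D\<^esub>"
        using p.R.maximalideal_complement_mult[OF P t s] by blast
    qed
  }
qed

text \<open>
  Elements outside \<open>P\<close> become invertible at \<open>P\<close>, and the localization is not the zero ring, so
  they are not killed there.
\<close>
lemma (in cring) vanishes_at_subset:
  assumes P: "maximalideal P R" and K: "K \<subseteq> carrier R" and "vanishes_at R P K"
  shows "K \<subseteq> P"
proof
  interpret P: maximalideal P R by (rule P)
  fix x assume x: "x \<in> K"
  then obtain s where s: "s \<in> carrier R - P" "s \<otimes> x = \<zero>" using assms(3) by (auto simp: vanishes_at_def)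
  show "x \<in> P"
  proof (rule ccontr)
    assume "x \<notin> P"
    then have "s \<otimes> x \<in> carrier R - P" using x K s by (intro maximalideal_complement_mult[OF P]) auto
    then show False using s(2) P.zero_closed by simp
  qed
qed

lemma semihereditary_at_kernel:
  assumes "cring D" "cring R" and p: "p \<in> ring_hom D R" and surj: "p ` carrier D = carrier R"
    and P: "maximalideal P D" and K: "vanishes_at D P (a_kernel D R p)" and R: "semihereditary R"
  shows "valuation_at D P \<and> domain_at D P"
proof -
  interpret p: ring_hom_cring D R p by (rule ring_hom_cring_of_hom) fact+
  have "a_kernel D R p \<subseteq> carrier D" unfolding a_kernel_def' by blast
  then have "a_kernel D R p \<subseteq> P" by (rule p.R.vanishes_at_subset[OF P _ K])
  note im = surjective_maximalideal_image[OF assms(1,2) p surj P this]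
  show ?thesis
    using local_properties_vimage[OF assms(1,2) p surj P im(2) K] p.S.semihereditary_valuation_at[OF R im(1)]
      p.S.semihereditary_domain_at[OF R im(1)] by blast
qed

lemma (in cring) ideals_trivial_Int_mult:
  assumes "ideal K R" "ideal L R" "K \<inter> L = {\<zero>}" "k \<in> K" "l \<in> L"
  shows "k \<otimes> l = \<zero>"
proof -
  interpret K: ideal K R by fact
  interpret L: ideal L R by fact
  have "k \<otimes> l \<in> K \<inter> L" using assms(4,5) K.I_r_closed L.I_l_closed by auto
  then show ?thesis using assms(3) by simp
qed

lemma (in cring) vanishes_at_of_not_subset:
  assumes "ideal K R" "ideal L R" "K \<inter> L = {\<zero>}" "\<not> K \<subseteq> P"
  shows "vanishes_at R P L"
  unfolding vanishes_at_def
proof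
  fix l assume l: "l \<in> L"
  obtain k where k: "k \<in> K" "k \<notin> P" using assms(4) by blast
  have "k \<in> carrier R" by (rule ideal.Icarr[OF assms(1) k(1)])
  then show "\<exists>s\<in>carrier R - P. s \<otimes> l = \<zero>"
    using ideals_trivial_Int_mult[OF assms(1-3) k(1) l] k(2) by blast
qed

lemma (in cring) vanishes_at_one_of:
  assumes "ideal K R" "ideal L R" "K \<inter> L = {\<zero>}" and P: "maximalideal P R" and D: "domain_at R P"
  shows "vanishes_at R P K \<or> vanishes_at R P L"
proof (rule ccontr)
  assume "\<not> ?thesis"
  then obtain k l where k: "k \<in> K" "\<And>s. s \<in> carrier R - P \<Longrightarrow> s \<otimes> k \<noteq> \<zero>"
    and l: "l \<in> L" "\<And>s. s \<in> carrier R - P \<Longrightarrow> s \<otimes> l \<noteq> \<zero>"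
    unfolding vanishes_at_def by blast
  have "k \<in> carrier R" "l \<in> carrier R"
    using ideal.Icarr[OF assms(1) k(1)] ideal.Icarr[OF assms(2) l(1)] by auto
  moreover have "k \<otimes> l = \<zero>" by (rule ideals_trivial_Int_mult[OF assms(1-3) k(1) l(1)])
  ultimately obtain s where s: "s \<in> carrier R - P" "s \<otimes> k = \<zero> \<or> s \<otimes> l = \<zero>"
    using D by (auto simp: domain_at_def)
  then show False using k(2)[OF s(1)] l(2)[OF s(1)] by simp
qed

lemma semihereditary_subdirect:
  assumes "cring D" "cring R" "cring S"
    and p: "p \<in> ring_hom D R" "p ` carrier D = carrier R"
    and q: "q \<in> ring_hom D S" "q ` carrier D = carrier S"
    and ker: "a_kernel D R p \<inter> a_kernel D S q = {\<zero>\<^bsub>D\<^esub>}"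
    and noeth: "noetherian_ring R" "noetherian_ring S"
    and sh: "semihereditary R" "semihereditary S"
    and loc: "\<And>P. maximalideal P D \<Longrightarrow> a_kernel D R p \<subseteq> P \<Longrightarrow> a_kernel D S q \<subseteq> P \<Longrightarrow>
       vanishes_at D P (a_kernel D R p) \<or> vanishes_at D P (a_kernel D S q)"
  shows "semihereditary D"
proof -
  interpret p: ring_hom_cring D R p by (rule ring_hom_cring_of_hom) fact+
  interpret q: ring_hom_cring D S q by (rule ring_hom_cring_of_hom) fact+
  note id = p.ring.kernel_is_ideal q.ring.kernel_is_ideal
  have ker': "a_kernel D S q \<inter> a_kernel D R p = {\<zero>\<^bsub>D\<^esub>}" using ker by blast
  show ?thesis
  proof (rule p.R.noetherian_semihereditaryI)
    show "noetherian_ring D" by (rule noetherian_subdirect) fact+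
    fix P assume P: "maximalideal P D"
    have "vanishes_at D P (a_kernel D R p) \<or> vanishes_at D P (a_kernel D S q)"
      using loc[OF P] p.R.vanishes_at_of_not_subset[OF id ker]
        p.R.vanishes_at_of_not_subset[OF id(2,1) ker'] by blast
    then show "valuation_at D P \<and> domain_at D P"
      using semihereditary_at_kernel[OF assms(1,2) p P _ sh(1)]
        semihereditary_at_kernel[OF assms(1,3) q P _ sh(2)] by blast
  qed
qed

text \<open>
  Write \<open>K = ker p\<close> and let \<open>P\<close> be the preimage of \<open>Q\<close>.  Divisibility in \<open>R\<^sub>Q\<close> is total since
  \<open>R\<^sub>Q\<close> is a quotient of \<open>D\<^sub>P\<close>.  Let \<open>x y \<in> K\<close>.  If \<open>K\<close> vanishes at \<open>P\<close>, then \<open>D\<^sub>P\<close> being a domain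
  suffices.  Otherwise \<open>L\<close> vanishes at \<open>P\<close>; if, say, \<open>s x = r y\<close>, then
  \<open>(s x)\<^sup>2 = s r x y \<in> K\<close>, so \<open>s x \<in> K + L\<close> by radicality, and \<open>s x\<close> lies in \<open>K\<close> locally.
\<close>
lemma semihereditary_subdirect_factor:
  assumes "cring D" "cring R" and p: "p \<in> ring_hom D R" and surj: "p ` carrier D = carrier R"
    and L: "ideal L D" and KL: "a_kernel D R p \<inter> L = {\<zero>\<^bsub>D\<^esub>}"
    and rad: "\<And>x. x \<in> carrier D \<Longrightarrow> x \<otimes>\<^bsub>D\<^esub> x \<in> a_kernel D R p <+>\<^bsub>D\<^esub> L \<Longrightarrow> x \<in> a_kernel D R p <+>\<^bsub>D\<^esub> L"
    and noeth: "noetherian_ring D" and sh: "semihereditary D"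
  shows "semihereditary R"
proof -
  interpret p: ring_hom_cring D R p by (rule ring_hom_cring_of_hom) fact+
  interpret L: ideal L D by (rule L)
  let ?K = "a_kernel D R p"
  have K: "ideal ?K D" by (rule p.ring.kernel_is_ideal)
  interpret K: ideal ?K D by (rule K)
  show ?thesis
  proof (rule p.S.noetherian_semihereditaryI)
    show "noetherian_ring R" by (rule noetherian_surjective_image) fact+
    fix Q assume Q: "maximalideal Q R"
    interpret Q: maximalideal Q R by (rule Q)
    define P where "P = {d \<in> carrier D. p d \<in> Q}"
    have P: "maximalideal P D" unfolding P_def by (rule surjective_maximalideal_vimage) fact+
    have PQ: "p d \<in> carrier R - Q" if "d \<in> carrier D - P" for d using that by (auto simp: P_def)
    have V: "valuation_at D P" and dom: "domain_at D P"
      using p.R.semihereditary_valuation_at[OF sh P] p.R.semihereditary_domain_at[OF sh P] by auto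
    have "valuation_at R Q" unfolding valuation_at_def
    proof (intro ballI)
      fix u v assume "u \<in> carrier R" "v \<in> carrier R"
      then obtain x y where x: "x \<in> carrier D" "y \<in> carrier D" "u = p x" "v = p y" using surj by blast
      obtain s r where s: "s \<in> carrier D - P" "r \<in> carrier D"
        "s \<otimes>\<^bsub>D\<^esub> x = r \<otimes>\<^bsub>D\<^esub> y \<or> s \<otimes>\<^bsub>D\<^esub> y = r \<otimes>\<^bsub>D\<^esub> x"
        using V x unfolding valuation_at_def by blast
      then have "p (s \<otimes>\<^bsub>D\<^esub> x) = p (r \<otimes>\<^bsub>D\<^esub> y) \<or> p (s \<otimes>\<^bsub>D\<^esub> y) = p (r \<otimes>\<^bsub>D\<^esub> x)" by metis
      then have "p s \<otimes>\<^bsub>R\<^esub> u = p r \<otimes>\<^bsub>R\<^esub> v \<or> p s \<otimes>\<^bsub>R\<^esub> v = p r \<otimes>\<^bsub>R\<^esub> u" using x s by simp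
      then show "\<exists>s\<in>carrier R - Q. \<exists>r\<in>carrier R. s \<otimes>\<^bsub>R\<^esub> u = r \<otimes>\<^bsub>R\<^esub> v \<or> s \<otimes>\<^bsub>R\<^esub> v = r \<otimes>\<^bsub>R\<^esub> u"
        using PQ[OF s(1)] p.hom_closed[OF s(2)] by blast
    qed
    moreover have cancel: "\<exists>s\<in>carrier D - P. s \<otimes>\<^bsub>D\<^esub> x \<in> ?K \<or> s \<otimes>\<^bsub>D\<^esub> y \<in> ?K"
      if x: "x \<in> carrier D" and y: "y \<in> carrier D" and xy: "x \<otimes>\<^bsub>D\<^esub> y \<in> ?K" for x y
    proof (cases "vanishes_at D P ?K")
      case True
      then obtain t where t: "t \<in> carrier D - P" "t \<otimes>\<^bsub>D\<^esub> (x \<otimes>\<^bsub>D\<^esub> y) = \<zero>\<^bsub>D\<^esub>"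
        using xy by (auto simp: vanishes_at_def)
      then have "(t \<otimes>\<^bsub>D\<^esub> x) \<otimes>\<^bsub>D\<^esub> y = \<zero>\<^bsub>D\<^esub>" using x y by (simp add: p.R.m_assoc)
      then obtain s where s: "s \<in> carrier D - P" "s \<otimes>\<^bsub>D\<^esub> (t \<otimes>\<^bsub>D\<^esub> x) = \<zero>\<^bsub>D\<^esub> \<or> s \<otimes>\<^bsub>D\<^esub> y = \<zero>\<^bsub>D\<^esub>"
        using dom[unfolded domain_at_def, rule_format, of "t \<otimes>\<^bsub>D\<^esub> x" y] t(1) x y by blast
      from s(2) show ?thesis
      proof
        assume "s \<otimes>\<^bsub>D\<^esub> (t \<otimes>\<^bsub>D\<^esub> x) = \<zero>\<^bsub>D\<^esub>"
        then have "(s \<otimes>\<^bsub>D\<^esub> t) \<otimes>\<^bsub>D\<^esub> x \<in> ?K" using s(1) t(1) x K.zero_closed by (simp add: p.R.m_assoc)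
        then show ?thesis using p.R.maximalideal_complement_mult[OF P s(1) t(1)] by blast
      next
        assume "s \<otimes>\<^bsub>D\<^esub> y = \<zero>\<^bsub>D\<^esub>"
        then show ?thesis using s(1) K.zero_closed by metis
      qed
    next
      case False
      then have van: "vanishes_at D P L" using p.R.vanishes_at_one_of[OF K L KL P dom] by blast
      have key: "\<exists>t\<in>carrier D - P. t \<otimes>\<^bsub>D\<^esub> a \<in> ?K"
        if a: "a \<in> carrier D" and b: "b \<in> carrier D" and ab: "a \<otimes>\<^bsub>D\<^esub> b \<in> ?K"
          and s: "s \<in> carrier D - P" and r: "r \<in> carrier D" and e: "s \<otimes>\<^bsub>D\<^esub> a = r \<otimes>\<^bsub>D\<^esub> b" for a b s r
      proof -
        have sa: "s \<otimes>\<^bsub>D\<^esub> a \<in> carrier D" using s a by simp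
        have "(s \<otimes>\<^bsub>D\<^esub> a) \<otimes>\<^bsub>D\<^esub> (s \<otimes>\<^bsub>D\<^esub> a) = (s \<otimes>\<^bsub>D\<^esub> a) \<otimes>\<^bsub>D\<^esub> (r \<otimes>\<^bsub>D\<^esub> b)" using e by simp
        also have "\<dots> = (s \<otimes>\<^bsub>D\<^esub> r) \<otimes>\<^bsub>D\<^esub> (a \<otimes>\<^bsub>D\<^esub> b)" using a b r s by (simp add: p.R.m_ac)
        also have "\<dots> \<in> ?K" using K.I_l_closed[OF ab] s r by simp
        finally have "(s \<otimes>\<^bsub>D\<^esub> a) \<otimes>\<^bsub>D\<^esub> (s \<otimes>\<^bsub>D\<^esub> a) \<in> ?K" .
        moreover have "?K \<subseteq> ?K <+>\<^bsub>D\<^esub> L"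
        proof
          fix k assume k: "k \<in> ?K"
          then have "k = k \<oplus>\<^bsub>D\<^esub> \<zero>\<^bsub>D\<^esub>" using K.Icarr by simp
          then show "k \<in> ?K <+>\<^bsub>D\<^esub> L" using k L.zero_closed unfolding set_add_def' by blast
        qed
        ultimately have "s \<otimes>\<^bsub>D\<^esub> a \<in> ?K <+>\<^bsub>D\<^esub> L" using rad[OF sa] by blast
        then obtain k l where kl: "k \<in> ?K" "l \<in> L" "s \<otimes>\<^bsub>D\<^esub> a = k \<oplus>\<^bsub>D\<^esub> l"
          unfolding set_add_def' by blast
        obtain t where t: "t \<in> carrier D - P" "t \<otimes>\<^bsub>D\<^esub> l = \<zero>\<^bsub>D\<^esub>"
          using van kl(2) by (auto simp: vanishes_at_def)
        have "(t \<otimes>\<^bsub>D\<^esub> s) \<otimes>\<^bsub>D\<^esub> a = t \<otimes>\<^bsub>D\<^esub> (k \<oplus>\<^bsub>D\<^esub> l)" using t(1) s a kl(3) by (simp add: p.R.m_assoc)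
        also have "\<dots> = t \<otimes>\<^bsub>D\<^esub> k" using t kl K.Icarr L.Icarr by (simp add: p.R.r_distr)
        also have "\<dots> \<in> ?K" using K.I_l_closed[OF kl(1)] t(1) by simp
        finally show ?thesis using p.R.maximalideal_complement_mult[OF P t(1) s] by blast
      qed
      obtain s r where s: "s \<in> carrier D - P" "r \<in> carrier D"
        and "s \<otimes>\<^bsub>D\<^esub> x = r \<otimes>\<^bsub>D\<^esub> y \<or> s \<otimes>\<^bsub>D\<^esub> y = r \<otimes>\<^bsub>D\<^esub> x"
        using V x y unfolding valuation_at_def by blast
      then show ?thesis
        using key[OF x y xy s] key[OF y x _ s] xy p.R.m_comm[OF x y] by metis
    qed
    moreover have "domain_at R Q" unfolding domain_at_def
    proof (intro ballI impI)
      fix u v assume "u \<in> carrier R" "v \<in> carrier R" and uv: "u \<otimes>\<^bsub>R\<^esub> v = \<zero>\<^bsub>R\<^esub>"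
      then obtain x y where x: "x \<in> carrier D" "y \<in> carrier D" "u = p x" "v = p y" using surj by blast
      have "p (x \<otimes>\<^bsub>D\<^esub> y) = \<zero>\<^bsub>R\<^esub>" using x uv by simp
      then have "x \<otimes>\<^bsub>D\<^esub> y \<in> ?K" unfolding a_kernel_iff using x by blast
      then obtain s where s: "s \<in> carrier D - P" "s \<otimes>\<^bsub>D\<^esub> x \<in> ?K \<or> s \<otimes>\<^bsub>D\<^esub> y \<in> ?K"
        using cancel x by blast
      then have "p (s \<otimes>\<^bsub>D\<^esub> x) = \<zero>\<^bsub>R\<^esub> \<or> p (s \<otimes>\<^bsub>D\<^esub> y) = \<zero>\<^bsub>R\<^esub>" unfolding a_kernel_iff by blast
      then have "p s \<otimes>\<^bsub>R\<^esub> u = \<zero>\<^bsub>R\<^esub> \<or> p s \<otimes>\<^bsub>R\<^esub> v = \<zero>\<^bsub>R\<^esub>" using x s(1) by simp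
      then show "\<exists>s\<in>carrier R - Q. s \<otimes>\<^bsub>R\<^esub> u = \<zero>\<^bsub>R\<^esub> \<or> s \<otimes>\<^bsub>R\<^esub> v = \<zero>\<^bsub>R\<^esub>" using PQ[OF s(1)] by blast
    qed
    ultimately show "valuation_at R Q \<and> domain_at R Q" by blast
  qed
qed

section \<open>Bi-amalgamations as subdirect products\<close>

lemma local_ideal_zero_iff:
  assumes "cring R" and S: "mult_subset R S" and J: "ideal J R"
  shows "local_ideal R S J = {\<zero>\<^bsub>localization R S\<^esub>} \<longleftrightarrow> (\<forall>j\<in>J. \<exists>t\<in>S. t \<otimes>\<^bsub>R\<^esub> j = \<zero>\<^bsub>R\<^esub>)"
proof -
  interpret cring R by fact
  interpret J: ideal J R by fact
  have Sc: "t \<in> carrier R" if "t \<in> S" for t using S that by (auto simp: mult_subset_def)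
  have one: "\<one>\<^bsub>R\<^esub> \<in> S" and mult: "\<And>s t. s \<in> S \<Longrightarrow> t \<in> S \<Longrightarrow> s \<otimes>\<^bsub>R\<^esub> t \<in> S"
    using S by (auto simp: mult_subset_def)
  have eq: "loc_frac R S j s = \<zero>\<^bsub>localization R S\<^esub> \<longleftrightarrow> (\<exists>t\<in>S. t \<otimes>\<^bsub>R\<^esub> j = \<zero>\<^bsub>R\<^esub>)"
    if "j \<in> J" "s \<in> S" for j s
  proof -
    have "\<zero>\<^bsub>localization R S\<^esub> = loc_frac R S \<zero>\<^bsub>R\<^esub> \<one>\<^bsub>R\<^esub>" by (simp add: localization_def)
    then show ?thesis
      using that one Sc J.Icarr by (auto simp: frac_eq_iff[OF assms(1) S])
  qed
  have mem: "loc_frac R S j s \<in> local_ideal R S J" if "j \<in> J" "s \<in> S" for j s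
    using that unfolding local_ideal_def by blast
  have zero: "\<zero>\<^bsub>localization R S\<^esub> \<in> local_ideal R S J"
    using mem[OF J.zero_closed one] by (simp add: localization_def)
  show ?thesis
  proof
    assume *: "local_ideal R S J = {\<zero>\<^bsub>localization R S\<^esub>}"
    show "\<forall>j\<in>J. \<exists>t\<in>S. t \<otimes>\<^bsub>R\<^esub> j = \<zero>\<^bsub>R\<^esub>"
    proof
      fix j assume j: "j \<in> J"
      show "\<exists>t\<in>S. t \<otimes>\<^bsub>R\<^esub> j = \<zero>\<^bsub>R\<^esub>" using * eq[OF j one] mem[OF j one] by blast
    qed
  next
    assume *: "\<forall>j\<in>J. \<exists>t\<in>S. t \<otimes>\<^bsub>R\<^esub> j = \<zero>\<^bsub>R\<^esub>"
    have "X = \<zero>\<^bsub>localization R S\<^esub>" if "X \<in> local_ideal R S J" for X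
      using that * eq by (auto simp: local_ideal_def)
    then show "local_ideal R S J = {\<zero>\<^bsub>localization R S\<^esub>}" using zero by blast
  qed
qed

lemma image_mult_set_iff:
  "x \<in> image_mult_set A B f J \<mm> \<longleftrightarrow>
    (\<exists>a j. a \<in> carrier A - \<mm> \<and> j \<in> J \<and> x = f a \<oplus>\<^bsub>B\<^esub> j)"
  by (auto simp: image_mult_set_def set_add_def set_mult_def)

lemma image_plus_ideal_simps:
  "carrier (image_plus_ideal A B f J) = f ` carrier A <+>\<^bsub>B\<^esub> J"
  "x \<oplus>\<^bsub>image_plus_ideal A B f J\<^esub> y = x \<oplus>\<^bsub>B\<^esub> y"
  "x \<otimes>\<^bsub>image_plus_ideal A B f J\<^esub> y = x \<otimes>\<^bsub>B\<^esub> y"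
  "\<zero>\<^bsub>image_plus_ideal A B f J\<^esub> = \<zero>\<^bsub>B\<^esub>" "\<one>\<^bsub>image_plus_ideal A B f J\<^esub> = \<one>\<^bsub>B\<^esub>"
  by (simp_all add: image_plus_ideal_def)

lemma bi_amalgamation_simps:
  "carrier (bi_amalgamation A B C f g J J') =
     {(f a \<oplus>\<^bsub>B\<^esub> j, g a \<oplus>\<^bsub>C\<^esub> j') | a j j'. a \<in> carrier A \<and> j \<in> J \<and> j' \<in> J'}"
  "x \<oplus>\<^bsub>bi_amalgamation A B C f g J J'\<^esub> y = (fst x \<oplus>\<^bsub>B\<^esub> fst y, snd x \<oplus>\<^bsub>C\<^esub> snd y)"
  "x \<otimes>\<^bsub>bi_amalgamation A B C f g J J'\<^esub> y = (fst x \<otimes>\<^bsub>B\<^esub> fst y, snd x \<otimes>\<^bsub>C\<^esub> snd y)"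
  "\<zero>\<^bsub>bi_amalgamation A B C f g J J'\<^esub> = (\<zero>\<^bsub>B\<^esub>, \<zero>\<^bsub>C\<^esub>)"
  "\<one>\<^bsub>bi_amalgamation A B C f g J J'\<^esub> = (\<one>\<^bsub>B\<^esub>, \<one>\<^bsub>C\<^esub>)"
  by (cases x; cases y; simp add: bi_amalgamation_def RDirProd_def DirProd_def monoid.defs)+

text \<open>
  The powers of an element of \<open>J\<close> are the same in \<open>B\<close> and in the subring \<open>K\<close>, and a semihereditary
  ring is reduced.
\<close>
lemma nilradical_Int_ideal:
  assumes "cring B" and J: "ideal J B" and sh: "semihereditary (B\<lparr>carrier := K\<rparr>)" and "J \<subseteq> K"
  shows "J \<inter> nilradical B = {\<zero>\<^bsub>B\<^esub>}"
proof -
  interpret B: cring B by fact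
  interpret K: cring "B\<lparr>carrier := K\<rparr>" using sh by (simp add: semihereditary_def)
  have "x = \<zero>\<^bsub>B\<^esub>" if x: "x \<in> J" "x \<in> nilradical B" for x
  proof -
    obtain n :: nat where "n > 0" "x [^]\<^bsub>B\<^esub> n = \<zero>\<^bsub>B\<^esub>"
      using x(2) by (auto simp: nilradical_def ring_radical_def)
    then obtain m where "x [^]\<^bsub>B\<^esub> Suc m = \<zero>\<^bsub>B\<^esub>" by (metis Suc_pred)
    then have "x [^]\<^bsub>B\<lparr>carrier := K\<rparr>\<^esub> Suc m = \<zero>\<^bsub>B\<lparr>carrier := K\<rparr>\<^esub>"
      using B.nat_pow_consistent[of x "Suc m" K] by simp
    then show ?thesis using K.semihereditary_reduced[OF sh, of x m] x(1) assms(4) by auto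
  qed
  moreover have "\<zero>\<^bsub>B\<^esub> \<in> nilradical B"
    by (auto simp: nilradical_def ring_radical_def intro!: exI[of _ "1::nat"])
  moreover have "\<zero>\<^bsub>B\<^esub> \<in> J" using J by (simp add: additive_subgroup.zero_closed ideal.axioms(1))
  ultimately show ?thesis by blast
qed

locale bi_amalgamation_data = A: cring A + B: cring B + C: cring C
  for A :: "('a, 'k) ring_scheme" and B :: "('b, 'm) ring_scheme" and C :: "('c, 'n) ring_scheme" +
  fixes f :: "'a \<Rightarrow> 'b" and g :: "'a \<Rightarrow> 'c" and J :: "'b set" and J' :: "'c set"
  assumes f: "f \<in> ring_hom A B" and g: "g \<in> ring_hom A C"
    and J: "ideal J B" and J': "ideal J' C"
    and pre: "\<And>a. a \<in> carrier A \<Longrightarrow> f a \<in> J \<longleftrightarrow> g a \<in> J'"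
begin

abbreviation "D \<equiv> bi_amalgamation A B C f g J J'"
abbreviation "R \<equiv> image_plus_ideal A B f J"
abbreviation "R' \<equiv> image_plus_ideal A C g J'"
abbreviation "K \<equiv> J \<times> {\<zero>\<^bsub>C\<^esub>}"
abbreviation "K' \<equiv> {\<zero>\<^bsub>B\<^esub>} \<times> J'"

lemma rings: "cring D" "cring R" "cring R'"
  by (rule cring_bi_amalgamation cring_image_plus_ideal; fact A.is_cring B.is_cring C.is_cring f g J J')+

sublocale f: ring_hom_cring A B f
  by (rule ring_hom_cring_of_hom[OF A.is_cring B.is_cring f])
sublocale g: ring_hom_cring A C g
  by (rule ring_hom_cring_of_hom[OF A.is_cring C.is_cring g])
sublocale J: ideal J B by (rule J)
sublocale J': ideal J' C by (rule J')

lemma carrier_R: "x \<in> carrier R \<longleftrightarrow> (\<exists>a\<in>carrier A. \<exists>j\<in>J. x = f a \<oplus>\<^bsub>B\<^esub> j)"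
  by (auto simp: image_plus_ideal_simps set_add_def set_mult_def)

lemma carrier_R': "x \<in> carrier R' \<longleftrightarrow> (\<exists>a\<in>carrier A. \<exists>j\<in>J'. x = g a \<oplus>\<^bsub>C\<^esub> j)"
  by (auto simp: image_plus_ideal_simps set_add_def set_mult_def)

lemma carrier_D: "x \<in> carrier D \<longleftrightarrow>
    (\<exists>a\<in>carrier A. \<exists>j\<in>J. \<exists>j'\<in>J'. x = (f a \<oplus>\<^bsub>B\<^esub> j, g a \<oplus>\<^bsub>C\<^esub> j'))"
  by (auto simp: bi_amalgamation_simps)

lemma carrier_DI: "a \<in> carrier A \<Longrightarrow> j \<in> J \<Longrightarrow> j' \<in> J' \<Longrightarrow> (f a \<oplus>\<^bsub>B\<^esub> j, g a \<oplus>\<^bsub>C\<^esub> j') \<in> carrier D"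
  unfolding carrier_D by blast

lemma fst_D: "fst \<in> ring_hom D R" "fst ` carrier D = carrier R"
proof -
  show im: "fst ` carrier D = carrier R"
  proof
    show "fst ` carrier D \<subseteq> carrier R" unfolding image_subset_iff Ball_def carrier_D carrier_R by (metis fst_conv)
    show "carrier R \<subseteq> fst ` carrier D"
    proof
      fix x assume "x \<in> carrier R"
      then obtain a j where a: "a \<in> carrier A" "j \<in> J" "x = f a \<oplus>\<^bsub>B\<^esub> j" unfolding carrier_R by blast
      then show "x \<in> fst ` carrier D"
        using carrier_DI[OF a(1,2) J'.zero_closed] by (metis fst_conv image_eqI)
    qed
  qed
  show "fst \<in> ring_hom D R"
    by (rule ring_hom_memI) (use im in \<open>auto simp: bi_amalgamation_simps(2-) image_plus_ideal_simps(2-)\<close>)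
qed

lemma snd_D: "snd \<in> ring_hom D R'" "snd ` carrier D = carrier R'"
proof -
  show im: "snd ` carrier D = carrier R'"
  proof
    show "snd ` carrier D \<subseteq> carrier R'" unfolding image_subset_iff Ball_def carrier_D carrier_R' by (metis snd_conv)
    show "carrier R' \<subseteq> snd ` carrier D"
    proof
      fix x assume "x \<in> carrier R'"
      then obtain a j where a: "a \<in> carrier A" "j \<in> J'" "x = g a \<oplus>\<^bsub>C\<^esub> j" unfolding carrier_R' by blast
      then show "x \<in> snd ` carrier D"
        using carrier_DI[OF a(1) J.zero_closed a(2)] by (metis snd_conv image_eqI)
    qed
  qed
  show "snd \<in> ring_hom D R'"
    by (rule ring_hom_memI) (use im in \<open>auto simp: bi_amalgamation_simps(2-) image_plus_ideal_simps(2-)\<close>)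
qed

lemma f_add_mem_J: "a \<in> carrier A \<Longrightarrow> j \<in> J \<Longrightarrow> f a \<oplus>\<^bsub>B\<^esub> j \<in> J \<longleftrightarrow> f a \<in> J"
  using J.a_closed J.a_inv_closed J.Icarr B.add.inv_solve_right'
  by (metis B.add.m_assoc B.r_neg B.r_zero f.hom_closed B.a_inv_closed)

lemma g_add_mem_J': "a \<in> carrier A \<Longrightarrow> j \<in> J' \<Longrightarrow> g a \<oplus>\<^bsub>C\<^esub> j \<in> J' \<longleftrightarrow> g a \<in> J'"
  using J'.a_closed J'.a_inv_closed J'.Icarr
  by (metis C.add.m_assoc C.r_neg C.r_zero g.hom_closed C.a_inv_closed)

lemma J_times_J'_subset: "J \<times> J' \<subseteq> carrier D"
proof clarify
  fix j j' assume "j \<in> J" "j' \<in> J'"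
  then show "(j, j') \<in> carrier D"
    using carrier_DI[OF A.zero_closed, of j j'] J.Icarr J'.Icarr by simp
qed

text \<open>
  This is where \<open>f\<inverse>(J) = g\<inverse>(J')\<close> enters: an element of \<open>D\<close> lies over \<open>J\<close> iff it lies over \<open>J'\<close>.  It makes
  the kernels of the projections exactly \<open>0 \<times> J'\<close> and \<open>J \<times> 0\<close>.
\<close>
lemma mem_D_J_iff: "x \<in> carrier D \<Longrightarrow> fst x \<in> J \<longleftrightarrow> snd x \<in> J'"
  unfolding carrier_D using pre by (auto simp: f_add_mem_J g_add_mem_J')

lemma kernel_fst: "a_kernel D R fst = K'"
proof -
  have "x \<in> a_kernel D R fst \<longleftrightarrow> x \<in> K'" for x
    unfolding a_kernel_iff
    using mem_D_J_iff[of x] J_times_J'_subset J.zero_closed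
    by (cases x) (auto simp: image_plus_ideal_simps(2-))
  then show ?thesis by blast
qed

lemma kernel_snd: "a_kernel D R' snd = K"
proof -
  have "x \<in> a_kernel D R' snd \<longleftrightarrow> x \<in> K" for x
    unfolding a_kernel_iff
    using mem_D_J_iff[of x] J_times_J'_subset J'.zero_closed
    by (cases x) (auto simp: image_plus_ideal_simps(2-))
  then show ?thesis by blast
qed

lemma kernels_Int: "K' \<inter> K = {\<zero>\<^bsub>D\<^esub>}"
  using J.zero_closed J'.zero_closed by (auto simp: bi_amalgamation_simps)

lemma kernels_add: "K' <+>\<^bsub>D\<^esub> K = J \<times> J'"
proof -
  have "x \<in> K' <+>\<^bsub>D\<^esub> K \<longleftrightarrow> x \<in> J \<times> J'" for x
    unfolding set_add_def' using J.Icarr J'.Icarr by (cases x) (auto simp: bi_amalgamation_simps)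
  then show ?thesis by blast
qed

lemma ideal_J_times_J': "ideal (J \<times> J') D"
proof -
  interpret D: cring D by (rule rings)
  interpret p: ring_hom_cring D R fst by (rule ring_hom_cring_of_hom[OF rings(1,2) fst_D(1)])
  interpret q: ring_hom_cring D R' snd by (rule ring_hom_cring_of_hom[OF rings(1,3) snd_D(1)])
  have "ideal K' D" "ideal K D"
    using p.ring.kernel_is_ideal q.ring.kernel_is_ideal unfolding kernel_fst kernel_snd by auto
  from D.add_ideals[OF this] show ?thesis unfolding kernels_add .
qed

abbreviation "diag \<equiv> \<lambda>a. (f a, g a)"

lemma diag_hom: "diag \<in> ring_hom A D"
proof (rule ring_hom_memI)
  fix a assume a: "a \<in> carrier A"
  show "diag a \<in> carrier D" using carrier_DI[OF a J.zero_closed J'.zero_closed] a by simp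
qed (auto simp: bi_amalgamation_simps(2-))

lemma diag_plus: "diag ` X <+>\<^bsub>D\<^esub> (J \<times> J') =
    {(f a \<oplus>\<^bsub>B\<^esub> j, g a \<oplus>\<^bsub>C\<^esub> j') | a j j'. a \<in> X \<and> j \<in> J \<and> j' \<in> J'}"
  unfolding set_add_def' by (auto simp: bi_amalgamation_simps(2-); blast)

lemma diag_gen: "carrier D \<subseteq> diag ` carrier A <+>\<^bsub>D\<^esub> (J \<times> J')"
  unfolding diag_plus bi_amalgamation_simps by blast

lemma diag_mem_iff: "a \<in> carrier A \<Longrightarrow> diag a \<in> J \<times> J' \<longleftrightarrow> f a \<in> J"
  using pre by auto

text \<open>
  The maximal ideal of \<open>D\<close> lying over \<open>\<mm> \<in> Max(A, I\<^sub>o)\<close>.  Its complement projects onto the multiplicative sets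
  \<open>S\<^sub>\<mm>\<close> and \<open>S'\<^sub>\<mm>\<close> (lemmas \<open>fst_over\<close> and \<open>snd_over\<close> below), which turns the conditions on
  \<open>J\<^bsub>S\<^sub>\<mm>\<^esub>\<close> and \<open>J'\<^bsub>S'\<^sub>\<mm>\<^esub>\<close> into conditions on the kernels of the projections.
\<close>
definition over :: "'a set \<Rightarrow> ('b \<times> 'c) set"
  where "over \<mm> = diag ` \<mm> <+>\<^bsub>D\<^esub> (J \<times> J')"

context
  fixes \<mm> assumes \<mm>: "\<mm> \<in> max_ideals_over A {a \<in> carrier A. f a \<in> J}"
begin

lemma maximalideal_\<mm>: "maximalideal \<mm> A"
  using \<mm> by (simp add: max_ideals_over_def)

lemma maximalideal_over: "maximalideal (over \<mm>) D"
  and over_iff: "a \<in> carrier A \<Longrightarrow> j \<in> J \<Longrightarrow> j' \<in> J' \<Longrightarrow>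
    (f a \<oplus>\<^bsub>B\<^esub> j, g a \<oplus>\<^bsub>C\<^esub> j') \<in> over \<mm> \<longleftrightarrow> a \<in> \<mm>"
proof -
  have "{a \<in> carrier A. diag a \<in> J \<times> J'} \<subseteq> \<mm>"
    using \<mm> diag_mem_iff by (auto simp: max_ideals_over_def)
  note * = maximalideal_image[OF A.is_cring rings(1) diag_hom maximalideal_\<mm> ideal_J_times_J' this diag_gen,
      folded over_def]
  show "maximalideal (over \<mm>) D" by (rule *(1))
  show "(f a \<oplus>\<^bsub>B\<^esub> j, g a \<oplus>\<^bsub>C\<^esub> j') \<in> over \<mm> \<longleftrightarrow> a \<in> \<mm>"
    if "a \<in> carrier A" "j \<in> J" "j' \<in> J'"
    using *(2)[of a "(j, j')"] that by (simp add: bi_amalgamation_simps(2-))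
qed

lemma fst_over: "fst ` (carrier D - over \<mm>) = image_mult_set A B f J \<mm>"
proof (intro equalityI subsetI)
  fix x assume "x \<in> fst ` (carrier D - over \<mm>)"
  then obtain a j j' where "a \<in> carrier A" "j \<in> J" "j' \<in> J'" "x = f a \<oplus>\<^bsub>B\<^esub> j"
    "(f a \<oplus>\<^bsub>B\<^esub> j, g a \<oplus>\<^bsub>C\<^esub> j') \<notin> over \<mm>" by (force simp: carrier_D)
  then show "x \<in> image_mult_set A B f J \<mm>" unfolding image_mult_set_iff using over_iff by blast
next
  fix x assume "x \<in> image_mult_set A B f J \<mm>"
  then obtain a j where a: "a \<in> carrier A" "a \<notin> \<mm>" "j \<in> J" "x = f a \<oplus>\<^bsub>B\<^esub> j"
    unfolding image_mult_set_iff by blast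
  then have "(f a \<oplus>\<^bsub>B\<^esub> j, g a \<oplus>\<^bsub>C\<^esub> \<zero>\<^bsub>C\<^esub>) \<in> carrier D - over \<mm>"
    using over_iff[OF a(1,3) J'.zero_closed] carrier_DI[OF a(1,3) J'.zero_closed] by blast
  then show "x \<in> fst ` (carrier D - over \<mm>)" unfolding a(4) by (rule image_eqI[rotated]) simp
qed

lemma snd_over: "snd ` (carrier D - over \<mm>) = image_mult_set A C g J' \<mm>"
proof (intro equalityI subsetI)
  fix x assume "x \<in> snd ` (carrier D - over \<mm>)"
  then obtain a j j' where "a \<in> carrier A" "j \<in> J" "j' \<in> J'" "x = g a \<oplus>\<^bsub>C\<^esub> j'"
    "(f a \<oplus>\<^bsub>B\<^esub> j, g a \<oplus>\<^bsub>C\<^esub> j') \<notin> over \<mm>" by (force simp: carrier_D)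
  then show "x \<in> image_mult_set A C g J' \<mm>" unfolding image_mult_set_iff using over_iff by blast
next
  fix x assume "x \<in> image_mult_set A C g J' \<mm>"
  then obtain a j where a: "a \<in> carrier A" "a \<notin> \<mm>" "j \<in> J'" "x = g a \<oplus>\<^bsub>C\<^esub> j"
    unfolding image_mult_set_iff by blast
  then have "(f a \<oplus>\<^bsub>B\<^esub> \<zero>\<^bsub>B\<^esub>, g a \<oplus>\<^bsub>C\<^esub> j) \<in> carrier D - over \<mm>"
    using over_iff[OF a(1) J.zero_closed a(3)] carrier_DI[OF a(1) J.zero_closed a(3)] by blast
  then show "x \<in> snd ` (carrier D - over \<mm>)" unfolding a(4) by (rule image_eqI[rotated]) simp
qed

lemma local_ideal_J_iff:
  "local_ideal B (image_mult_set A B f J \<mm>) J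
      = {\<zero>\<^bsub>localization B (image_mult_set A B f J \<mm>)\<^esub>} \<longleftrightarrow> vanishes_at D (over \<mm>) K"
proof -
  have snd: "snd x \<in> carrier C" if "x \<in> carrier D" for x
    using that J'.Icarr by (auto simp: carrier_D)
  have "vanishes_at D (over \<mm>) K \<longleftrightarrow>
      (\<forall>j\<in>J. \<exists>t\<in>fst ` (carrier D - over \<mm>). t \<otimes>\<^bsub>B\<^esub> j = \<zero>\<^bsub>B\<^esub>)"
    unfolding vanishes_at_def using snd by (simp add: bi_amalgamation_simps(2-))
  moreover have "mult_subset B (image_mult_set A B f J \<mm>)"
    by (rule mult_subset_image_mult_set[OF A.is_cring B.is_cring f J A.maximalideal_prime[OF maximalideal_\<mm>]])
  ultimately show ?thesis unfolding fst_over by (simp add: local_ideal_zero_iff[OF B.is_cring _ J])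
qed

lemma local_ideal_J'_iff:
  "local_ideal C (image_mult_set A C g J' \<mm>) J'
      = {\<zero>\<^bsub>localization C (image_mult_set A C g J' \<mm>)\<^esub>} \<longleftrightarrow> vanishes_at D (over \<mm>) K'"
proof -
  have fst: "fst x \<in> carrier B" if "x \<in> carrier D" for x
    using that J.Icarr by (auto simp: carrier_D)
  have "vanishes_at D (over \<mm>) K' \<longleftrightarrow>
      (\<forall>j\<in>J'. \<exists>t\<in>snd ` (carrier D - over \<mm>). t \<otimes>\<^bsub>C\<^esub> j = \<zero>\<^bsub>C\<^esub>)"
    unfolding vanishes_at_def using fst by (simp add: bi_amalgamation_simps(2-))
  moreover have "mult_subset C (image_mult_set A C g J' \<mm>)"
    by (rule mult_subset_image_mult_set[OF A.is_cring C.is_cring g J' A.maximalideal_prime[OF maximalideal_\<mm>]])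
  ultimately show ?thesis unfolding snd_over by (simp add: local_ideal_zero_iff[OF C.is_cring _ J'])
qed

end

lemma maximalideal_over_J_times_J':
  assumes P: "maximalideal P D" and "J \<times> J' \<subseteq> P"
  obtains \<mm> where "\<mm> \<in> max_ideals_over A {a \<in> carrier A. f a \<in> J}" "P = over \<mm>"
proof -
  interpret P: maximalideal P D by (rule P)
  define \<mm> where "\<mm> = {a \<in> carrier A. diag a \<in> P}"
  have "maximalideal \<mm> A" unfolding \<mm>_def
    by (rule maximalideal_vimage[OF A.is_cring rings(1) diag_hom P assms(2) diag_gen])
  then have \<mm>: "\<mm> \<in> max_ideals_over A {a \<in> carrier A. f a \<in> J}"
    using assms(2) diag_mem_iff unfolding max_ideals_over_def \<mm>_def by blast
  interpret M: maximalideal "over \<mm>" D by (rule maximalideal_over[OF \<mm>])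
  have sub: "over \<mm> \<subseteq> P"
  proof
    fix x assume "x \<in> over \<mm>"
    then obtain u v where "u \<in> diag ` \<mm>" "v \<in> J \<times> J'" "x = u \<oplus>\<^bsub>D\<^esub> v"
      unfolding over_def set_add_def' by blast
    then show "x \<in> P" using assms(2) by (auto simp: \<mm>_def intro!: P.a_closed)
  qed
  have "P = over \<mm>" using M.I_maximal[OF P.is_ideal sub P.a_subset] P.I_notcarr by blast
  then show thesis by (rule that[OF \<mm>])
qed

abbreviation conditions :: bool
  where "conditions \<equiv>
    noetherian_ring R \<and> semihereditary R \<and> noetherian_ring R' \<and> semihereditary R' \<and>
    J \<inter> nilradical B = {\<zero>\<^bsub>B\<^esub>} \<and> J' \<inter> nilradical C = {\<zero>\<^bsub>C\<^esub>} \<and>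
    (\<forall>\<mm> \<in> max_ideals_over A {a \<in> carrier A. f a \<in> J}.
       local_ideal B (image_mult_set A B f J \<mm>) J
         = {\<zero>\<^bsub>localization B (image_mult_set A B f J \<mm>)\<^esub>} \<or>
       local_ideal C (image_mult_set A C g J' \<mm>) J'
         = {\<zero>\<^bsub>localization C (image_mult_set A C g J' \<mm>)\<^esub>})"

lemma bi_amalgamation_noetherian_semihereditary:
  assumes conditions
  shows "noetherian_ring D \<and> semihereditary D"
proof
  have ker: "a_kernel D R fst \<inter> a_kernel D R' snd = {\<zero>\<^bsub>D\<^esub>}"
    unfolding kernel_fst kernel_snd by (rule kernels_Int)
  have noeth: "noetherian_ring R" "noetherian_ring R'" and sh: "semihereditary R" "semihereditary R'"
    using assms by blast+
  show "noetherian_ring D" by (rule noetherian_subdirect[OF rings fst_D snd_D ker noeth])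
  show "semihereditary D"
  proof (rule semihereditary_subdirect[OF rings fst_D snd_D ker noeth sh], unfold kernel_fst kernel_snd)
    fix P assume P: "maximalideal P D" and K: "K' \<subseteq> P" "K \<subseteq> P"
    interpret P: maximalideal P D by (rule P)
    have "J \<times> J' \<subseteq> P" unfolding kernels_add[symmetric] set_add_def' using K P.a_closed by blast
    then obtain \<mm> where \<mm>: "\<mm> \<in> max_ideals_over A {a \<in> carrier A. f a \<in> J}"
      "P = over \<mm>" by (rule maximalideal_over_J_times_J'[OF P])
    have "\<forall>\<mm>\<in>max_ideals_over A {a \<in> carrier A. f a \<in> J}.
        vanishes_at D (over \<mm>) K \<or> vanishes_at D (over \<mm>) K'"
      using assms by (simp add: local_ideal_J_iff local_ideal_J'_iff)
    then have "vanishes_at D (over \<mm>) K \<or> vanishes_at D (over \<mm>) K'" using \<mm>(1) by (rule bspec)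
    then show "vanishes_at D P K' \<or> vanishes_at D P K" unfolding \<mm>(2) by blast
  qed
qed

lemma noetherian_semihereditary_bi_amalgamation:
  assumes rad: "ring_radical A {a \<in> carrier A. f a \<in> J} = {a \<in> carrier A. f a \<in> J}"
    and noeth: "noetherian_ring D" and sh: "semihereditary D"
  shows conditions
proof -
  interpret p: ring_hom_cring D R fst by (rule ring_hom_cring_of_hom[OF rings(1,2) fst_D(1)])
  interpret q: ring_hom_cring D R' snd by (rule ring_hom_cring_of_hom[OF rings(1,3) snd_D(1)])
  have K': "ideal K' D" and K: "ideal K D"
    using p.ring.kernel_is_ideal q.ring.kernel_is_ideal unfolding kernel_fst kernel_snd by auto
  have Int: "K \<inter> K' = {\<zero>\<^bsub>D\<^esub>}" using kernels_Int by blast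
  have add: "K <+>\<^bsub>D\<^esub> K' = J \<times> J'"
    using p.R.set_add_comm[of K K'] kernels_add K K' ideal.Icarr by (metis subsetI)
  \<comment> \<open>Radicality of \<open>I\<^sub>o\<close> enters for squares: \<open>a\<^sup>2 \<in> I\<^sub>o\<close> implies \<open>a \<in> I\<^sub>o\<close>.\<close>
  have rad': "x \<in> J \<times> J'" if x: "x \<in> carrier D" and xx: "x \<otimes>\<^bsub>D\<^esub> x \<in> J \<times> J'" for x
  proof -
    obtain a j j' where a: "a \<in> carrier A" "j \<in> J" "j' \<in> J'" and xa: "x = (f a \<oplus>\<^bsub>B\<^esub> j, g a \<oplus>\<^bsub>C\<^esub> j')"
      using x unfolding carrier_D by blast
    have jc: "j \<in> carrier B" using a(2) by (rule J.Icarr)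
    have "(f a \<oplus>\<^bsub>B\<^esub> j) \<otimes>\<^bsub>B\<^esub> (f a \<oplus>\<^bsub>B\<^esub> j) \<in> J"
      using xx xa by (simp add: bi_amalgamation_simps(2-))
    also have "(f a \<oplus>\<^bsub>B\<^esub> j) \<otimes>\<^bsub>B\<^esub> (f a \<oplus>\<^bsub>B\<^esub> j) =
        f (a \<otimes>\<^bsub>A\<^esub> a) \<oplus>\<^bsub>B\<^esub> (f a \<otimes>\<^bsub>B\<^esub> j \<oplus>\<^bsub>B\<^esub> j \<otimes>\<^bsub>B\<^esub> (f a \<oplus>\<^bsub>B\<^esub> j))"
      using a(1) jc by (simp add: B.l_distr B.r_distr B.a_ac)
    finally have "f (a \<otimes>\<^bsub>A\<^esub> a) \<oplus>\<^bsub>B\<^esub> (f a \<otimes>\<^bsub>B\<^esub> j \<oplus>\<^bsub>B\<^esub> j \<otimes>\<^bsub>B\<^esub> (f a \<oplus>\<^bsub>B\<^esub> j)) \<in> J" .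
    moreover have "f a \<otimes>\<^bsub>B\<^esub> j \<oplus>\<^bsub>B\<^esub> j \<otimes>\<^bsub>B\<^esub> (f a \<oplus>\<^bsub>B\<^esub> j) \<in> J"
      using a jc by (simp add: J.a_closed J.I_l_closed J.I_r_closed)
    ultimately have "f (a \<otimes>\<^bsub>A\<^esub> a) \<in> J" using f_add_mem_J[OF A.m_closed[OF a(1) a(1)]] by metis
    then have "f (a [^]\<^bsub>A\<^esub> (2::nat)) \<in> J" using a(1) by (simp add: numeral_2_eq_2)
    then have "a \<in> ring_radical A {a \<in> carrier A. f a \<in> J}"
      unfolding ring_radical_def using a(1) by (auto intro!: exI[of _ "2::nat"])
    then have "f a \<in> J" using rad by blast
    then show ?thesis using a xa pre[OF a(1)] by (auto intro: J.a_closed J'.a_closed)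
  qed
  have shR: "semihereditary R"
    by (rule semihereditary_subdirect_factor[OF rings(1,2) fst_D K, unfolded kernel_fst kernels_add,
          OF kernels_Int rad' noeth sh])
  have shR': "semihereditary R'"
    by (rule semihereditary_subdirect_factor[OF rings(1,3) snd_D K', unfolded kernel_snd add,
          OF Int rad' noeth sh])
  have "J \<subseteq> f ` carrier A <+>\<^bsub>B\<^esub> J"
    using carrier_R J.Icarr f.hom_zero A.zero_closed B.l_zero unfolding image_plus_ideal_simps by (metis subsetI)
  then have nil: "J \<inter> nilradical B = {\<zero>\<^bsub>B\<^esub>}"
    by (rule nilradical_Int_ideal[OF B.is_cring J shR[unfolded image_plus_ideal_def]])
  have "J' \<subseteq> g ` carrier A <+>\<^bsub>C\<^esub> J'"
    using carrier_R' J'.Icarr g.hom_zero A.zero_closed C.l_zero unfolding image_plus_ideal_simps by (metis subsetI)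
  then have nil': "J' \<inter> nilradical C = {\<zero>\<^bsub>C\<^esub>}"
    by (rule nilradical_Int_ideal[OF C.is_cring J' shR'[unfolded image_plus_ideal_def]])
  have "vanishes_at D (over \<mm>) K \<or> vanishes_at D (over \<mm>) K'"
    if "\<mm> \<in> max_ideals_over A {a \<in> carrier A. f a \<in> J}" for \<mm>
    by (rule p.R.vanishes_at_one_of[OF K K' Int maximalideal_over[OF that]
          p.R.semihereditary_domain_at[OF sh maximalideal_over[OF that]]])
  then show conditions
    using noetherian_surjective_image[OF rings(1,2) fst_D noeth]
      noetherian_surjective_image[OF rings(1,3) snd_D noeth] shR shR' nil nil'
    by (simp add: local_ideal_J_iff local_ideal_J'_iff)
qed

end

theorem corollary2p11:
  fixes A :: "('a, 'k) ring_scheme" and B :: "('b, 'm) ring_scheme" and C :: "('c, 'n) ring_scheme"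
    and f :: "'a \<Rightarrow> 'b" and g :: "'a \<Rightarrow> 'c"
    and J :: "'b set" and J' :: "'c set" and I\<^sub>o :: "'a set"
  assumes "cring A" and "cring B" and "cring C"
    and "f \<in> ring_hom A B" and "g \<in> ring_hom A C"
    and "ideal J B" and "J \<noteq> carrier B"
    and "ideal J' C" and "J' \<noteq> carrier C"
    and "I\<^sub>o = {a \<in> carrier A. f a \<in> J}"
    and "I\<^sub>o = {a \<in> carrier A. g a \<in> J'}"
  shows
    "(noetherian_ring (image_plus_ideal A B f J) \<and> semihereditary (image_plus_ideal A B f J) \<and>
      noetherian_ring (image_plus_ideal A C g J') \<and> semihereditary (image_plus_ideal A C g J') \<and>
      J \<inter> nilradical B = {\<zero>\<^bsub>B\<^esub>} \<and> J' \<inter> nilradical C = {\<zero>\<^bsub>C\<^esub>} \<and>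
      (\<forall>\<mm> \<in> max_ideals_over A I\<^sub>o.
         local_ideal B (image_mult_set A B f J \<mm>) J
           = {\<zero>\<^bsub>localization B (image_mult_set A B f J \<mm>)\<^esub>} \<or>
         local_ideal C (image_mult_set A C g J' \<mm>) J'
           = {\<zero>\<^bsub>localization C (image_mult_set A C g J' \<mm>)\<^esub>})
      \<longrightarrow> noetherian_ring (bi_amalgamation A B C f g J J') \<and>
          semihereditary (bi_amalgamation A B C f g J J')) \<and>
     (ring_radical A I\<^sub>o = I\<^sub>o \<and>
      noetherian_ring (bi_amalgamation A B C f g J J') \<and>
      semihereditary (bi_amalgamation A B C f g J J')
      \<longrightarrow>
      noetherian_ring (image_plus_ideal A B f J) \<and> semihereditary (image_plus_ideal A B f J) \<and>
      noetherian_ring (image_plus_ideal A C g J') \<and> semihereditary (image_plus_ideal A C g J') \<and>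
      J \<inter> nilradical B = {\<zero>\<^bsub>B\<^esub>} \<and> J' \<inter> nilradical C = {\<zero>\<^bsub>C\<^esub>} \<and>
      (\<forall>\<mm> \<in> max_ideals_over A I\<^sub>o.
         local_ideal B (image_mult_set A B f J \<mm>) J
           = {\<zero>\<^bsub>localization B (image_mult_set A B f J \<mm>)\<^esub>} \<or>
         local_ideal C (image_mult_set A C g J' \<mm>) J'
           = {\<zero>\<^bsub>localization C (image_mult_set A C g J' \<mm>)\<^esub>}))"
proof -
  have pre: "f a \<in> J \<longleftrightarrow> g a \<in> J'" if "a \<in> carrier A" for a
    using assms(10,11) that by blast
  interpret bi_amalgamation_data A B C f g J J'
    by (intro bi_amalgamation_data.intro bi_amalgamation_data_axioms.intro assms pre)
  show ?thesis
    using bi_amalgamation_noetherian_semihereditary noetherian_semihereditary_bi_amalgamation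
    unfolding assms(10) by blast
qed

end
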